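(* (In $\mathbf{ZF}$.) Let $\mathbf{X}$ be a non-empty zero-dimensional $T_1$-space. Then the extensions $e_2^{\ast}\mathbf{X}$ and $e_{U_{\aleph_0}^{\ast}(\mathbf{X})}\mathbf{X}$ of $\mathbf{X}$ are equivalent. Furthermore, $$U_{\aleph_0}^{\ast}(\mathbf{X})=\{ f\circ e_2^{\ast}: f\in U_{\aleph_0}^{\ast}(e_2^{\ast}\mathbf{X})\},$$ and the Banaschewski compactification $\beta_0\mathbf{X}$ exists if and only if $e_{U_{\aleph_0}^{\ast}(\mathbf{X})}\mathbf{X}$ is compact.
   Context: The base theory is $\mathbf{ZF}$ (the Axiom of Choice is not assumed). A space is compact if every open cover has a finite subcover, and zero-dimensional if its clopen sets form a base. An extension of $\mathbf{X}$ is a pair $\langle\mathbf{Y},h\rangle$ where $h:\mathbf{X}\to\mathbf{Y}$ is a homeomorphic embedding with dense image; a compactification is a compact extension. Extensions $\langle\mathbf{Y}_1,h_1\rangle$, $\langle\mathbf{Y}_2,h_2\rangle$ are equivalent if there is a homeomorphism $h:\mathbf{Y}_1\to\mathbf{Y}_2$ with $h\circ h_1=h_2$. $C(\mathbf{X})$ is the set of continuous real functions on $\mathbf{X}$, $C^{\ast}(\mathbf{X})$ the set of bounded ones; $\mathbf{2}$ is the discrete space $\{0,1\}$ and $C(\mathbf{X},\mathbf{2})$ is the set of continuous maps $\mathbf{X}\to\mathbf{2}$. For $A\subseteq X$, $\mathrm{osc}_A(f)=\sup\{|f(x)-f(y)|:x,y\in A\}$ if $A\neq\emptyset$ and $\mathrm{osc}_\emptyset(f)=0$.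 $U_{\aleph_0}(\mathbf{X})$ is the set of all $f\in C(\mathbf{X})$ such that for every real $\varepsilon>0$ there is a countable (equipotent to a subset of $\omega$) family $\mathcal{A}$ of clopen subsets of $\mathbf{X}$ with $\bigcup\mathcal{A}=X$ and $\mathrm{osc}_A(f)\leq\varepsilon$ for every $A\in\mathcal{A}$; $U_{\aleph_0}^{\ast}(\mathbf{X})=U_{\aleph_0}(\mathbf{X})\cap C^{\ast}(\mathbf{X})$. $e^{\ast}_2\mathbf{X}$ is the extension given by the closure of $e^{\ast}_2[X]$ in $\mathbf{2}^{C(\mathbf{X},\mathbf{2})}$ together with the evaluation embedding $e^{\ast}_2:\mathbf{X}\to\mathbf{2}^{C(\mathbf{X},\mathbf{2})}$, $e^{\ast}_2(x)(f)=f(x)$. For $\mathcal{F}\subseteq C(\mathbf{X})$ whose evaluation map $e_{\mathcal{F}}:\mathbf{X}\to\mathbb{R}^{\mathcal{F}}$, $e_{\mathcal{F}}(x)(f)=f(x)$, is a homeomorphic embedding (this holds for $\mathcal{F}=U^{\ast}_{\aleph_0}(\mathbf{X})$ when $\mathbf{X}$ is a zero-dimensional $T_1$-space), $e_{\mathcal{F}}\mathbf{X}$ is the extension given by the closure of $e_{\mathcal{F}}[X]$ in $\mathbb{R}^{\mathcal{F}}$ together with $e_{\mathcal{F}}$. A Banaschewski compactification of a zero-dimensional $T_1$-space $\mathbf{X}$ is a zero-dimensional $T_1$-compactification $\beta_0\mathbf{X}$ such that for every compact zero-dimensional $T_1$-space $\mathbf{K}$ and every continuous $f:\mathbf{X}\to\mathbf{K}$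 there is a continuous $\tilde f:\beta_0\mathbf{X}\to\mathbf{K}$ with $\tilde f\circ\beta_0=f$. *)

theory Defs
  imports "HOL-Algebra.Ring"
begin

text \<open>
  The base theory of the result is ZF without the axiom of choice, whereas HOL proves choice (and, for
  instance, the compactness of arbitrary powers of the two-point space) for its own sets.  Hence the
  mathematics is not stated about HOL's sets, but inside an arbitrary model of first-order ZF: a type
  \<open>'a\<close> with a binary relation \<open>mem\<close> satisfying the axioms below.  By the completeness theorem (and
  downward Loewenheim-Skolem) a first-order sentence is a theorem of ZF iff it holds in all of
  these models.

  The replacement and separation schemas range over first-order formulas only.  (With arbitrary HOL
  predicates in place of formulas, HOL's own choice operator would force the axiom of choice to hold
  in the model.)  Accordingly, everything below quantifies only over elements of the model; all
  functions, families, countable and finite sets, and real numbers are those of the model.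
\<close>

datatype fm = Mem nat nat | Eq nat nat | Neg fm | Conj fm fm | Forall nat fm

primrec sat :: "('a \<Rightarrow> 'a \<Rightarrow> bool) \<Rightarrow> fm \<Rightarrow> (nat \<Rightarrow> 'a) \<Rightarrow> bool" where
  "sat mem (Mem i j) s \<longleftrightarrow> mem (s i) (s j)"
| "sat mem (Eq i j) s \<longleftrightarrow> s i = s j"
| "sat mem (Neg p) s \<longleftrightarrow> \<not> sat mem p s"
| "sat mem (Conj p q) s \<longleftrightarrow> sat mem p s \<and> sat mem q s"
| "sat mem (Forall i p) s \<longleftrightarrow> (\<forall>x. sat mem p (s(i := x)))"

text \<open>In the two schemas, the assignment \<open>s\<close> supplies the parameters of the formula.\<close>

locale ZF =
  fixes mem :: "'a \<Rightarrow> 'a \<Rightarrow> bool"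
  assumes extensionality: "(\<forall>x. mem x a \<longleftrightarrow> mem x b) \<Longrightarrow> a = b"
    and foundation: "mem x a \<Longrightarrow> \<exists>y. mem y a \<and> (\<forall>z. \<not> (mem z y \<and> mem z a))"
    and pairing: "\<exists>c. \<forall>x. mem x c \<longleftrightarrow> x = a \<or> x = b"
    and union: "\<exists>c. \<forall>x. mem x c \<longleftrightarrow> (\<exists>y. mem y a \<and> mem x y)"
    and power_set: "\<exists>c. \<forall>x. mem x c \<longleftrightarrow> (\<forall>z. mem z x \<longrightarrow> mem z a)"
    and infinity: "\<exists>w. (\<exists>e. mem e w \<and> (\<forall>z. \<not> mem z e)) \<and>
          (\<forall>n. mem n w \<longrightarrow> (\<exists>m. mem m w \<and> (\<forall>z. mem z m \<longleftrightarrow> mem z n \<or> z = n)))"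
    and separation: "\<exists>b. \<forall>x. mem x b \<longleftrightarrow> mem x a \<and> sat mem p (s(0 := x))"
    and replacement: "(\<forall>x. mem x a \<longrightarrow> (\<exists>!y. sat mem p (s(0 := x, 1 := y)))) \<Longrightarrow>
          \<exists>b. \<forall>y. mem y b \<longleftrightarrow> (\<exists>x. mem x a \<and> sat mem p (s(0 := x, 1 := y)))"

text \<open>A topological space and a structure in the language of ordered fields; all components are
  elements of the model.\<close>

datatype 'a space = Space (pts: 'a) (opens: 'a)

datatype 'a ofield = OField (car: 'a) (rplus: 'a) (rtimes: 'a) (rzero: 'a) (rone: 'a) (leq: 'a)

context
  fixes mem :: "'a \<Rightarrow> 'a \<Rightarrow> bool"
begin

subsection \<open>Sets, functions, cardinality\<close>

definition elts :: "'a \<Rightarrow> 'a set" where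
  "elts a = {x. mem x a}"

text \<open>The element of the model with exactly the given elements.  It is meaningful only where ZF proves
  that there is one; that is the case for each use below.\<close>

definition set_of :: "'a set \<Rightarrow> 'a" where
  "set_of S = (THE a. elts a = S)"

definition vunion :: "'a \<Rightarrow> 'a" where
  "vunion a = set_of (\<Union>y\<in>elts a. elts y)"

definition vpow :: "'a \<Rightarrow> 'a" where
  "vpow a = set_of {b. elts b \<subseteq> elts a}"

definition vpair :: "'a \<Rightarrow> 'a \<Rightarrow> 'a" where
  "vpair a b = set_of {set_of {a}, set_of {a, b}}"

definition vtimes :: "'a \<Rightarrow> 'a \<Rightarrow> 'a" where
  "vtimes A B = set_of {vpair a b | a b. a \<in> elts A \<and> b \<in> elts B}"

definition funs :: "'a \<Rightarrow> 'a \<Rightarrow> 'a" where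
  "funs A B = set_of {f. elts f \<subseteq> elts (vtimes A B) \<and>
     (\<forall>a\<in>elts A. \<exists>!b. vpair a b \<in> elts f)}"

definition app :: "'a \<Rightarrow> 'a \<Rightarrow> 'a" where
  "app f x = (THE y. vpair x y \<in> elts f)"

definition lam :: "'a \<Rightarrow> ('a \<Rightarrow> 'a) \<Rightarrow> 'a" where
  "lam A t = set_of {vpair x (t x) | x. x \<in> elts A}"

definition vcomp :: "'a \<Rightarrow> 'a \<Rightarrow> 'a" where
  "vcomp g f = set_of {vpair x z | x y z. vpair x y \<in> elts f \<and> vpair y z \<in> elts g}"

definition image_set :: "'a \<Rightarrow> 'a \<Rightarrow> 'a" where
  "image_set f A = set_of {app f x | x. x \<in> elts A}"

definition bijection :: "'a \<Rightarrow> 'a \<Rightarrow> 'a \<Rightarrow> bool" where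
  "bijection f A B \<longleftrightarrow> f \<in> elts (funs A B) \<and> (\<forall>b\<in>elts B. \<exists>!a. a \<in> elts A \<and> app f a = b)"

definition equipotent :: "'a \<Rightarrow> 'a \<Rightarrow> bool" where
  "equipotent A B \<longleftrightarrow> (\<exists>f. bijection f A B)"

definition vempty :: 'a where
  "vempty = set_of {}"

definition vsucc :: "'a \<Rightarrow> 'a" where
  "vsucc n = set_of (insert n (elts n))"

definition omega :: 'a where
  "omega = set_of {n. \<forall>w. vempty \<in> elts w \<and> (\<forall>m\<in>elts w. vsucc m \<in> elts w) \<longrightarrow> n \<in> elts w}"

definition vfinite :: "'a \<Rightarrow> bool" where
  "vfinite A \<longleftrightarrow> (\<exists>n\<in>elts omega. equipotent A n)"

definition vcountable :: "'a \<Rightarrow> bool" where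
  "vcountable A \<longleftrightarrow> (\<exists>B. elts B \<subseteq> elts omega \<and> equipotent A B)"

subsection \<open>Topological spaces\<close>

definition is_space :: "'a space \<Rightarrow> bool" where
  "is_space X \<longleftrightarrow> (\<forall>U\<in>elts (opens X). elts U \<subseteq> elts (pts X)) \<and>
     pts X \<in> elts (opens X) \<and>
     (\<forall>U\<in>elts (opens X). \<forall>V\<in>elts (opens X). set_of (elts U \<inter> elts V) \<in> elts (opens X)) \<and>
     (\<forall>\<U>. elts \<U> \<subseteq> elts (opens X) \<longrightarrow> vunion \<U> \<in> elts (opens X))"

definition clopen :: "'a space \<Rightarrow> 'a \<Rightarrow> bool" where
  "clopen X A \<longleftrightarrow> A \<in> elts (opens X) \<and> set_of (elts (pts X) - elts A) \<in> elts (opens X)"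

definition zero_dimensional :: "'a space \<Rightarrow> bool" where
  "zero_dimensional X \<longleftrightarrow>
     (\<forall>U\<in>elts (opens X). \<forall>x\<in>elts U. \<exists>A. clopen X A \<and> x \<in> elts A \<and> elts A \<subseteq> elts U)"

definition T1 :: "'a space \<Rightarrow> bool" where
  "T1 X \<longleftrightarrow> (\<forall>x\<in>elts (pts X). \<forall>y\<in>elts (pts X). x \<noteq> y \<longrightarrow>
     (\<exists>U\<in>elts (opens X). x \<in> elts U \<and> y \<notin> elts U))"

definition compact_space :: "'a space \<Rightarrow> bool" where
  "compact_space X \<longleftrightarrow> (\<forall>\<U>. elts \<U> \<subseteq> elts (opens X) \<and> vunion \<U> = pts X \<longrightarrow>
     (\<exists>\<V>. elts \<V> \<subseteq> elts \<U> \<and> vfinite \<V> \<and> vunion \<V> = pts X))"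

definition subspace_of :: "'a space \<Rightarrow> 'a \<Rightarrow> 'a space" where
  "subspace_of X A = Space A (set_of {set_of (elts U \<inter> elts A) | U. U \<in> elts (opens X)})"

definition closure_in :: "'a space \<Rightarrow> 'a \<Rightarrow> 'a" where
  "closure_in X A = set_of {x \<in> elts (pts X).
     \<forall>U\<in>elts (opens X). x \<in> elts U \<longrightarrow> elts U \<inter> elts A \<noteq> {}}"

text \<open>The set of continuous maps.\<close>

definition cmaps :: "'a space \<Rightarrow> 'a space \<Rightarrow> 'a" where
  "cmaps X Y = set_of {f \<in> elts (funs (pts X) (pts Y)).
     \<forall>V\<in>elts (opens Y). set_of {x \<in> elts (pts X). app f x \<in> elts V} \<in> elts (opens X)}"

definition homeomorphism :: "'a space \<Rightarrow> 'a space \<Rightarrow> 'a \<Rightarrow> bool" where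
  "homeomorphism X Y h \<longleftrightarrow> bijection h (pts X) (pts Y) \<and> h \<in> elts (cmaps X Y) \<and>
     (\<forall>U\<in>elts (opens X). image_set h U \<in> elts (opens Y))"

definition embedding :: "'a space \<Rightarrow> 'a space \<Rightarrow> 'a \<Rightarrow> bool" where
  "embedding X Y h \<longleftrightarrow> h \<in> elts (funs (pts X) (pts Y)) \<and>
     homeomorphism X (subspace_of Y (image_set h (pts X))) h"

text \<open>The topology on \<open>Y\<close> generated by the subbase \<open>S\<close>.\<close>

definition generated_space :: "'a \<Rightarrow> 'a \<Rightarrow> 'a space" where
  "generated_space Y S = Space Y (set_of {U. elts U \<subseteq> elts Y \<and>
     (\<forall>p\<in>elts U. \<exists>F. vfinite F \<and> elts F \<subseteq> elts S \<and> (\<forall>B\<in>elts F. p \<in> elts B) \<and>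
        (\<forall>q\<in>elts Y. (\<forall>B\<in>elts F. q \<in> elts B) \<longrightarrow> q \<in> elts U))})"

text \<open>The Tychonoff power \<open>Z\<^sup>I\<close>.\<close>

definition power_space :: "'a space \<Rightarrow> 'a \<Rightarrow> 'a space" where
  "power_space Z I = generated_space (funs I (pts Z))
     (set_of {set_of {p \<in> elts (funs I (pts Z)). app p i \<in> elts V} | i V.
        i \<in> elts I \<and> V \<in> elts (opens Z)})"

subsection \<open>Extensions\<close>

text \<open>An extension of a space is a pair of a space and a map into it.\<close>

definition is_extension :: "'a space \<Rightarrow> 'a space \<times> 'a \<Rightarrow> bool" where
  "is_extension X E \<longleftrightarrow> (case E of (Y, h) \<Rightarrow> is_space Y \<and> embedding X Y h \<and>
     closure_in Y (image_set h (pts X)) = pts Y)"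

definition equivalent_extensions :: "'a space \<Rightarrow> 'a space \<times> 'a \<Rightarrow> 'a space \<times> 'a \<Rightarrow> bool" where
  "equivalent_extensions X E1 E2 \<longleftrightarrow> is_extension X E1 \<and> is_extension X E2 \<and>
     (\<exists>h. homeomorphism (fst E1) (fst E2) h \<and> vcomp h (snd E1) = snd E2)"

definition eval_map :: "'a space \<Rightarrow> 'a \<Rightarrow> 'a" where
  "eval_map X F = lam (pts X) (\<lambda>x. lam F (\<lambda>f. app f x))"

text \<open>For a set \<open>F\<close> of continuous maps from \<open>X\<close> to \<open>Z\<close>: the closure of the image of \<open>X\<close> in \<open>Z\<^sup>F\<close>,
  with the evaluation map.\<close>

definition eval_extension :: "'a space \<Rightarrow> 'a space \<Rightarrow> 'a \<Rightarrow> 'a space \<times> 'a" where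
  "eval_extension Z X F =
     (subspace_of (power_space Z F) (closure_in (power_space Z F) (image_set (eval_map X F) (pts X))),
      eval_map X F)"

definition two_space :: "'a space" where
  "two_space = Space (set_of {vempty, vsucc vempty}) (vpow (set_of {vempty, vsucc vempty}))"

definition e2_extension :: "'a space \<Rightarrow> 'a space \<times> 'a" where
  "e2_extension X = eval_extension two_space X (cmaps X two_space)"

definition banaschewski_compactification :: "'a space \<Rightarrow> 'a space \<times> 'a \<Rightarrow> bool" where
  "banaschewski_compactification X E \<longleftrightarrow> is_extension X E \<and>
     compact_space (fst E) \<and> zero_dimensional (fst E) \<and> T1 (fst E) \<and>
     (\<forall>K. is_space K \<and> compact_space K \<and> zero_dimensional K \<and> T1 K \<longrightarrow>
        (\<forall>f\<in>elts (cmaps X K). \<exists>g\<in>elts (cmaps (fst E) K). vcomp g (snd E) = f))"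

subsection \<open>The real numbers of the model\<close>

text \<open>The real line of the model is given axiomatically, as an arbitrary field in the model that is
  ordered and Dedekind complete in the sense of the model (so only nonempty bounded subsets belonging
  to the model need have a supremum).  In ZF such a field exists and is unique up to isomorphism.\<close>

definition ring_of :: "'a ofield \<Rightarrow> 'a ring" where
  "ring_of R = \<lparr>carrier = elts (car R), mult = (\<lambda>x y. app (rtimes R) (vpair x y)), one = rone R,
     zero = rzero R, add = (\<lambda>x y. app (rplus R) (vpair x y))\<rparr>"

definition rle :: "'a ofield \<Rightarrow> 'a \<Rightarrow> 'a \<Rightarrow> bool" where
  "rle R x y \<longleftrightarrow> vpair x y \<in> elts (leq R)"

definition rless :: "'a ofield \<Rightarrow> 'a \<Rightarrow> 'a \<Rightarrow> bool" where
  "rless R x y \<longleftrightarrow> rle R x y \<and> x \<noteq> y"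

definition is_sup :: "'a ofield \<Rightarrow> 'a set \<Rightarrow> 'a \<Rightarrow> bool" where
  "is_sup R S s \<longleftrightarrow> s \<in> elts (car R) \<and> (\<forall>x\<in>S. rle R x s) \<and>
     (\<forall>u\<in>elts (car R). (\<forall>x\<in>S. rle R x u) \<longrightarrow> rle R s u)"

definition complete_ordered_field :: "'a ofield \<Rightarrow> bool" where
  "complete_ordered_field R \<longleftrightarrow>
     rplus R \<in> elts (funs (vtimes (car R) (car R)) (car R)) \<and>
     rtimes R \<in> elts (funs (vtimes (car R) (car R)) (car R)) \<and>
     elts (leq R) \<subseteq> elts (vtimes (car R) (car R)) \<and>
     field (ring_of R) \<and>
     linear_order_on (elts (car R)) {(x, y). rle R x y} \<and>
     (\<forall>x\<in>elts (car R). \<forall>y\<in>elts (car R). \<forall>z\<in>elts (car R).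
        rle R x y \<longrightarrow> rle R (x \<oplus>\<^bsub>ring_of R\<^esub> z) (y \<oplus>\<^bsub>ring_of R\<^esub> z)) \<and>
     (\<forall>x\<in>elts (car R). \<forall>y\<in>elts (car R).
        rle R (rzero R) x \<and> rle R (rzero R) y \<longrightarrow> rle R (rzero R) (x \<otimes>\<^bsub>ring_of R\<^esub> y)) \<and>
     (\<forall>S. elts S \<subseteq> elts (car R) \<and> elts S \<noteq> {} \<and>
        (\<exists>u\<in>elts (car R). \<forall>x\<in>elts S. rle R x u) \<longrightarrow> (\<exists>s. is_sup R (elts S) s))"

definition rabs :: "'a ofield \<Rightarrow> 'a \<Rightarrow> 'a" where
  "rabs R x = (if rle R (rzero R) x then x else \<ominus>\<^bsub>ring_of R\<^esub> x)"

definition rdist :: "'a ofield \<Rightarrow> 'a \<Rightarrow> 'a \<Rightarrow> 'a" where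
  "rdist R x y = rabs R (x \<ominus>\<^bsub>ring_of R\<^esub> y)"

definition real_space :: "'a ofield \<Rightarrow> 'a space" where
  "real_space R = Space (car R) (set_of {U. elts U \<subseteq> elts (car R) \<and>
     (\<forall>x\<in>elts U. \<exists>e\<in>elts (car R). rless R (rzero R) e \<and>
        (\<forall>y\<in>elts (car R). rless R (rdist R y x) e \<longrightarrow> y \<in> elts U))})"

subsection \<open>The set of functions \<open>U\<^sup>*\<close> of countable clopen oscillation\<close>

text \<open>\<open>s\<close> is the oscillation of \<open>f\<close> on \<open>A\<close>.  A relation, as the oscillation may be infinite, in which case
  no \<open>s\<close> in the field qualifies.\<close>

definition is_osc :: "'a ofield \<Rightarrow> 'a \<Rightarrow> 'a \<Rightarrow> 'a \<Rightarrow> bool" where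
  "is_osc R f A s \<longleftrightarrow> (if elts A = {} then s = rzero R
     else is_sup R {rdist R (app f x) (app f y) | x y. x \<in> elts A \<and> y \<in> elts A} s)"

definition U_countable :: "'a ofield \<Rightarrow> 'a space \<Rightarrow> 'a" where
  "U_countable R X = set_of {f \<in> elts (cmaps X (real_space R)).
     \<forall>e\<in>elts (car R). rless R (rzero R) e \<longrightarrow>
       (\<exists>\<A>. vcountable \<A> \<and> (\<forall>A\<in>elts \<A>. clopen X A) \<and> vunion \<A> = pts X \<and>
          (\<forall>A\<in>elts \<A>. \<exists>s. is_osc R f A s \<and> rle R s e))}"

definition C_bounded :: "'a ofield \<Rightarrow> 'a space \<Rightarrow> 'a" where
  "C_bounded R X = set_of {f \<in> elts (cmaps X (real_space R)).
     \<exists>b\<in>elts (car R). \<forall>x\<in>elts (pts X). rle R (rabs R (app f x)) b}"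

definition U_countable_bounded :: "'a ofield \<Rightarrow> 'a space \<Rightarrow> 'a" where
  "U_countable_bounded R X = set_of (elts (U_countable R X) \<inter> elts (C_bounded R X))"

definition eU_extension :: "'a ofield \<Rightarrow> 'a space \<Rightarrow> 'a space \<times> 'a" where
  "eU_extension R X = eval_extension (real_space R) X (U_countable_bounded R X)"

end

end

theory Submission
  imports Defs
begin

text \<open>
  A point \<open>p\<close> of \<open>e\<^sub>2\<^sup>*X\<close> gives every continuous two-valued map, hence every clopen set \<open>C\<close> of \<open>X\<close>,
  a value: \<open>p\<close> \<^emph>\<open>holds\<close> at \<open>C\<close> if the value at the characteristic map of \<open>C\<close> is one.  Lying in the
  closure of the image of \<open>X\<close> means that any finitely many of these values are the values at some point
  of \<open>X\<close>.  So \<open>p\<close> is an ultrafilter of clopen sets (\<open>Fin_avoid\<close>, \<open>holds_compl\<close>, \<open>holds_Int\<close>).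

  Let \<open>f\<close> be a bounded function of countable clopen oscillation.  A countable clopen cover on whose
  members \<open>f\<close> varies by at most \<open>d\<close> can be made disjoint by subtracting from each member the finitely
  many earlier ones.  In the resulting partition into open sets the union of any family of pieces
  is clopen (\<open>partition_clopen\<close>), so sets given by inequalities on \<open>f\<close> can be enlarged to clopen sets at the
  cost of an error \<open>d\<close>, and \<open>p\<close> decides the latter.  Together with Dedekind completeness, this gives a
  limit of \<open>f\<close> at \<open>p\<close> (\<open>lim_exists\<close>): the unique real \<open>v\<close> such that for every \<open>d\<close> the values of \<open>f\<close> are \<open>d\<close>-close
  to \<open>v\<close> on some clopen set at which \<open>p\<close> holds.  Uniqueness lets the limit be described instead of chosen.

  The limits form a continuous bounded function on \<open>e\<^sub>2\<^sup>*X\<close> that extends \<open>f\<close>.  It is again of countable clopen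
  oscillation (\<open>prolong_small_cover\<close>).  The point is that a countable clopen cover of \<open>X\<close> need not induce
  a cover of \<open>e\<^sub>2\<^sup>*X\<close>; but if each member \<open>A\<close> is fattened to a clopen set that contains
  every point of \<open>X\<close> where \<open>f\<close> takes a value near a value on \<open>A\<close>, the induced sets do cover, since the values of \<open>f\<close>
  are dense in those of the extended function.  This is the description of \<open>U\<^sup>*(X)\<close> by restrictions
  (\<open>U_eq_restrictions\<close>).

  Sending \<open>p\<close> to the family of all limits at \<open>p\<close> maps \<open>e\<^sub>2\<^sup>*X\<close> continuously into the closure of \<open>X\<close> in the power of the
  real line.  Conversely, the real characteristic functions of clopen sets are among the functions
  considered, and a point of the second extension takes only the values zero and one at them, so it
  determines a point of \<open>e\<^sub>2\<^sup>*X\<close>.  These two maps are continuous, mutually inverse, and fix \<open>X\<close>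
  (\<open>extensions_equivalent\<close>).

  A continuous map of \<open>X\<close> into a compact zero-dimensional \<open>T\<^sub>1\<close>-space always extends to \<open>e\<^sub>2\<^sup>*X\<close>
  (\<open>extend_to_compact\<close>), so \<open>e\<^sub>2\<^sup>*X\<close> is a Banaschewski compactification once it is compact.  If on the other
  hand \<open>B\<close> is any Banaschewski compactification, each clopen set of \<open>X\<close> is the trace of exactly one clopen set
  of \<open>B\<close>, which yields a continuous map of \<open>B\<close> to \<open>e\<^sub>2\<^sup>*X\<close>; the extension to \<open>e\<^sub>2\<^sup>*X\<close> of the embedding of \<open>X\<close> in \<open>B\<close> is a right
  inverse of it, so \<open>e\<^sub>2\<^sup>*X\<close> is a continuous image of \<open>B\<close> and is compact (\<open>compact_if_banaschewski\<close>).

  All of this takes place in a model of first-order ZF, so each set, function or family that is formed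
  has to be given by a first-order formula with parameters.  The predicate \<open>definable\<close> captures this
  semantically, without writing formulas: the rules collected under \<open>dfn\<close> show that it is closed under
  everything that is used to form sets below, and \<open>intro dfn\<close> then discharges the
  definability conditions of separation, replacement, induction and function abstraction.
\<close>

section \<open>Definability with parameters\<close>

text \<open>
  A predicate of a sequence \<open>e\<close> of elements stands for a formula in the free variables \<open>0, 1, \<dots>\<close>, and
  \<open>e i\<close> for the value of the \<open>i\<close>-th one.  Binders are treated as with de Bruijn indices: under a quantifier
  the bound variable becomes number \<open>0\<close> and all others move up by one.  Arbitrary elements may occur as
  constants; they are the parameters.
\<close>
inductive variable_or_constant :: "((nat \<Rightarrow> 'a) \<Rightarrow> 'a) \<Rightarrow> bool" where
  var_vc: "variable_or_constant (\<lambda>e. e i)"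
| const_vc: "variable_or_constant (\<lambda>e. c)"

inductive definable :: "('a \<Rightarrow> 'a \<Rightarrow> bool) \<Rightarrow> ((nat \<Rightarrow> 'a) \<Rightarrow> bool) \<Rightarrow> bool" for mem where
  mem_atom: "variable_or_constant u \<Longrightarrow> variable_or_constant v \<Longrightarrow> definable mem (\<lambda>e. mem (u e) (v e))"
| eq_atom: "variable_or_constant u \<Longrightarrow> variable_or_constant v \<Longrightarrow> definable mem (\<lambda>e. u e = v e)"
| neg: "definable mem P \<Longrightarrow> definable mem (\<lambda>e. \<not> P e)"
| conj: "definable mem P \<Longrightarrow> definable mem Q \<Longrightarrow> definable mem (\<lambda>e. P e \<and> Q e)"
| forall: "definable mem P \<Longrightarrow> definable mem (\<lambda>e. \<forall>x. P (case_nat x e))"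

text \<open>
  Realising a definable predicate by an actual formula means to give each of its variables a fixed
  slot of the assignment.  Under \<open>d\<close> quantifiers, the index \<open>i < d\<close> belongs to the quantifier at level
  \<open>d - 1 - i\<close>, which owns an even slot from \<open>2\<close> on; going under one more quantifier leaves the slots of the other
  variables unchanged.  The free variables \<open>0\<close> and \<open>1\<close> have the slots \<open>0\<close> and \<open>1\<close>, which is where the schemas of
  separation and replacement expect them, and any further free variables share slot \<open>0\<close>; the odd slots from \<open>3\<close> on hold the parameters.
\<close>
definition slot :: "nat \<Rightarrow> nat \<Rightarrow> nat" where
  "slot d i = (if i < d then 2 * (d - 1 - i) + 2 else if i = d + 1 then 1 else 0)"

definition view :: "nat \<Rightarrow> (nat \<Rightarrow> 'a) \<Rightarrow> nat \<Rightarrow> 'a" where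
  "view d s = (\<lambda>i. s (slot d i))"

definition stores :: "(nat \<Rightarrow> 'a) \<Rightarrow> (nat \<Rightarrow> 'a) \<Rightarrow> bool" where
  "stores t s \<longleftrightarrow> (\<forall>j. s (2 * j + 3) = t j)"

definition expressible ::
  "('a \<Rightarrow> 'a \<Rightarrow> bool) \<Rightarrow> ((nat \<Rightarrow> 'a) \<Rightarrow> bool) \<Rightarrow> (nat \<Rightarrow> 'a) \<Rightarrow> bool" where
  "expressible mem P t \<longleftrightarrow> (\<forall>d. \<exists>p. \<forall>s. stores t s \<longrightarrow> sat mem p s = P (view d s))"

definition locatable :: "((nat \<Rightarrow> 'a) \<Rightarrow> 'a) \<Rightarrow> (nat \<Rightarrow> 'a) \<Rightarrow> bool" where
  "locatable u t \<longleftrightarrow> (\<forall>d. \<exists>k. \<forall>s. stores t s \<longrightarrow> s k = u (view d s))"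

text \<open>
  A formula has finitely many parameters, but the two parts of a conjunction may have different ones.
  Asking for a property of all parameter lists \<open>t\<close> that contain a certain finite set makes it
  possible to use the same list for both.
\<close>
definition finitely_supported :: "((nat \<Rightarrow> 'a) \<Rightarrow> bool) \<Rightarrow> bool" where
  "finitely_supported Q \<longleftrightarrow> (\<exists>C. finite C \<and> (\<forall>t. C \<subseteq> range t \<longrightarrow> Q t))"

lemma finitely_supported_mono:
  assumes "finitely_supported Q" "\<And>t. Q t \<Longrightarrow> R t"
  shows "finitely_supported R"
  using assms unfolding finitely_supported_def by blast

lemma finitely_supported_conj:
  assumes "finitely_supported Q" "finitely_supported R"
  shows "finitely_supported (\<lambda>t. Q t \<and> R t)"
proof -
  obtain C D where "finite C" "\<And>t. C \<subseteq> range t \<Longrightarrow> Q t" "finite D" "\<And>t. D \<subseteq> range t \<Longrightarrow> R t"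
    using assms unfolding finitely_supported_def by metis
  then show ?thesis unfolding finitely_supported_def by (intro exI[of _ "C \<union> D"]) auto
qed

lemma view_Suc: "view (Suc d) (s(2 * d + 2 := x)) = case_nat x (view d s)"
  by (rule ext) (auto simp: view_def slot_def split: nat.split)

lemma stores_upd: "stores t s \<Longrightarrow> stores t (s(2 * d + 2 := x))"
proof -
  have "2 * j + 3 \<noteq> 2 * d + 2" for j by presburger
  then show "stores t s \<Longrightarrow> stores t (s(2 * d + 2 := x))" by (simp add: stores_def)
qed

lemma finitely_supported_locatable:
  assumes "variable_or_constant u"
  shows "finitely_supported (locatable u)"
  using assms
proof cases
  case (var_vc i)
  have "s (slot d i) = u (view d s)" for s d by (simp add: var_vc view_def)
  then have "locatable u t" for t unfolding locatable_def by blast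
  then show ?thesis unfolding finitely_supported_def by (intro exI[of _ "{}"]) simp
next
  case (const_vc c)
  have "locatable u t" if c: "{c} \<subseteq> range t" for t
  proof -
    from c obtain j where "t j = c" by auto
    then have "stores t s \<Longrightarrow> s (2 * j + 3) = u (view d s)" for s d
      unfolding const_vc stores_def by simp
    then show ?thesis unfolding locatable_def by blast
  qed
  then show ?thesis unfolding finitely_supported_def by (intro exI[of _ "{c}"]) simp
qed

text \<open>
  The induction goes through for every quantifier depth at once, since the case of a quantifier at
  depth \<open>d\<close> needs the formula for its body at depth \<open>d + 1\<close>.
\<close>
lemma finitely_supported_expressible:
  assumes "definable mem P"
  shows "finitely_supported (expressible mem P)"
  using assms
proof induction
  case (mem_atom u v)
  have "expressible mem (\<lambda>e. mem (u e) (v e)) t" if "locatable u t \<and> locatable v t" for t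
    unfolding expressible_def
  proof
    fix d
    obtain k l where "\<And>s. stores t s \<Longrightarrow> s k = u (view d s)" "\<And>s. stores t s \<Longrightarrow> s l = v (view d s)"
      using \<open>locatable u t \<and> locatable v t\<close> unfolding locatable_def by metis
    then show "\<exists>p. \<forall>s. stores t s \<longrightarrow> sat mem p s = mem (u (view d s)) (v (view d s))"
      by (intro exI[of _ "Mem k l"]) simp
  qed
  with finitely_supported_conj[OF mem_atom[THEN finitely_supported_locatable]] show ?case
    by (rule finitely_supported_mono)
next
  case (eq_atom u v)
  have "expressible mem (\<lambda>e. u e = v e) t" if "locatable u t \<and> locatable v t" for t
    unfolding expressible_def
  proof
    fix d
    obtain k l where "\<And>s. stores t s \<Longrightarrow> s k = u (view d s)" "\<And>s. stores t s \<Longrightarrow> s l = v (view d s)"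
      using \<open>locatable u t \<and> locatable v t\<close> unfolding locatable_def by metis
    then show "\<exists>p. \<forall>s. stores t s \<longrightarrow> sat mem p s = (u (view d s) = v (view d s))"
      by (intro exI[of _ "Eq k l"]) simp
  qed
  with finitely_supported_conj[OF eq_atom[THEN finitely_supported_locatable]] show ?case
    by (rule finitely_supported_mono)
next
  case (neg P)
  have "expressible mem (\<lambda>e. \<not> P e) t" if "expressible mem P t" for t
    unfolding expressible_def
  proof
    fix d
    obtain p where "\<And>s. stores t s \<Longrightarrow> sat mem p s = P (view d s)"
      using \<open>expressible mem P t\<close> unfolding expressible_def by metis
    then show "\<exists>p. \<forall>s. stores t s \<longrightarrow> sat mem p s = (\<not> P (view d s))"
      by (intro exI[of _ "Neg p"]) simp
  qed
  with neg.IH show ?case by (rule finitely_supported_mono)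
next
  case (conj P Q)
  have "expressible mem (\<lambda>e. P e \<and> Q e) t" if "expressible mem P t \<and> expressible mem Q t" for t
    unfolding expressible_def
  proof
    fix d
    obtain p q where "\<And>s. stores t s \<Longrightarrow> sat mem p s = P (view d s)"
        "\<And>s. stores t s \<Longrightarrow> sat mem q s = Q (view d s)"
      using \<open>expressible mem P t \<and> expressible mem Q t\<close> unfolding expressible_def by metis
    then show "\<exists>p. \<forall>s. stores t s \<longrightarrow> sat mem p s = (P (view d s) \<and> Q (view d s))"
      by (intro exI[of _ "Conj p q"]) simp
  qed
  with finitely_supported_conj[OF conj.IH] show ?case by (rule finitely_supported_mono)
next
  case (forall P)
  have "expressible mem (\<lambda>e. \<forall>x. P (case_nat x e)) t" if "expressible mem P t" for t
    unfolding expressible_def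
  proof
    fix d
    obtain p where "\<And>s. stores t s \<Longrightarrow> sat mem p s = P (view (Suc d) s)"
      using \<open>expressible mem P t\<close> unfolding expressible_def by metis
    then have "stores t s \<Longrightarrow> sat mem p (s(2 * d + 2 := x)) = P (case_nat x (view d s))" for s x
      by (metis stores_upd view_Suc)
    then show "\<exists>p. \<forall>s. stores t s \<longrightarrow> sat mem p s = (\<forall>x. P (case_nat x (view d s)))"
      by (intro exI[of _ "Forall (2 * d + 2) p"]) simp
  qed
  with forall.IH show ?case by (rule finitely_supported_mono)
qed

lemma variable_or_constant_rename:
  assumes "variable_or_constant u"
  shows "variable_or_constant (\<lambda>e. u (\<lambda>i. e (r i)))"
  using assms
proof cases
  case (var_vc i)
  show ?thesis unfolding var_vc by (rule variable_or_constant.var_vc)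
next
  case (const_vc c)
  show ?thesis unfolding const_vc by (rule variable_or_constant.const_vc)
qed

lemma definable_rename:
  assumes "definable mem P"
  shows "definable mem (\<lambda>e. P (\<lambda>i. e (r i)))"
  using assms
proof (induction arbitrary: r)
  case (mem_atom u v)
  show ?case
    by (rule definable.mem_atom[OF mem_atom[THEN variable_or_constant_rename]])
next
  case (eq_atom u v)
  show ?case
    by (rule definable.eq_atom[OF eq_atom[THEN variable_or_constant_rename]])
next
  case (forall P)
  have "(\<lambda>i. case_nat x e (case_nat 0 (\<lambda>i. Suc (r i)) i)) = case_nat x (\<lambda>i. e (r i))" for x :: 'a and e
    by (auto split: nat.split)
  then show ?case
    using definable.forall[OF forall.IH[of "case_nat 0 (\<lambda>i. Suc (r i))"]] by simp
next
  case (neg P)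
  show ?case by (rule definable.neg[OF neg.IH])
next
  case (conj P Q)
  show ?case by (rule definable.conj[OF conj.IH])
qed

text \<open>
  A term is definable if its graph is: the value occupies variable \<open>0\<close>, the arguments move up by one.
\<close>
definition definable_term :: "('a \<Rightarrow> 'a \<Rightarrow> bool) \<Rightarrow> ((nat \<Rightarrow> 'a) \<Rightarrow> 'a) \<Rightarrow> bool" where
  "definable_term mem F \<longleftrightarrow> definable mem (\<lambda>e. e 0 = F (\<lambda>i. e (Suc i)))"

abbreviation "definable1 mem P \<equiv> definable mem (\<lambda>e. P (e 0))"
abbreviation "definable2 mem P \<equiv> definable mem (\<lambda>e. P (e 0) (e 1))"
abbreviation "definable_term1 mem F \<equiv> definable_term mem (\<lambda>e. F (e 0))"
abbreviation "definable_term2 mem F \<equiv> definable_term mem (\<lambda>e. F (e 0) (e 1))"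

lemma definable2_formula:
  assumes "definable2 mem P"
  shows "\<exists>p s. \<forall>x y. sat mem p (s(0 := x, 1 := y)) = P x y"
proof -
  obtain C where C: "finite C" "\<And>t. C \<subseteq> range t \<Longrightarrow> expressible mem (\<lambda>e. P (e 0) (e 1)) t"
    using finitely_supported_expressible[OF assms] unfolding finitely_supported_def by blast
  obtain l where l: "set l = C" using C(1) finite_list by blast
  define t where "t j = (if j < length l then l ! j else undefined)" for j
  have "C \<subseteq> range t"
  proof
    fix c assume "c \<in> C"
    then obtain j where "j < length l" "l ! j = c" unfolding l[symmetric] in_set_conv_nth by blast
    then have "t j = c" by (simp add: t_def)
    then show "c \<in> range t" by blast
  qed
  then obtain p where p: "\<And>s. stores t s \<Longrightarrow> sat mem p s = P (view 0 s 0) (view 0 s 1)"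
    using C(2) unfolding expressible_def by metis
  define s where "s i = t ((i - 3) div 2)" for i
  have "sat mem p (s(0 := x, 1 := y)) = P x y" for x y
    using p[of "s(0 := x, 1 := y)"] by (simp add: s_def slot_def view_def stores_def)
  then show ?thesis by blast
qed

lemma definable1_formula:
  assumes "definable1 mem P"
  shows "\<exists>p s. \<forall>x. sat mem p (s(0 := x)) = P x"
proof -
  obtain p s where *: "\<And>x y. sat mem p (s(0 := x, 1 := y)) = P x"
    using definable2_formula[of mem "\<lambda>x y. P x"] assms by auto
  have "sat mem p (s(0 := x)) = P x" for x
    using *[of x "s 1"] by (simp add: fun_upd_idem)
  then show ?thesis by blast
qed

named_theorems dfn

lemma definable_forall [dfn]:
  "definable mem (\<lambda>e. P (\<lambda>i. e (Suc i)) (e 0)) \<Longrightarrow> definable mem (\<lambda>e. \<forall>x. P e x)"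
  using definable.forall[of mem "\<lambda>e. P (\<lambda>i. e (Suc i)) (e 0)"] by simp

lemma definable_neg [dfn]: "definable mem P \<Longrightarrow> definable mem (\<lambda>e. \<not> P e)"
  by (rule definable.neg)

lemma definable_conj [dfn]:
  "definable mem P \<Longrightarrow> definable mem Q \<Longrightarrow> definable mem (\<lambda>e. P e \<and> Q e)"
  by (rule definable.conj)

lemma definable_exists [dfn]:
  assumes "definable mem (\<lambda>e. P (\<lambda>i. e (Suc i)) (e 0))"
  shows "definable mem (\<lambda>e. \<exists>x. P e x)"
proof -
  have "definable mem (\<lambda>e. \<not> (\<forall>x. \<not> P e x))" by (intro dfn assms)
  then show ?thesis by simp
qed

lemma definable_disj [dfn]:
  assumes "definable mem P" "definable mem Q"
  shows "definable mem (\<lambda>e. P e \<or> Q e)"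
proof -
  have "definable mem (\<lambda>e. \<not> (\<not> P e \<and> \<not> Q e))" by (intro dfn assms)
  then show ?thesis by simp
qed

lemma definable_imp [dfn]:
  assumes "definable mem P" "definable mem Q"
  shows "definable mem (\<lambda>e. P e \<longrightarrow> Q e)"
  unfolding imp_conv_disj by (intro dfn assms)

lemma definable_iff [dfn]:
  assumes "definable mem P" "definable mem Q"
  shows "definable mem (\<lambda>e. P e = Q e)"
  unfolding iff_conv_conj_imp by (intro dfn assms)

lemma definable_const [dfn]: "definable mem (\<lambda>e. b)"
proof -
  have "definable mem (\<lambda>e. e 0 = e 0)" "definable mem (\<lambda>e. \<not> e 0 = e 0)"
    by (intro definable.intros variable_or_constant.intros)+
  then show ?thesis by (cases b) simp_all
qed

lemma definable_term_var [dfn]: "definable_term mem (\<lambda>e. e i)"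
  unfolding definable_term_def by (intro definable.intros variable_or_constant.intros)

lemma definable_term_const [dfn]: "definable_term mem (\<lambda>e. c)"
  unfolding definable_term_def by (intro definable.intros variable_or_constant.intros)

text \<open>
  A definable term can be substituted because \<open>P (F e)\<close> says that some \<open>x\<close> equals \<open>F e\<close> and satisfies \<open>P\<close>.
  The closure rules for all later operations come from this one.
\<close>
lemma definable_subst:
  assumes "definable_term mem F" "definable mem (\<lambda>e. P (\<lambda>i. e (Suc i)) (e 0))"
  shows "definable mem (\<lambda>e. P e (F e))"
proof -
  have "definable mem (\<lambda>e. \<exists>x. x = F e \<and> P e x)"
    using assms by (intro dfn) (simp_all add: definable_term_def)
  then show ?thesis by simp
qed

lemma definable_term_rename:
  assumes "definable_term mem F"
  shows "definable_term mem (\<lambda>e. F (\<lambda>i. e (r i)))"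
  using definable_rename[OF assms[unfolded definable_term_def], of "case_nat 0 (\<lambda>i. Suc (r i))"]
  by (simp add: definable_term_def)

lemma definable_eq [dfn]:
  assumes "definable_term mem F" "definable_term mem G"
  shows "definable mem (\<lambda>e. F e = G e)"
proof -
  have "definable mem (\<lambda>e. e 0 = F (\<lambda>i. e (Suc i)))"
    using assms(1) by (simp add: definable_term_def)
  then have "definable mem (\<lambda>e. F e = G e)"
    by (intro definable_subst[OF assms(2), where P = "\<lambda>e x. F e = x"]) (simp add: eq_commute)
  then show ?thesis .
qed

lemma definable_mem [dfn]:
  assumes "definable_term mem F" "definable_term mem G"
  shows "definable mem (\<lambda>e. mem (F e) (G e))"
proof (rule definable_subst[OF assms(2)])
  show "definable mem (\<lambda>e. mem (F (\<lambda>i. e (Suc i))) (e 0))"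
    by (rule definable_subst[OF definable_term_rename[OF assms(1)], where P = "\<lambda>e x. mem x (e 0)"])
      (intro definable.intros variable_or_constant.intros)
qed

lemma definable_unary:
  assumes "definable1 mem P" "definable_term mem F"
  shows "definable mem (\<lambda>e. P (F e))"
  by (rule definable_subst[OF assms(2)]) (rule assms(1))

lemma definable_binary:
  assumes "definable2 mem P" "definable_term mem F" "definable_term mem G"
  shows "definable mem (\<lambda>e. P (F e) (G e))"
proof (rule definable_subst[OF assms(3)])
  show "definable mem (\<lambda>e. P (F (\<lambda>i. e (Suc i))) (e 0))"
    by (rule definable_subst[OF definable_term_rename[OF assms(2)], where P = "\<lambda>e x. P x (e 0)"])
      (use assms(1) in simp)
qed

lemma definable_term_unary:
  assumes "definable_term1 mem F" "definable_term mem G"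
  shows "definable_term mem (\<lambda>e. F (G e))"
  unfolding definable_term_def
proof (rule definable_subst[OF definable_term_rename[OF assms(2)]])
  show "definable mem (\<lambda>e. e (Suc 0) = F (e 0))"
    by (intro definable_eq dfn assms)
qed

lemma definable_term_binary:
  assumes "definable_term2 mem F" "definable_term mem G" "definable_term mem H"
  shows "definable_term mem (\<lambda>e. F (G e) (H e))"
  unfolding definable_term_def
proof (rule definable_subst[OF definable_term_rename[OF assms(3)]],
    rule definable_subst[OF definable_term_rename[OF definable_term_rename[OF assms(2)]]])
  have "definable_term mem (\<lambda>e. F (e 0) (e 1))" by (rule assms)
  from definable_eq[OF definable_term_var[of _ 2] this]
  show "definable mem (\<lambda>e. e (Suc (Suc 0)) = F (e 0) (e (Suc 0)))" by (simp add: numeral_2_eq_2)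
qed

section \<open>Sets, pairs and functions in a model of ZF\<close>

context ZF
begin

abbreviation "E \<equiv> elts mem"
abbreviation "coll \<equiv> set_of mem"
abbreviation "pair \<equiv> vpair mem"
abbreviation "Cart \<equiv> vtimes mem"
abbreviation "Fun \<equiv> funs mem"
abbreviation "Lam \<equiv> lam mem"
abbreviation "Comp \<equiv> vcomp mem"
abbreviation "Img \<equiv> image_set mem"

lemma mem_E: "mem x a \<longleftrightarrow> x \<in> E a"
  by (simp add: elts_def)

lemma E_eq: "E a = E b \<Longrightarrow> a = b"
  by (rule extensionality) (auto simp: mem_E)

lemma E_eq_iff: "E a = E b \<longleftrightarrow> a = b"
  using E_eq by blast

definition small :: "'a set \<Rightarrow> bool" where
  "small S \<longleftrightarrow> (\<exists>a. E a = S)"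

lemma E_coll: "small S \<Longrightarrow> E (coll S) = S"
  unfolding small_def set_of_def by (metis (mono_tags, lifting) E_eq theI)

lemma coll_E [simp]: "coll (E a) = a"
  by (metis E_coll E_eq small_def)

subsection \<open>Definability of set-theoretic operations\<close>

lemma definable_in_E [dfn]:
  "definable_term mem F \<Longrightarrow> definable_term mem G \<Longrightarrow> definable mem (\<lambda>e. F e \<in> E (G e))"
  unfolding mem_E[symmetric] by (rule definable_mem)

lemma definable_in_Collect [dfn]:
  "definable mem (\<lambda>e. P e (F e)) \<Longrightarrow> definable mem (\<lambda>e. F e \<in> {x. P e x})"
  by simp

lemma definable_in_Int [dfn]:
  "definable mem (\<lambda>e. F e \<in> S e) \<Longrightarrow> definable mem (\<lambda>e. F e \<in> T e) \<Longrightarrow> definable mem (\<lambda>e. F e \<in> S e \<inter> T e)"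
  unfolding Int_iff by (rule definable_conj)

lemma definable_in_Un [dfn]:
  "definable mem (\<lambda>e. F e \<in> S e) \<Longrightarrow> definable mem (\<lambda>e. F e \<in> T e) \<Longrightarrow> definable mem (\<lambda>e. F e \<in> S e \<union> T e)"
  unfolding Un_iff by (rule definable_disj)

lemma definable_in_Diff [dfn]:
  "definable mem (\<lambda>e. F e \<in> S e) \<Longrightarrow> definable mem (\<lambda>e. F e \<in> T e) \<Longrightarrow> definable mem (\<lambda>e. F e \<in> S e - T e)"
  unfolding Diff_iff by (intro dfn)

lemma definable_in_empty [dfn]: "definable mem (\<lambda>e. F e \<in> {})"
  unfolding empty_iff by (rule definable_const)

lemma definable_in_insert [dfn]:
  "definable_term mem F \<Longrightarrow> definable_term mem G \<Longrightarrow> definable mem (\<lambda>e. F e \<in> S e) \<Longrightarrow>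
    definable mem (\<lambda>e. F e \<in> insert (G e) (S e))"
  unfolding insert_iff by (intro dfn)

lemma definable_Ball [dfn]:
  "definable mem (\<lambda>e. e 0 \<in> S (\<lambda>i. e (Suc i))) \<Longrightarrow> definable mem (\<lambda>e. P (\<lambda>i. e (Suc i)) (e 0)) \<Longrightarrow>
    definable mem (\<lambda>e. \<forall>x\<in>S e. P e x)"
  unfolding Ball_def by (intro dfn)

lemma definable_Bex [dfn]:
  "definable mem (\<lambda>e. e 0 \<in> S (\<lambda>i. e (Suc i))) \<Longrightarrow> definable mem (\<lambda>e. P (\<lambda>i. e (Suc i)) (e 0)) \<Longrightarrow>
    definable mem (\<lambda>e. \<exists>x\<in>S e. P e x)"
  unfolding Bex_def by (intro dfn)

lemma definable_Ex1 [dfn]: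
  assumes "definable mem (\<lambda>e. P (\<lambda>i. e (Suc i)) (e 0))"
  shows "definable mem (\<lambda>e. \<exists>!x. P e x)"
proof -
  have "definable mem (\<lambda>e. P (\<lambda>i. e (Suc (Suc i))) (e 0))"
    using definable_rename[OF assms, of "case_nat 0 (\<lambda>i. Suc (Suc i))"] by simp
  then show ?thesis unfolding Ex1_def by (intro dfn assms)
qed

lemma definable_in_UN [dfn]:
  assumes "definable mem (\<lambda>e. e 0 \<in> S (\<lambda>i. e (Suc i)))"
    "definable mem (\<lambda>e. F (\<lambda>i. e (Suc i)) \<in> T (\<lambda>i. e (Suc i)) (e 0))"
  shows "definable mem (\<lambda>e. F e \<in> (\<Union>x\<in>S e. T e x))"
  unfolding UN_iff by (intro dfn assms)

lemma definable_in_image [dfn]: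
  assumes "definable mem (\<lambda>e. e 0 \<in> S (\<lambda>i. e (Suc i)))"
    "definable_term mem F" "definable_term mem (\<lambda>e. G (\<lambda>i. e (Suc i)) (e 0))"
  shows "definable mem (\<lambda>e. F e \<in> G e ` S e)"
  unfolding image_iff by (intro dfn assms definable_term_rename[OF assms(2)])

lemma definable_subset [dfn]:
  "definable mem (\<lambda>e. e 0 \<in> S (\<lambda>i. e (Suc i))) \<Longrightarrow> definable mem (\<lambda>e. e 0 \<in> T (\<lambda>i. e (Suc i))) \<Longrightarrow>
    definable mem (\<lambda>e. S e \<subseteq> T e)"
  unfolding subset_eq by (intro dfn)

lemma definable_set_eq [dfn]:
  "definable mem (\<lambda>e. e 0 \<in> S (\<lambda>i. e (Suc i))) \<Longrightarrow> definable mem (\<lambda>e. e 0 \<in> T (\<lambda>i. e (Suc i))) \<Longrightarrow>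
    definable mem (\<lambda>e. (S e :: 'a set) = T e)"
  unfolding set_eq_iff by (intro dfn)

text \<open>
  If \<open>S e\<close> is not a set of the model, the defining description is that of an unsatisfiable predicate
  and so does not depend on \<open>e\<close>.  Hence the graph is definable whether or not all \<open>S e\<close> are sets,
  and no existence proof is needed to see that a term built with \<open>coll\<close> is definable.
\<close>
lemma definable_term_coll [dfn]:
  assumes S: "definable mem (\<lambda>e. e 0 \<in> S (\<lambda>i. e (Suc i)))"
  shows "definable_term mem (\<lambda>e. coll (S e))"
proof -
  have none: "coll T = (THE x. False)" if "\<not> small T" for T
    using that unfolding small_def set_of_def by simp
  have *: "y = coll T \<longleftrightarrow> E y = T \<or> (\<not> (\<exists>a. E a = T)) \<and> y = (THE x. False)" for y T
  proof (cases "small T")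
    case True
    then show ?thesis using E_coll[OF True] coll_E[of y] by (metis small_def)
  next
    case False
    then show ?thesis using none[OF False] unfolding small_def by auto
  qed
  have S': "definable mem (\<lambda>e. e 0 \<in> S (\<lambda>i. e (Suc (r i))))" for r
    using definable_rename[OF S, of "case_nat 0 (\<lambda>i. Suc (r i))"] by simp
  show ?thesis unfolding definable_term_def * by (intro dfn S')
qed

lemma definable_term_if [dfn]:
  assumes "definable mem P" "definable_term mem F" "definable_term mem G"
  shows "definable_term mem (\<lambda>e. if P e then F e else G e)"
proof -
  have *: "y = (if p then a else b) \<longleftrightarrow> p \<and> y = a \<or> \<not> p \<and> y = b" for y a b :: 'a and p by simp
  show ?thesis unfolding definable_term_def *
    by (intro dfn definable_rename[OF assms(1)] definable_term_rename[OF assms(2)] definable_term_rename[OF assms(3)])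
qed

lemma definable_term_pair [dfn]:
  "definable_term mem F \<Longrightarrow> definable_term mem G \<Longrightarrow> definable_term mem (\<lambda>e. pair (F e) (G e))"
  unfolding vpair_def by (rule definable_term_binary[where F = "\<lambda>a b. coll {coll {a}, coll {a, b}}"]) (intro dfn)+

lemma definable_term_Cart [dfn]:
  "definable_term mem F \<Longrightarrow> definable_term mem G \<Longrightarrow> definable_term mem (\<lambda>e. Cart (F e) (G e))"
  unfolding vtimes_def
  by (rule definable_term_binary[where F = "\<lambda>A B. coll {pair a b | a b. a \<in> E A \<and> b \<in> E B}"]) (intro dfn)+

lemma definable_term_Fun [dfn]:
  "definable_term mem F \<Longrightarrow> definable_term mem G \<Longrightarrow> definable_term mem (\<lambda>e. Fun (F e) (G e))"
  by (rule definable_term_binary[where F = "funs mem"]) (unfold funs_def, intro dfn)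

lemma definable_term_Lam [dfn]:
  assumes "definable_term mem A" "definable_term mem (\<lambda>e. t (\<lambda>i. e (Suc i)) (e 0))"
  shows "definable_term mem (\<lambda>e. Lam (A e) (t e))"
proof -
  have t: "definable_term mem (\<lambda>e. t (\<lambda>i. e (Suc (Suc i))) (e 0))"
    using definable_term_rename[OF assms(2), of "case_nat 0 (\<lambda>i. Suc (Suc i))"] by simp
  show ?thesis unfolding lam_def by (intro dfn t definable_term_rename[OF assms(1)])
qed

subsection \<open>Existence of sets\<close>

lemma small_E [simp]: "small (E a)"
  unfolding small_def by blast

lemma small_subset:
  assumes "S \<subseteq> E a" "definable mem (\<lambda>e. e 0 \<in> S)"
  shows "small S"
proof -
  obtain p s where ps: "\<And>x. sat mem p (s(0 := x)) = (x \<in> S)"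
    using definable1_formula[OF assms(2)] by blast
  obtain b where "\<And>x. mem x b \<longleftrightarrow> mem x a \<and> sat mem p (s(0 := x))"
    using separation[of a p s] by blast
  then have "E b = S" using assms(1) by (auto simp: mem_E ps)
  then show ?thesis unfolding small_def by blast
qed

lemma small_image:
  assumes "definable_term1 mem F"
  shows "small (F ` E a)"
proof -
  have def: "definable2 mem (\<lambda>x y. y = F x)"
    by (intro dfn definable_term_unary[OF assms])
  obtain p s where ps: "\<And>x y. sat mem p (s(0 := x, 1 := y)) = (y = F x)"
    using definable2_formula[OF def] by blast
  obtain b where "\<forall>y. mem y b \<longleftrightarrow> (\<exists>x. mem x a \<and> sat mem p (s(0 := x, 1 := y)))"
    using replacement[of a p s] unfolding ps by auto
  then have "E b = F ` E a" by (auto simp: mem_E ps[simplified])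
  then show ?thesis unfolding small_def by blast
qed

lemma smallI: "\<exists>c. \<forall>x. mem x c \<longleftrightarrow> x \<in> S \<Longrightarrow> small S"
  unfolding small_def elts_def by (auto simp: set_eq_iff)

lemma small_doubleton [simp]: "small {a, b}"
  by (rule smallI) (use pairing[of a b] in simp)

lemma small_singleton [simp]: "small {a}"
  using small_doubleton[of a a] by simp

lemma small_Union [simp]: "small (\<Union>y\<in>E a. E y)"
  by (rule smallI) (use union[of a] in \<open>simp add: mem_E Bex_def\<close>)

lemma small_Un: "small S \<Longrightarrow> small T \<Longrightarrow> small (S \<union> T)"
  using small_Union[of "coll {coll S, coll T}"] by (simp add: E_coll)

lemma small_insert [simp]: "small (insert x (E a))"
  using small_Un[of "{x}" "E a"] by simp

lemma small_Pow [simp]: "small {b. E b \<subseteq> E a}"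
  by (rule smallI) (use power_set[of a] in \<open>simp add: mem_E subset_iff\<close>)

lemma small_empty [simp]: "small {}"
proof -
  obtain w e where "\<forall>z. \<not> mem z e" using infinity by blast
  then have "E e = {}" by (auto simp: mem_E)
  then show ?thesis unfolding small_def by blast
qed

lemma small_Int [simp]: "small (E a \<inter> E b)"
  by (rule small_subset[of _ a]) (blast, intro dfn)

lemma small_sep: "definable1 mem P \<Longrightarrow> small {x \<in> E a. P x}"
  by (rule small_subset[of _ a]) (blast, intro dfn)

lemma E_sep: "definable1 mem P \<Longrightarrow> E (coll {x \<in> E a. P x}) = {x \<in> E a. P x}"
  by (intro E_coll small_sep)

lemma E_vunion: "E (vunion mem a) = (\<Union>y\<in>E a. E y)"
  by (simp add: vunion_def E_coll)

lemma E_vpow: "E (vpow mem a) = {b. E b \<subseteq> E a}"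
  by (simp add: vpow_def E_coll)

lemma pair_eq [simp]: "pair a b = pair c d \<longleftrightarrow> a = c \<and> b = d"
proof
  have E: "E (pair a b) = {coll {a}, coll {a, b}}" for a b
    by (simp add: vpair_def E_coll)
  assume eq: "pair a b = pair c d"
  have inj: "S = T" if "coll S = coll T" "small S" "small T" for S T
    using that E_coll by metis
  have *: "{coll {a}, coll {a, b}} = {coll {c}, coll {c, d}}" using eq E by metis
  have 1: "a = c"
  proof -
    have "coll {a} = coll {c} \<or> coll {a} = coll {c, d}" using * by blast
    then have "{a} = {c} \<or> {a} = {c, d}" using inj by (metis small_doubleton small_singleton)
    then show ?thesis by auto
  qed
  have "coll {a, b} = coll {a} \<or> coll {a, b} = coll {a, d}" "coll {a, d} = coll {a} \<or> coll {a, d} = coll {a, b}"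
    using * unfolding 1 by blast+
  then have "({a, b} = {a} \<or> {a, b} = {a, d}) \<and> ({a, d} = {a} \<or> {a, d} = {a, b})"
    using inj by (metis small_doubleton small_singleton)
  then have "b = d" by auto
  with 1 show "a = c \<and> b = d" by simp
qed simp

lemma E_Cart: "E (Cart A B) = {pair a b | a b. a \<in> E A \<and> b \<in> E B}"
proof -
  define U where "U = coll (E A \<union> E B)"
  have U: "E U = E A \<union> E B" by (simp add: U_def E_coll small_Un)
  have "small {pair a b | a b. a \<in> E A \<and> b \<in> E B}"
  proof (rule small_subset[of _ "vpow mem (vpow mem U)"])
    show "{pair a b |a b. a \<in> E A \<and> b \<in> E B} \<subseteq> E (vpow mem (vpow mem U))"
      by (auto simp: E_vpow U vpair_def E_coll)
  qed (intro dfn)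
  then show ?thesis by (simp add: vtimes_def E_coll)
qed

lemma pair_in_Cart [simp]: "pair a b \<in> E (Cart A B) \<longleftrightarrow> a \<in> E A \<and> b \<in> E B"
  by (auto simp: E_Cart)

subsection \<open>Functions\<close>

lemma Fun_iff: "f \<in> E (Fun A B) \<longleftrightarrow> E f \<subseteq> E (Cart A B) \<and> (\<forall>a\<in>E A. \<exists>!b. pair a b \<in> E f)"
proof -
  have "small {f. E f \<subseteq> E (Cart A B) \<and> (\<forall>a\<in>E A. \<exists>!b. pair a b \<in> E f)}"
    by (rule small_subset[of _ "vpow mem (Cart A B)"]) ((auto simp: E_vpow)[1], intro dfn)
  then show ?thesis by (simp add: funs_def E_coll)
qed

text \<open>
  A definite description by a union: if exactly one \<open>y\<close> satisfies \<open>P\<close>, it is the union of all such \<open>y\<close>.  HOL's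
  own description operator has unspecified values on predicates that hold for several elements, and
  these values need not be definable.
\<close>
definition descr :: "('a \<Rightarrow> bool) \<Rightarrow> 'a" where
  "descr P = coll {z. \<exists>y. P y \<and> z \<in> E y}"

lemma descr_eq:
  assumes "\<exists>!y. P y" "P y"
  shows "descr P = y"
proof -
  have "{z. \<exists>y. P y \<and> z \<in> E y} = E y" using assms by blast
  then show ?thesis by (simp add: descr_def)
qed

lemma definable_term_descr [dfn]:
  assumes "definable mem (\<lambda>e. P (\<lambda>i. e (Suc i)) (e 0))"
  shows "definable_term mem (\<lambda>e. descr (P e))"
proof -
  have P: "definable mem (\<lambda>e. P (\<lambda>i. e (Suc (Suc i))) (e 0))"
    using definable_rename[OF assms, of "case_nat 0 (\<lambda>i. Suc (Suc i))"] by simp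
  show ?thesis unfolding descr_def by (intro dfn P)
qed

text \<open>
  Function application by the definable description.  It agrees with \<open>app\<close> on the domain of a function
  (\<open>app_val\<close>), and replaces it throughout since it is definable without any condition on the
  arguments.
\<close>
definition val :: "'a \<Rightarrow> 'a \<Rightarrow> 'a" (infixl "\<bullet>" 90) where
  "f \<bullet> x = descr (\<lambda>y. pair x y \<in> E f)"

lemma definable_term_val [dfn]:
  "definable_term mem F \<Longrightarrow> definable_term mem G \<Longrightarrow> definable_term mem (\<lambda>e. F e \<bullet> G e)"
  by (rule definable_term_binary[where F = val]) (unfold val_def, intro dfn)

lemma val_eqI:
  assumes "\<exists>!y. pair x y \<in> E f" "pair x y \<in> E f"
  shows "f \<bullet> x = y"
  unfolding val_def by (rule descr_eq[OF assms])

lemma Fun_pair: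
  assumes "f \<in> E (Fun A B)"
  shows "pair a b \<in> E f \<longleftrightarrow> a \<in> E A \<and> b = f \<bullet> a"
proof
  assume "pair a b \<in> E f"
  moreover have "a \<in> E A" using assms \<open>pair a b \<in> E f\<close> unfolding Fun_iff by (metis pair_in_Cart subsetD)
  moreover have "\<exists>!y. pair a y \<in> E f" using assms \<open>a \<in> E A\<close> by (simp add: Fun_iff)
  ultimately show "a \<in> E A \<and> b = f \<bullet> a" using val_eqI by metis
next
  assume *: "a \<in> E A \<and> b = f \<bullet> a"
  then have ex: "\<exists>!y. pair a y \<in> E f" using assms by (simp add: Fun_iff)
  then obtain y where "pair a y \<in> E f" by blast
  with * val_eqI[OF ex this] show "pair a b \<in> E f" by simp
qed

lemma val_in:
  assumes "f \<in> E (Fun A B)" "a \<in> E A"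
  shows "f \<bullet> a \<in> E B"
proof -
  have "pair a (f \<bullet> a) \<in> E f" using assms by (simp add: Fun_pair)
  then show ?thesis using assms(1) by (metis Fun_iff pair_in_Cart subsetD)
qed

lemma Fun_range:
  assumes f: "f \<in> E (Fun A B)" and C: "\<And>a. a \<in> E A \<Longrightarrow> f \<bullet> a \<in> E C"
  shows "f \<in> E (Fun A C)"
proof -
  have "E f \<subseteq> E (Cart A C)"
  proof
    fix p assume p: "p \<in> E f"
    then have "p \<in> E (Cart A B)" using f by (auto simp: Fun_iff)
    then obtain a b where "p = pair a b" by (auto simp: E_Cart)
    then show "p \<in> E (Cart A C)" using p C Fun_pair[OF f] by simp
  qed
  then show ?thesis using f by (simp add: Fun_iff)
qed

lemma app_val:
  assumes "f \<in> E (Fun A B)" "a \<in> E A"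
  shows "app mem f a = f \<bullet> a"
  unfolding app_def by (rule the_equality) (use assms in \<open>auto simp: Fun_pair\<close>)

lemma Fun_ext:
  assumes f: "f \<in> E (Fun A B)" and g: "g \<in> E (Fun A C)" and eq: "\<And>a. a \<in> E A \<Longrightarrow> f \<bullet> a = g \<bullet> a"
  shows "f = g"
proof -
  have sub: "E f \<subseteq> E g" if f: "f \<in> E (Fun A B)" and g: "g \<in> E (Fun A C)" and
      eq: "\<And>a. a \<in> E A \<Longrightarrow> f \<bullet> a = g \<bullet> a" for f g B C
  proof
    fix p assume p: "p \<in> E f"
    then have "p \<in> E (Cart A B)" using f by (auto simp: Fun_iff)
    then obtain a b where "p = pair a b" by (auto simp: E_Cart)
    then show "p \<in> E g" using p Fun_pair[OF f] Fun_pair[OF g] eq by metis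
  qed
  show ?thesis using sub[OF f g eq] sub[OF g f eq[symmetric]] E_eq by blast
qed

lemma Lam_cong:
  assumes "\<And>x. x \<in> E A \<Longrightarrow> t x = s x"
  shows "Lam A t = Lam A s"
proof -
  have "(\<lambda>x. pair x (t x)) ` E A = (\<lambda>x. pair x (s x)) ` E A"
    by (rule image_cong) (simp_all add: assms)
  moreover have "(\<lambda>x. pair x (t x)) ` E A = {pair x (t x) | x. x \<in> E A}" for t by blast
  ultimately show ?thesis by (simp add: lam_def)
qed

lemma Lam_pair:
  assumes "definable_term1 mem t"
  shows "pair a b \<in> E (Lam A t) \<longleftrightarrow> a \<in> E A \<and> b = t a"
proof -
  have "small ((\<lambda>x. pair x (t x)) ` E A)"
    by (rule small_image) (intro dfn assms)
  moreover have "(\<lambda>x. pair x (t x)) ` E A = {pair x (t x) | x. x \<in> E A}" by blast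
  ultimately have "E (Lam A t) = {pair x (t x) | x. x \<in> E A}" by (simp add: lam_def E_coll)
  then show ?thesis by auto
qed

lemma Lam_in:
  assumes "definable_term1 mem t" "\<And>x. x \<in> E A \<Longrightarrow> t x \<in> E B"
  shows "Lam A t \<in> E (Fun A B)"
proof -
  have "small ((\<lambda>x. pair x (t x)) ` E A)"
    by (rule small_image) (intro dfn assms)
  moreover have "(\<lambda>x. pair x (t x)) ` E A = {pair x (t x) | x. x \<in> E A}" by blast
  ultimately have "E (Lam A t) = {pair x (t x) | x. x \<in> E A}" by (simp add: lam_def E_coll)
  then show ?thesis using assms(2) by (auto simp: Fun_iff)
qed

lemma Lam_val:
  assumes "definable_term1 mem t" "a \<in> E A"
  shows "Lam A t \<bullet> a = t a"
  by (rule val_eqI) (use assms in \<open>auto simp: Lam_pair\<close>)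

lemma Comp_pair:
  assumes "f \<in> E (Fun A B)" "g \<in> E (Fun B C)"
  shows "pair a c \<in> E (Comp g f) \<longleftrightarrow> a \<in> E A \<and> c = g \<bullet> (f \<bullet> a)"
    and "Comp g f \<in> E (Fun A C)"
proof -
  have sub: "{pair x z | x y z. pair x y \<in> E f \<and> pair y z \<in> E g} \<subseteq> E (Cart A C)"
    using assms val_in by (auto simp: Fun_pair)
  have "small {pair x z | x y z. pair x y \<in> E f \<and> pair y z \<in> E g}"
    by (rule small_subset[OF sub]) (intro dfn)
  then have E: "E (Comp g f) = {pair x z | x y z. pair x y \<in> E f \<and> pair y z \<in> E g}"
    by (simp add: vcomp_def E_coll)
  show *: "pair a c \<in> E (Comp g f) \<longleftrightarrow> a \<in> E A \<and> c = g \<bullet> (f \<bullet> a)" for a c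
    using assms val_in[OF assms(1)] by (auto simp: E Fun_pair)
  show "Comp g f \<in> E (Fun A C)"
    using sub by (simp add: Fun_iff * E[symmetric])
qed

lemma Comp_val:
  assumes "f \<in> E (Fun A B)" "g \<in> E (Fun B C)" "a \<in> E A"
  shows "Comp g f \<bullet> a = g \<bullet> (f \<bullet> a)"
  using Fun_pair[OF Comp_pair(2)[OF assms(1,2)]] Comp_pair(1)[OF assms(1,2)] assms(3) by blast

lemma E_Img:
  assumes "f \<in> E (Fun A B)" "E S \<subseteq> E A"
  shows "E (Img f S) = (\<lambda>x. f \<bullet> x) ` E S"
proof -
  have "{app mem f x | x. x \<in> E S} = (\<lambda>x. app mem f x) ` E S" by blast
  also have "\<dots> = (\<lambda>x. f \<bullet> x) ` E S"
    by (rule image_cong) (use assms app_val in auto)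
  finally have "{app mem f x | x. x \<in> E S} = (\<lambda>x. f \<bullet> x) ` E S" .
  moreover have "small ((\<lambda>x. f \<bullet> x) ` E S)" by (rule small_image) (intro dfn)
  ultimately show ?thesis by (simp add: image_set_def E_coll)
qed

lemma bijection_iff:
  "bijection mem f A B \<longleftrightarrow> f \<in> E (Fun A B) \<and> (\<forall>b\<in>E B. \<exists>!a. a \<in> E A \<and> f \<bullet> a = b)"
  unfolding bijection_def by (metis app_val)

lemma bijection_bij_betw:
  "bijection mem f A B \<longleftrightarrow> f \<in> E (Fun A B) \<and> bij_betw (\<lambda>x. f \<bullet> x) (E A) (E B)"
proof -
  have *: "(\<forall>b\<in>T. \<exists>!a. a \<in> S \<and> g a = b) \<longleftrightarrow> bij_betw g S T" if "g ` S \<subseteq> T"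
    for g :: "'a \<Rightarrow> 'a" and S T
  proof
    assume b: "\<forall>b\<in>T. \<exists>!a. a \<in> S \<and> g a = b"
    have "inj_on g S"
    proof (rule inj_onI)
      fix x y assume *: "x \<in> S" "y \<in> S" "g x = g y"
      then have "\<exists>!a. a \<in> S \<and> g a = g y" using b that by auto
      then show "x = y" using * by auto
    qed
    moreover have "T \<subseteq> g ` S"
    proof
      fix y assume "y \<in> T"
      with b have "\<exists>!a. a \<in> S \<and> g a = y" by (rule bspec)
      then obtain a where "a \<in> S \<and> g a = y" by (rule ex1E)
      then show "y \<in> g ` S" by auto
    qed
    ultimately show "bij_betw g S T" using that unfolding bij_betw_def by (intro conjI equalityI)
  next
    assume "bij_betw g S T"
    then have inj: "inj_on g S" and T: "T = g ` S" unfolding bij_betw_def by auto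
    show "\<forall>b\<in>T. \<exists>!a. a \<in> S \<and> g a = b"
    proof
      fix b assume "b \<in> T"
      then obtain a where "a \<in> S" "g a = b" unfolding T by blast
      then show "\<exists>!a. a \<in> S \<and> g a = b"
        by (intro ex1I[of _ a]) (auto dest: inj_onD[OF inj])
    qed
  qed
  have "f \<in> E (Fun A B) \<Longrightarrow> (\<lambda>x. f \<bullet> x) ` E A \<subseteq> E B" using val_in by auto
  from *[OF this] show ?thesis unfolding bijection_iff by auto
qed

lemma bijection_LamI:
  assumes "definable_term1 mem t" "bij_betw t (E A) (E B)"
  shows "bijection mem (Lam A t) A B"
proof -
  have "Lam A t \<in> E (Fun A B)"
    by (rule Lam_in[OF assms(1)]) (use assms(2) in \<open>auto simp: bij_betw_def\<close>)
  moreover have "bij_betw (\<lambda>x. Lam A t \<bullet> x) (E A) (E B)"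
    using assms(2) by (rule bij_betw_cong[THEN iffD1, rotated]) (simp add: Lam_val[OF assms(1)])
  ultimately show ?thesis unfolding bijection_bij_betw by simp
qed

lemma definable_equipotent [dfn]:
  "definable_term mem F \<Longrightarrow> definable_term mem G \<Longrightarrow> definable mem (\<lambda>e. equipotent mem (F e) (G e))"
  by (rule definable_binary[where P = "equipotent mem"]) (unfold equipotent_def bijection_iff, intro dfn)

lemma equipotent_iff:
  "equipotent mem A B \<longleftrightarrow> (\<exists>t. definable_term1 mem t \<and> bij_betw t (E A) (E B))"
proof
  assume "equipotent mem A B"
  then obtain f where f: "bijection mem f A B" unfolding equipotent_def by blast
  have "definable_term1 mem (\<lambda>x. f \<bullet> x)" by (intro dfn)
  with f show "\<exists>t. definable_term1 mem t \<and> bij_betw t (E A) (E B)"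
    unfolding bijection_bij_betw by (intro exI[of _ "\<lambda>x. f \<bullet> x"] conjI) simp_all
next
  assume "\<exists>t. definable_term1 mem t \<and> bij_betw t (E A) (E B)"
  then obtain t where "definable_term1 mem t" "bij_betw t (E A) (E B)" by (elim exE conjE)
  from bijection_LamI[OF this] show "equipotent mem A B" unfolding equipotent_def by (rule exI)
qed

end

section \<open>Natural numbers, finite and countable sets of the model\<close>

context ZF
begin

abbreviation "Zero \<equiv> vempty mem"
abbreviation "suc \<equiv> vsucc mem"
abbreviation "om \<equiv> omega mem"

lemma E_Zero [simp]: "E Zero = {}"
  by (simp add: vempty_def E_coll)

lemma E_suc [simp]: "E (suc n) = insert n (E n)"
  by (simp add: vsucc_def E_coll)

lemma E_empty_iff: "E a = {} \<longleftrightarrow> a = Zero"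
  using E_eq_iff[of a Zero] by simp

lemma definable_term_suc [dfn]: "definable_term mem F \<Longrightarrow> definable_term mem (\<lambda>e. suc (F e))"
  by (rule definable_term_unary[where F = "vsucc mem"]) (unfold vsucc_def, intro dfn)

lemma omega_iff: "n \<in> E om \<longleftrightarrow> (\<forall>w. Zero \<in> E w \<and> (\<forall>m\<in>E w. suc m \<in> E w) \<longrightarrow> n \<in> E w)"
proof -
  obtain w e where w: "mem e w" "\<forall>z. \<not> mem z e"
      "\<And>n. mem n w \<Longrightarrow> \<exists>m. mem m w \<and> (\<forall>z. mem z m \<longleftrightarrow> mem z n \<or> z = n)"
    using infinity by blast
  have "e = Zero" using w(2) E_empty_iff by (auto simp: elts_def)
  moreover have "suc n \<in> E w" if n: "n \<in> E w" for n
  proof -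
    obtain m where m: "mem m w" "\<forall>z. mem z m \<longleftrightarrow> mem z n \<or> z = n"
      using w(3) n by (auto simp: mem_E)
    have "E m = E (suc n)" using m(2) by (auto simp: mem_E)
    then have "m = suc n" by (rule E_eq)
    then show ?thesis using m(1) by (simp add: mem_E)
  qed
  ultimately have "{n. \<forall>w. Zero \<in> E w \<and> (\<forall>m\<in>E w. suc m \<in> E w) \<longrightarrow> n \<in> E w} \<subseteq> E w"
    using w(1) by (auto simp: mem_E)
  then have "small {n. \<forall>w. Zero \<in> E w \<and> (\<forall>m\<in>E w. suc m \<in> E w) \<longrightarrow> n \<in> E w}"
    by (rule small_subset) (intro dfn)
  then show ?thesis by (simp add: omega_def E_coll)
qed

lemma zero_omega [simp]: "Zero \<in> E om"
  by (simp add: omega_iff)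

lemma suc_omega [simp]: "n \<in> E om \<Longrightarrow> suc n \<in> E om"
  by (simp add: omega_iff)

lemma omega_induct:
  assumes P: "definable1 mem P" and n: "n \<in> E om"
    and Zero: "P Zero" and suc: "\<And>n. n \<in> E om \<Longrightarrow> P n \<Longrightarrow> P (suc n)"
  shows "P n"
proof -
  define w where "w = coll {n \<in> E om. P n}"
  have w: "E w = {n \<in> E om. P n}" unfolding w_def by (rule E_sep[OF P])
  have "Zero \<in> E w \<and> (\<forall>m\<in>E w. suc m \<in> E w)" using Zero suc by (simp add: w)
  then have "n \<in> E w" using n unfolding omega_iff by blast
  then show ?thesis by (simp add: w)
qed

text \<open>
  Applied to sets of natural numbers, foundation is the existence of least elements.
\<close>
lemma foundation_E:
  assumes "S \<noteq> {}" "small S"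
  shows "\<exists>x\<in>S. \<forall>y\<in>S. y \<notin> E x"
proof -
  obtain a where a: "E a = S" using assms(2) unfolding small_def by blast
  then obtain x where "mem x a" using assms(1) by (auto simp: mem_E)
  from foundation[OF this] a show ?thesis by (auto simp: mem_E)
qed

lemma not_mem_self: "a \<notin> E a"
  using foundation_E[of "{a}"] by simp

lemma omega_trans:
  assumes "n \<in> E om" "m \<in> E n"
  shows "m \<in> E om"
proof -
  have "\<forall>m\<in>E n. m \<in> E om"
    by (rule omega_induct[where P = "\<lambda>n. \<forall>m\<in>E n. m \<in> E om", OF _ assms(1)]) (intro dfn, auto)
  then show ?thesis using assms(2) by blast
qed

lemma omega_suc_le:
  assumes "n \<in> E om" "m \<in> E n"
  shows "suc m \<in> E (suc n)"
proof -
  have "\<forall>m\<in>E n. suc m \<in> E (suc n)"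
    by (rule omega_induct[where P = "\<lambda>n. \<forall>m\<in>E n. suc m \<in> E (suc n)", OF _ assms(1)]) (intro dfn, auto)
  then show ?thesis using assms(2) by blast
qed

lemma omega_zero_less:
  assumes "n \<in> E om"
  shows "n = Zero \<or> Zero \<in> E n"
  by (rule omega_induct[where P = "\<lambda>n. n = Zero \<or> Zero \<in> E n", OF _ assms]) (intro dfn, auto)

lemma omega_linear:
  assumes "m \<in> E om" "n \<in> E om"
  shows "m \<in> E n \<or> m = n \<or> n \<in> E m"
proof -
  have "\<forall>n\<in>E om. m \<in> E n \<or> m = n \<or> n \<in> E m"
  proof (rule omega_induct[where P = "\<lambda>m. \<forall>n\<in>E om. m \<in> E n \<or> m = n \<or> n \<in> E m", OF _ assms(1)])
    show "definable1 mem (\<lambda>m. \<forall>n\<in>E om. m \<in> E n \<or> m = n \<or> n \<in> E m)" by (intro dfn)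
    show "\<forall>n\<in>E om. Zero \<in> E n \<or> Zero = n \<or> n \<in> E Zero" using omega_zero_less by auto
    fix m assume m: "m \<in> E om" and IH: "\<forall>n\<in>E om. m \<in> E n \<or> m = n \<or> n \<in> E m"
    show "\<forall>n\<in>E om. suc m \<in> E n \<or> suc m = n \<or> n \<in> E (suc m)"
    proof
      fix n assume n: "n \<in> E om"
      consider "m \<in> E n" | "m = n" | "n \<in> E m" using IH n by blast
      then show "suc m \<in> E n \<or> suc m = n \<or> n \<in> E (suc m)"
      proof cases
        case 1
        then show ?thesis using omega_suc_le[OF n 1] by auto
      qed auto
    qed
  qed
  then show ?thesis using assms(2) by blast
qed

lemma omega_least:
  assumes P: "definable1 mem P" and ex: "\<exists>n\<in>E om. P n"
  shows "\<exists>!n. n \<in> E om \<and> P n \<and> (\<forall>m\<in>E n. \<not> P m)"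
proof -
  have "\<exists>n\<in>{n \<in> E om. P n}. \<forall>m\<in>{n \<in> E om. P n}. m \<notin> E n"
    by (rule foundation_E[OF _ small_sep[OF P]]) (use ex in blast)
  then obtain n where n: "n \<in> E om" "P n" "\<And>m. m \<in> E om \<Longrightarrow> P m \<Longrightarrow> m \<notin> E n" by blast
  show ?thesis
  proof (rule ex1I[of _ n])
    show "n \<in> E om \<and> P n \<and> (\<forall>m\<in>E n. \<not> P m)" using n omega_trans by blast
  qed (use n omega_linear in blast)
qed

subsection \<open>Finite sets\<close>

abbreviation "Fin \<equiv> vfinite mem"

lemma definable_Fin [dfn]: "definable_term mem F \<Longrightarrow> definable mem (\<lambda>e. Fin (F e))"
  by (rule definable_unary[where P = "vfinite mem"]) (unfold vfinite_def, intro dfn)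

lemma Fin_Zero [simp]: "Fin Zero"
  unfolding vfinite_def equipotent_iff
proof (intro bexI[of _ Zero] exI[of _ "\<lambda>x. x"] conjI)
  show "definable_term1 mem (\<lambda>x. x)" by (intro dfn)
qed (simp_all add: bij_betw_def)

lemma Fin_insert:
  assumes "Fin A"
  shows "Fin (coll (insert a (E A)))"
proof (cases "a \<in> E A")
  case True
  then show ?thesis using assms by (simp add: insert_absorb)
next
  case False
  obtain n t where n: "n \<in> E om" and t: "definable_term1 mem t" "bij_betw t (E A) (E n)"
    using assms unfolding vfinite_def equipotent_iff by auto
  have d: "definable_term1 mem (\<lambda>x. if x = a then n else t x)"
    by (intro dfn definable_term_unary[OF t(1)])
  have "bij_betw (\<lambda>x. if x = a then n else t x) (E A) (E n)"
    by (rule bij_betw_cong[THEN iffD1, OF _ t(2)]) (use False in auto)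
  then have "bij_betw (\<lambda>x. if x = a then n else t x) (insert a (E A)) (insert n (E n))"
    using notIn_Un_bij_betw[of a "E A" "\<lambda>x. if x = a then n else t x" "E n"] False not_mem_self[of n] by simp
  then have "bij_betw (\<lambda>x. if x = a then n else t x) (E (coll (insert a (E A)))) (E (suc n))"
    by (simp add: E_coll)
  with d show ?thesis unfolding vfinite_def equipotent_iff
    by (intro bexI[OF _ suc_omega[OF n]] exI conjI)
qed

text \<open>
  Induction on the number of elements: from a bijection of \<open>A\<close> with the successor of \<open>n\<close>, remove the element that goes to
  \<open>n\<close>.
\<close>
lemma Fin_induct:
  assumes P: "definable1 mem P" and A: "Fin A" and Zero: "P Zero"
    and insert: "\<And>a A. P A \<Longrightarrow> P (coll (insert a (E A)))"
  shows "P A"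
proof -
  obtain n where n: "n \<in> E om" "equipotent mem A n" using A unfolding vfinite_def by blast
  have "\<forall>A. equipotent mem A n \<longrightarrow> P A"
  proof (rule omega_induct[where P = "\<lambda>n. \<forall>A. equipotent mem A n \<longrightarrow> P A", OF _ n(1)])
    show "definable1 mem (\<lambda>n. \<forall>A. equipotent mem A n \<longrightarrow> P A)"
      by (intro dfn definable_unary[OF P])
    show "\<forall>A. equipotent mem A Zero \<longrightarrow> P A"
      using Zero by (auto simp: equipotent_iff bij_betw_def E_empty_iff)
    fix n assume IH: "\<forall>A. equipotent mem A n \<longrightarrow> P A"
    show "\<forall>A. equipotent mem A (suc n) \<longrightarrow> P A"
    proof (intro allI impI)
      fix A assume "equipotent mem A (suc n)"
      then obtain t where t: "definable_term1 mem t" "bij_betw t (E A) (insert n (E n))"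
        by (auto simp: equipotent_iff)
      then obtain a where a: "a \<in> E A" "t a = n" unfolding bij_betw_def by (metis image_iff insertI1)
      define A' where "A' = coll (E A - {a})"
      have "small (E A - {a})" by (rule small_subset[of _ A]) (blast, intro dfn)
      then have A': "E A' = E A - {a}" unfolding A'_def by (rule E_coll)
      have "bij_betw t (E A - {a}) (insert n (E n) - {n})"
        using bij_betw_DiffI[OF t(2), of "{a}" "{n}"] a by simp
      then have "bij_betw t (E A') (E n)" using not_mem_self[of n] by (simp add: A')
      then have "equipotent mem A' n" unfolding equipotent_iff using t(1) by (intro exI conjI)
      then have "P A'" using IH by blast
      then have "P (coll (insert a (E A')))" by (rule insert)
      moreover have "insert a (E A') = E A" using a(1) by (auto simp: A')
      ultimately show "P A" by simp
    qed
  qed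
  then show ?thesis using n(2) by blast
qed

lemma Fin_singleton: "Fin (coll {a})"
  using Fin_insert[OF Fin_Zero] by simp

lemma Fin_doubleton: "Fin (coll {a, b})"
  using Fin_insert[OF Fin_singleton] by (simp add: E_coll)

lemma Fin_Un:
  assumes "Fin A" "Fin B"
  shows "Fin (coll (E A \<union> E B))"
proof (rule Fin_induct[where P = "\<lambda>A. Fin (coll (E A \<union> E B))", OF _ assms(1)])
  fix a A assume "Fin (coll (E A \<union> E B))"
  from Fin_insert[OF this, of a] show "Fin (coll (E (coll (insert a (E A))) \<union> E B))"
    by (simp add: E_coll small_Un)
qed (intro dfn, simp add: assms(2))

lemma Fin_image:
  assumes F: "definable_term1 mem F" and A: "Fin A"
  shows "Fin (coll (F ` E A))"
proof (rule Fin_induct[where P = "\<lambda>A. Fin (coll (F ` E A))", OF _ A])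
  show "definable1 mem (\<lambda>A. Fin (coll (F ` E A)))" by (intro dfn definable_term_unary[OF F])
  fix a A assume "Fin (coll (F ` E A))"
  from Fin_insert[OF this, of "F a"] show "Fin (coll (F ` E (coll (insert a (E A)))))"
    by (simp add: E_coll small_image[OF F])
qed (simp add: vempty_def[symmetric])

subsection \<open>Countable sets\<close>

abbreviation "Ctb \<equiv> vcountable mem"

lemma definable_Ctb [dfn]: "definable_term mem F \<Longrightarrow> definable mem (\<lambda>e. Ctb (F e))"
  by (rule definable_unary[where P = "vcountable mem"]) (unfold vcountable_def, intro dfn)

lemma CtbI:
  assumes g: "definable_term1 mem g" "inj_on g (E A)" "g ` E A \<subseteq> E om"
  shows "Ctb A"
proof -
  have "E (coll (g ` E A)) = g ` E A" by (rule E_coll[OF small_image[OF g(1)]])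
  then have "bij_betw g (E A) (E (coll (g ` E A)))" "E (coll (g ` E A)) \<subseteq> E om"
    using g by (simp_all add: bij_betw_def)
  then show ?thesis unfolding vcountable_def equipotent_iff using g(1) by (intro exI conjI)
qed

lemma CtbE:
  assumes "Ctb A"
  obtains t where "definable_term1 mem t" "inj_on t (E A)" "t ` E A \<subseteq> E om"
proof -
  obtain B t where "E B \<subseteq> E om" "definable_term1 mem t" "bij_betw t (E A) (E B)"
    using assms unfolding vcountable_def equipotent_iff by (elim exE conjE)
  then show thesis by (intro that[of t]) (simp_all add: bij_betw_def)
qed

lemma Fin_Ctb:
  assumes "Fin A"
  shows "Ctb A"
proof -
  obtain n t where "n \<in> E om" "definable_term1 mem t" "bij_betw t (E A) (E n)"
    using assms unfolding vfinite_def equipotent_iff by auto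
  then show ?thesis using omega_trans by (intro CtbI[of t]) (auto simp: bij_betw_def)
qed

text \<open>
  An element of the image is numbered by the least number of its preimages, so no preimage has to be
  chosen.
\<close>
lemma Ctb_image:
  assumes F: "definable_term1 mem F" and A: "Ctb A"
  shows "Ctb (coll (F ` E A))"
proof -
  obtain t where t: "definable_term1 mem t" "inj_on t (E A)" "t ` E A \<subseteq> E om"
    using CtbE[OF A] .
  note d = definable_term_unary[OF F] definable_term_unary[OF t(1)]
  define least where "least y n \<longleftrightarrow> n \<in> E om \<and> (\<exists>x\<in>E A. F x = y \<and> t x = n) \<and>
      (\<forall>m\<in>E n. \<not> (\<exists>x\<in>E A. F x = y \<and> t x = m))" for y n
  have least: "least y (descr (least y))" if y: "y \<in> F ` E A" for y
  proof -
    have "\<exists>!n. least y n"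
      unfolding least_def
    proof (rule omega_least)
      show "definable1 mem (\<lambda>n. \<exists>x\<in>E A. F x = y \<and> t x = n)" by (intro dfn d)
      show "\<exists>n\<in>E om. \<exists>x\<in>E A. F x = y \<and> t x = n" using y t(3) by auto
    qed
    then show ?thesis using descr_eq by (metis (full_types))
  qed
  have E: "E (coll (F ` E A)) = F ` E A" by (rule E_coll[OF small_image[OF F]])
  show ?thesis
  proof (rule CtbI)
    show "definable_term1 mem (\<lambda>y. descr (least y))" unfolding least_def by (intro dfn d)
    show "inj_on (\<lambda>y. descr (least y)) (E (coll (F ` E A)))"
    proof (rule inj_onI)
      fix y y' assume y: "y \<in> E (coll (F ` E A))" "y' \<in> E (coll (F ` E A))"
        and eq: "descr (least y) = descr (least y')"
      have "least y (descr (least y))" by (rule least) (use y E in simp)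
      moreover have "least y' (descr (least y))" unfolding eq by (rule least) (use y E in simp)
      ultimately obtain x x' where "x \<in> E A" "F x = y" "x' \<in> E A" "F x' = y'" "t x = t x'"
        unfolding least_def by metis
      then show "y = y'" using inj_onD[OF t(2)] by blast
    qed
    show "(\<lambda>y. descr (least y)) ` E (coll (F ` E A)) \<subseteq> E om"
      using least unfolding E least_def by blast
  qed
qed

end

section \<open>Topological spaces of the model\<close>

context ZF
begin

abbreviation "Pt X \<equiv> E (pts X)"
abbreviation "Op X \<equiv> E (opens X)"
abbreviation "Cm \<equiv> cmaps mem"
abbreviation "Sub \<equiv> subspace_of mem"
abbreviation "Pow_sp \<equiv> power_space mem"
abbreviation "Cl \<equiv> closure_in mem"

subsection \<open>Open and clopen sets\<close>

lemma open_subset: "is_space mem X \<Longrightarrow> U \<in> Op X \<Longrightarrow> E U \<subseteq> Pt X"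
  unfolding is_space_def by blast

lemma open_pts: "is_space mem X \<Longrightarrow> pts X \<in> Op X"
  unfolding is_space_def by blast

lemma open_Int: "is_space mem X \<Longrightarrow> U \<in> Op X \<Longrightarrow> V \<in> Op X \<Longrightarrow> coll (E U \<inter> E V) \<in> Op X"
  unfolding is_space_def by blast

lemma E_Int: "E (coll (E a \<inter> E b)) = E a \<inter> E b"
  by (simp add: E_coll)

text \<open>
  The union of all open subsets of \<open>s\<close> is open, and it is \<open>s\<close> if each point has a neighbourhood inside \<open>s\<close>.
  Working with the family of all of them avoids choosing neighbourhoods.
\<close>
lemma open_local:
  assumes X: "is_space mem X" and loc: "\<And>x. x \<in> E s \<Longrightarrow> \<exists>U\<in>Op X. x \<in> E U \<and> E U \<subseteq> E s"
  shows "s \<in> Op X"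
proof -
  define \<U> where "\<U> = coll {U \<in> Op X. E U \<subseteq> E s}"
  have \<U>: "E \<U> = {U \<in> Op X. E U \<subseteq> E s}" unfolding \<U>_def by (rule E_sep) (intro dfn)
  have "E (vunion mem \<U>) = E s" unfolding E_vunion \<U> using loc by blast
  then have "vunion mem \<U> = s" by (rule E_eq)
  moreover have "vunion mem \<U> \<in> Op X" using X \<U> unfolding is_space_def by blast
  ultimately show ?thesis by simp
qed

lemma open_Zero: "is_space mem X \<Longrightarrow> Zero \<in> Op X"
  by (rule open_local) simp_all

lemma open_sepI:
  assumes X: "is_space mem X" and P: "definable1 mem P"
    and loc: "\<And>x. x \<in> Pt X \<Longrightarrow> P x \<Longrightarrow> \<exists>U\<in>Op X. x \<in> E U \<and> (\<forall>u\<in>E U. P u)"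
  shows "coll {x \<in> Pt X. P x} \<in> Op X"
proof (rule open_local[OF X])
  fix x assume "x \<in> E (coll {x \<in> Pt X. P x})"
  then have "x \<in> Pt X" "P x" by (simp_all add: E_sep[OF P])
  from loc[OF this] show "\<exists>U\<in>Op X. x \<in> E U \<and> E U \<subseteq> E (coll {x \<in> Pt X. P x})"
    using open_subset[OF X] unfolding E_sep[OF P] by blast
qed

lemma definable_clopen [dfn]: "definable_term mem F \<Longrightarrow> definable mem (\<lambda>e. clopen mem X (F e))"
  by (rule definable_unary[where P = "clopen mem X"]) (unfold clopen_def, intro dfn)

lemma clopen_iff:
  assumes X: "is_space mem X"
  shows "clopen mem X A \<longleftrightarrow> A \<in> Op X \<and> coll {x \<in> Pt X. x \<notin> E A} \<in> Op X"
proof -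
  have "Pt X - E A = {x \<in> Pt X. x \<notin> E A}" by blast
  then show ?thesis unfolding clopen_def by simp
qed

lemma clopen_subset: "is_space mem X \<Longrightarrow> clopen mem X A \<Longrightarrow> E A \<subseteq> Pt X"
  unfolding clopen_def using open_subset by blast

lemma clopen_sepI:
  assumes X: "is_space mem X" and P: "definable1 mem P"
    and loc: "\<And>x. x \<in> Pt X \<Longrightarrow> \<exists>U\<in>Op X. x \<in> E U \<and> (\<forall>u\<in>E U. P u \<longleftrightarrow> P x)"
  shows "clopen mem X (coll {x \<in> Pt X. P x})"
proof -
  have nP: "definable1 mem (\<lambda>x. \<not> P x)" by (intro dfn P)
  have "coll {x \<in> Pt X. P x} \<in> Op X"
    by (rule open_sepI[OF X P]) (use loc in blast)
  moreover have "coll {x \<in> Pt X. \<not> P x} \<in> Op X"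
    by (rule open_sepI[OF X nP]) (use loc in blast)
  moreover have "{x \<in> Pt X. x \<notin> E (coll {x \<in> Pt X. P x})} = {x \<in> Pt X. \<not> P x}"
    by (auto simp: E_sep[OF P])
  ultimately show ?thesis by (simp add: clopen_iff[OF X])
qed

lemma clopen_local:
  assumes X: "is_space mem X" and A: "clopen mem X A" and x: "x \<in> Pt X"
  shows "\<exists>U\<in>Op X. x \<in> E U \<and> (\<forall>u\<in>E U. u \<in> E A \<longleftrightarrow> x \<in> E A)"
proof (cases "x \<in> E A")
  case True
  then show ?thesis using A unfolding clopen_def by blast
next
  case False
  have "definable1 mem (\<lambda>x. x \<notin> E A)" by (intro dfn)
  from E_sep[OF this] False x A show ?thesis unfolding clopen_iff[OF X]
    by (intro bexI[of _ "coll {x \<in> Pt X. x \<notin> E A}"]) auto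
qed

lemma clopen_compl:
  assumes X: "is_space mem X" and A: "clopen mem X A"
  shows "clopen mem X (coll {x \<in> Pt X. x \<notin> E A})"
  by (rule clopen_sepI[OF X]) (intro dfn, use clopen_local[OF X A] in blast)

lemma clopen_Int:
  assumes X: "is_space mem X" and A: "clopen mem X A" and B: "clopen mem X B"
  shows "clopen mem X (coll {x \<in> Pt X. x \<in> E A \<and> x \<in> E B})"
proof (rule clopen_sepI[OF X])
  show "definable1 mem (\<lambda>x. x \<in> E A \<and> x \<in> E B)" by (intro dfn)
  fix x assume x: "x \<in> Pt X"
  obtain U V where "U \<in> Op X" "x \<in> E U" "\<forall>u\<in>E U. u \<in> E A \<longleftrightarrow> x \<in> E A"
      "V \<in> Op X" "x \<in> E V" "\<forall>u\<in>E V. u \<in> E B \<longleftrightarrow> x \<in> E B"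
    using clopen_local[OF X A x] clopen_local[OF X B x] by blast
  then show "\<exists>U\<in>Op X. x \<in> E U \<and> (\<forall>u\<in>E U. (u \<in> E A \<and> u \<in> E B) \<longleftrightarrow> (x \<in> E A \<and> x \<in> E B))"
    by (intro bexI[OF _ open_Int[OF X, of U V]]) (unfold E_Int, blast+)
qed

lemma clopen_Zero: "is_space mem X \<Longrightarrow> clopen mem X Zero"
  using open_Zero open_pts by (simp add: clopen_def)

lemma clopen_pts: "is_space mem X \<Longrightarrow> clopen mem X (pts X)"
  using open_Zero open_pts by (simp add: clopen_def vempty_def[symmetric])

text \<open>
  The sets are given by a relation \<open>Q\<close> rather than by a family of sets, as they typically arise as
  preimages of the members of \<open>F\<close>.
\<close>
lemma open_Fin_inter:
  assumes X: "is_space mem X" and F: "Fin F" and Q: "definable2 mem Q"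
    and op: "\<forall>B\<in>E F. coll {x \<in> Pt X. Q x B} \<in> Op X"
  shows "coll {x \<in> Pt X. \<forall>B\<in>E F. Q x B} \<in> Op X"
proof -
  note d = definable_binary[OF Q]
  have "(\<forall>B\<in>E F. coll {x \<in> Pt X. Q x B} \<in> Op X) \<longrightarrow> coll {x \<in> Pt X. \<forall>B\<in>E F. Q x B} \<in> Op X"
  proof (rule Fin_induct[where P = "\<lambda>F. (\<forall>B\<in>E F. coll {x \<in> Pt X. Q x B} \<in> Op X) \<longrightarrow>
      coll {x \<in> Pt X. \<forall>B\<in>E F. Q x B} \<in> Op X", OF _ F])
    show "definable1 mem (\<lambda>F. (\<forall>B\<in>E F. coll {x \<in> Pt X. Q x B} \<in> Op X) \<longrightarrow>
        coll {x \<in> Pt X. \<forall>B\<in>E F. Q x B} \<in> Op X)"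
      by (intro dfn d)
    show "(\<forall>B\<in>E Zero. coll {x \<in> Pt X. Q x B} \<in> Op X) \<longrightarrow> coll {x \<in> Pt X. \<forall>B\<in>E Zero. Q x B} \<in> Op X"
      using open_pts[OF X] by simp
    fix a F assume IH: "(\<forall>B\<in>E F. coll {x \<in> Pt X. Q x B} \<in> Op X) \<longrightarrow> coll {x \<in> Pt X. \<forall>B\<in>E F. Q x B} \<in> Op X"
    have E1: "E (coll {x \<in> Pt X. Q x a}) = {x \<in> Pt X. Q x a}" by (rule E_sep) (intro dfn d)
    have E2: "E (coll {x \<in> Pt X. \<forall>B\<in>E F. Q x B}) = {x \<in> Pt X. \<forall>B\<in>E F. Q x B}"
      by (rule E_sep) (intro dfn d)
    have "{x \<in> Pt X. Q x a} \<inter> {x \<in> Pt X. \<forall>B\<in>E F. Q x B} = {x \<in> Pt X. \<forall>B\<in>insert a (E F). Q x B}"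
      by blast
    then show "(\<forall>B\<in>E (coll (insert a (E F))). coll {x \<in> Pt X. Q x B} \<in> Op X) \<longrightarrow>
        coll {x \<in> Pt X. \<forall>B\<in>E (coll (insert a (E F))). Q x B} \<in> Op X"
      using IH open_Int[OF X, of "coll {x \<in> Pt X. Q x a}" "coll {x \<in> Pt X. \<forall>B\<in>E F. Q x B}"]
      by (simp add: E_coll E1 E2)
  qed
  then show ?thesis using op by blast
qed

subsection \<open>Continuous maps\<close>

lemma Cm_iff: "f \<in> E (Cm X Y) \<longleftrightarrow> f \<in> E (Fun (pts X) (pts Y)) \<and>
    (\<forall>V\<in>Op Y. coll {x \<in> Pt X. f \<bullet> x \<in> E V} \<in> Op X)"
proof -
  have eq: "{x \<in> Pt X. app mem f x \<in> E V} = {x \<in> Pt X. f \<bullet> x \<in> E V}"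
    if "f \<in> E (Fun (pts X) (pts Y))" for f V
    using app_val[OF that] by auto
  have "{f \<in> E (Fun (pts X) (pts Y)). \<forall>V\<in>Op Y. coll {x \<in> Pt X. app mem f x \<in> E V} \<in> Op X} =
      {f \<in> E (Fun (pts X) (pts Y)). \<forall>V\<in>Op Y. coll {x \<in> Pt X. f \<bullet> x \<in> E V} \<in> Op X}"
    using eq by (auto cong: conj_cong)
  then have "Cm X Y = coll {f \<in> E (Fun (pts X) (pts Y)). \<forall>V\<in>Op Y. coll {x \<in> Pt X. f \<bullet> x \<in> E V} \<in> Op X}"
    unfolding cmaps_def by simp
  moreover have "E (coll {f \<in> E (Fun (pts X) (pts Y)). \<forall>V\<in>Op Y. coll {x \<in> Pt X. f \<bullet> x \<in> E V} \<in> Op X}) =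
      {f \<in> E (Fun (pts X) (pts Y)). \<forall>V\<in>Op Y. coll {x \<in> Pt X. f \<bullet> x \<in> E V} \<in> Op X}"
    by (rule E_sep) (intro dfn)
  ultimately show ?thesis by simp
qed

lemma Cm_Fun: "f \<in> E (Cm X Y) \<Longrightarrow> f \<in> E (Fun (pts X) (pts Y))"
  by (simp add: Cm_iff)

lemma Cm_in: "f \<in> E (Cm X Y) \<Longrightarrow> x \<in> Pt X \<Longrightarrow> f \<bullet> x \<in> Pt Y"
  using Cm_Fun val_in by blast

lemma Cm_vimage: "f \<in> E (Cm X Y) \<Longrightarrow> V \<in> Op Y \<Longrightarrow> coll {x \<in> Pt X. f \<bullet> x \<in> E V} \<in> Op X"
  by (simp add: Cm_iff)

lemma E_vimage: "E (coll {x \<in> E A. f \<bullet> x \<in> E V}) = {x \<in> E A. f \<bullet> x \<in> E V}"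
  by (rule E_sep) (intro dfn)

lemma CmI_local:
  assumes X: "is_space mem X" and f: "f \<in> E (Fun (pts X) (pts Y))"
    and loc: "\<And>x V. x \<in> Pt X \<Longrightarrow> V \<in> Op Y \<Longrightarrow> f \<bullet> x \<in> E V \<Longrightarrow> \<exists>U\<in>Op X. x \<in> E U \<and> (\<forall>u\<in>E U. f \<bullet> u \<in> E V)"
  shows "f \<in> E (Cm X Y)"
  unfolding Cm_iff
proof (intro conjI ballI f)
  fix V assume V: "V \<in> Op Y"
  show "coll {x \<in> Pt X. f \<bullet> x \<in> E V} \<in> Op X"
    by (rule open_sepI[OF X]) (intro dfn, use loc V in blast)
qed

lemma Cm_Comp:
  assumes f: "f \<in> E (Cm X Y)" and g: "g \<in> E (Cm Y W)"
  shows "Comp g f \<in> E (Cm X W)"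
  unfolding Cm_iff
proof (intro conjI ballI)
  show "Comp g f \<in> E (Fun (pts X) (pts W))" by (rule Comp_pair(2)[OF Cm_Fun[OF f] Cm_Fun[OF g]])
  fix V assume "V \<in> Op W"
  then have "coll {y \<in> Pt Y. g \<bullet> y \<in> E V} \<in> Op Y" by (rule Cm_vimage[OF g])
  then have "coll {x \<in> Pt X. f \<bullet> x \<in> E (coll {y \<in> Pt Y. g \<bullet> y \<in> E V})} \<in> Op X" by (rule Cm_vimage[OF f])
  moreover have "{x \<in> Pt X. f \<bullet> x \<in> E (coll {y \<in> Pt Y. g \<bullet> y \<in> E V})} = {x \<in> Pt X. Comp g f \<bullet> x \<in> E V}"
    using Comp_val[OF Cm_Fun[OF f] Cm_Fun[OF g]] Cm_in[OF f] by (auto simp: E_vimage)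
  ultimately show "coll {x \<in> Pt X. Comp g f \<bullet> x \<in> E V} \<in> Op X" by simp
qed

lemma clopen_vimage:
  assumes X: "is_space mem X" and Y: "is_space mem Y" and f: "f \<in> E (Cm X Y)" and A: "clopen mem Y A"
  shows "clopen mem X (coll {x \<in> Pt X. f \<bullet> x \<in> E A})"
proof (rule clopen_sepI[OF X])
  show "definable1 mem (\<lambda>x. f \<bullet> x \<in> E A)" by (intro dfn)
  fix x assume x: "x \<in> Pt X"
  obtain V where V: "V \<in> Op Y" "f \<bullet> x \<in> E V" "\<forall>v\<in>E V. v \<in> E A \<longleftrightarrow> f \<bullet> x \<in> E A"
    using clopen_local[OF Y A Cm_in[OF f x]] by blast
  then show "\<exists>U\<in>Op X. x \<in> E U \<and> (\<forall>u\<in>E U. f \<bullet> u \<in> E A \<longleftrightarrow> f \<bullet> x \<in> E A)"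
    using x by (intro bexI[OF _ Cm_vimage[OF f V(1)]]) (unfold E_vimage, blast)
qed

lemma homeomorphismI:
  assumes Y: "is_space mem Y" and H: "H \<in> E (Cm Y Z)" and G: "G \<in> E (Cm Z Y)"
    and GH: "\<And>p. p \<in> Pt Y \<Longrightarrow> G \<bullet> (H \<bullet> p) = p" and HG: "\<And>z. z \<in> Pt Z \<Longrightarrow> H \<bullet> (G \<bullet> z) = z"
  shows "homeomorphism mem Y Z H"
  unfolding homeomorphism_def
proof (intro conjI ballI H)
  show "bijection mem H (pts Y) (pts Z)"
    unfolding bijection_bij_betw
    by (intro conjI Cm_Fun[OF H] bij_betw_byWitness[where f' = "\<lambda>z. G \<bullet> z"])
      (use GH HG Cm_in[OF H] Cm_in[OF G] in auto)
  fix U assume U: "U \<in> Op Y"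
  have "E (Img H U) = (\<lambda>x. H \<bullet> x) ` E U"
    by (rule E_Img[OF Cm_Fun[OF H] open_subset[OF Y U]])
  also have "\<dots> = {z \<in> Pt Z. G \<bullet> z \<in> E U}"
  proof (intro equalityI subsetI)
    fix z assume "z \<in> (\<lambda>x. H \<bullet> x) ` E U"
    then show "z \<in> {z \<in> Pt Z. G \<bullet> z \<in> E U}"
      using open_subset[OF Y U] Cm_in[OF H] GH by auto
  next
    fix z assume "z \<in> {z \<in> Pt Z. G \<bullet> z \<in> E U}"
    then show "z \<in> (\<lambda>x. H \<bullet> x) ` E U" using HG by (auto intro!: image_eqI[of _ _ "G \<bullet> z"])
  qed
  also have "\<dots> = E (coll {z \<in> Pt Z. G \<bullet> z \<in> E U})" by (rule E_vimage[symmetric])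
  finally have "Img H U = coll {z \<in> Pt Z. G \<bullet> z \<in> E U}" by (rule E_eq)
  then show "Img H U \<in> Op Z" using Cm_vimage[OF G U] by simp
qed

subsection \<open>Subspaces\<close>

lemma pts_Sub [simp]: "pts (Sub X A) = A"
  by (simp add: subspace_of_def)

lemma Sub_open_iff: "U \<in> Op (Sub X A) \<longleftrightarrow> (\<exists>W\<in>Op X. E U = E W \<inter> E A)"
proof -
  have "small ((\<lambda>U. coll (E U \<inter> E A)) ` Op X)" by (rule small_image) (intro dfn)
  moreover have "(\<lambda>U. coll (E U \<inter> E A)) ` Op X = {coll (E U \<inter> E A) | U. U \<in> Op X}" by blast
  ultimately have "Op (Sub X A) = {coll (E U \<inter> E A) | U. U \<in> Op X}"
    by (simp add: subspace_of_def E_coll)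
  moreover have "U = coll (E W \<inter> E A) \<longleftrightarrow> E U = E W \<inter> E A" for W
    using E_coll[OF small_Int[of W A]] E_eq by metis
  ultimately show ?thesis by blast
qed

lemma is_space_Sub:
  assumes X: "is_space mem X" and A: "E A \<subseteq> Pt X"
  shows "is_space mem (Sub X A)"
  unfolding is_space_def pts_Sub
proof (intro conjI ballI allI impI)
  fix U assume "U \<in> Op (Sub X A)"
  then show "E U \<subseteq> E A" by (auto simp: Sub_open_iff)
next
  show "A \<in> Op (Sub X A)" unfolding Sub_open_iff using open_pts[OF X] A by blast
next
  fix U V assume "U \<in> Op (Sub X A)" "V \<in> Op (Sub X A)"
  then obtain U' V' where "U' \<in> Op X" "E U = E U' \<inter> E A" "V' \<in> Op X" "E V = E V' \<inter> E A"
    by (auto simp: Sub_open_iff)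
  then show "coll (E U \<inter> E V) \<in> Op (Sub X A)"
    unfolding Sub_open_iff by (intro bexI[OF _ open_Int[OF X, of U' V']]) (unfold E_Int, blast+)
next
  fix \<U> assume \<U>: "E \<U> \<subseteq> Op (Sub X A)"
  define W where "W = vunion mem \<U>"
  define \<V> where "\<V> = coll {V \<in> Op X. E V \<inter> E A \<subseteq> E W}"
  have \<V>: "E \<V> = {V \<in> Op X. E V \<inter> E A \<subseteq> E W}" unfolding \<V>_def by (rule E_sep) (intro dfn)
  have "vunion mem \<V> \<in> Op X" using X \<V> unfolding is_space_def by blast
  moreover have "E W = E (vunion mem \<V>) \<inter> E A"
  proof (intro equalityI subsetI)
    fix x assume "x \<in> E W"
    then obtain U where U: "U \<in> E \<U>" "x \<in> E U" unfolding W_def E_vunion by blast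
    then obtain V where "V \<in> Op X" "E U = E V \<inter> E A" using \<U> by (metis Sub_open_iff subsetD)
    moreover have "E U \<subseteq> E W" using U unfolding W_def E_vunion by blast
    ultimately show "x \<in> E (vunion mem \<V>) \<inter> E A" using U unfolding E_vunion \<V> by blast
  qed (auto simp: E_vunion \<V>)
  ultimately show "vunion mem \<U> \<in> Op (Sub X A)" unfolding Sub_open_iff W_def by blast
qed

lemma Cm_into_Sub:
  assumes f: "f \<in> E (Cm X Y)" and A: "\<And>x. x \<in> Pt X \<Longrightarrow> f \<bullet> x \<in> E A"
  shows "f \<in> E (Cm X (Sub Y A))"
  unfolding Cm_iff pts_Sub
proof (intro conjI ballI)
  show "f \<in> E (Fun (pts X) A)" by (rule Fun_range[OF Cm_Fun[OF f] A])
  fix V assume "V \<in> Op (Sub Y A)"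
  then obtain W where W: "W \<in> Op Y" "E V = E W \<inter> E A" by (auto simp: Sub_open_iff)
  then have "{x \<in> Pt X. f \<bullet> x \<in> E V} = {x \<in> Pt X. f \<bullet> x \<in> E W}" using A by auto
  then show "coll {x \<in> Pt X. f \<bullet> x \<in> E V} \<in> Op X" using Cm_vimage[OF f W(1)] by simp
qed

subsection \<open>Closure\<close>

lemma E_Cl: "E (Cl X A) = {x \<in> Pt X. \<forall>U\<in>Op X. x \<in> E U \<longrightarrow> E U \<inter> E A \<noteq> {}}"
  unfolding closure_in_def by (rule E_sep) (intro dfn)

lemma Cl_subset: "E (Cl X A) \<subseteq> Pt X"
  by (auto simp: E_Cl)

lemma subset_Cl: "E A \<subseteq> Pt X \<Longrightarrow> E A \<subseteq> E (Cl X A)"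
  by (auto simp: E_Cl)

lemma Cl_meets: "x \<in> E (Cl X A) \<Longrightarrow> U \<in> Op X \<Longrightarrow> x \<in> E U \<Longrightarrow> \<exists>a\<in>E A. a \<in> E U"
  by (auto simp: E_Cl)

lemma dense_meets: "Cl X A = pts X \<Longrightarrow> is_space mem X \<Longrightarrow> U \<in> Op X \<Longrightarrow> E U \<noteq> {} \<Longrightarrow> \<exists>a\<in>E A. a \<in> E U"
  using Cl_meets[of _ X A U] open_subset[of X U] by auto

text \<open>
  If \<open>x\<close> were in only one of the two sets, so would be all points of some neighbourhood of \<open>x\<close>, and this
  neighbourhood contains a point of \<open>D\<close>.
\<close>
lemma dense_clopen_eq:
  assumes X: "is_space mem X" and D: "Cl X D = pts X" and A: "clopen mem X A" and B: "clopen mem X B"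
    and eq: "\<And>d. d \<in> E D \<Longrightarrow> d \<in> E A \<longleftrightarrow> d \<in> E B"
  shows "A = B"
proof (rule ccontr)
  assume "A \<noteq> B"
  then obtain x where x: "\<not> (x \<in> E A \<longleftrightarrow> x \<in> E B)" using E_eq[of A B] by blast
  then have xX: "x \<in> Pt X" using clopen_subset[OF X A] clopen_subset[OF X B] by auto
  obtain U where U: "U \<in> Op X" "x \<in> E U" "\<forall>u\<in>E U. u \<in> E A \<longleftrightarrow> x \<in> E A"
    using clopen_local[OF X A xX] by (elim bexE conjE)
  obtain V where V: "V \<in> Op X" "x \<in> E V" "\<forall>u\<in>E V. u \<in> E B \<longleftrightarrow> x \<in> E B"
    using clopen_local[OF X B xX] by (elim bexE conjE)
  have "E (coll (E U \<inter> E V)) \<noteq> {}" using U(2) V(2) unfolding E_Int by blast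
  then obtain d where "d \<in> E D" "d \<in> E U \<inter> E V"
    using dense_meets[OF D X open_Int[OF X U(1) V(1)]] unfolding E_Int by blast
  then show False using eq U(3) V(3) x by blast
qed

subsection \<open>Powers\<close>

abbreviation "subbasic Z I i V \<equiv> coll {p \<in> E (Fun I (pts Z)). p \<bullet> i \<in> E V}"

lemma E_coord: "E (coll {p \<in> E A. p \<bullet> i \<in> E V}) = {p \<in> E A. p \<bullet> i \<in> E V}"
  by (rule E_sep) (intro dfn)

lemma pts_Pow [simp]: "pts (Pow_sp Z I) = Fun I (pts Z)"
  by (simp add: power_space_def generated_space_def)

lemma generated_open_iff:
  "U \<in> Op (generated_space mem Y S) \<longleftrightarrow> E U \<subseteq> E Y \<and>
     (\<forall>p\<in>E U. \<exists>F. Fin F \<and> E F \<subseteq> E S \<and> (\<forall>B\<in>E F. p \<in> E B) \<and>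
        (\<forall>q\<in>E Y. (\<forall>B\<in>E F. q \<in> E B) \<longrightarrow> q \<in> E U))"
proof -
  have "small {U. E U \<subseteq> E Y \<and> (\<forall>p\<in>E U. \<exists>F. Fin F \<and> E F \<subseteq> E S \<and> (\<forall>B\<in>E F. p \<in> E B) \<and>
        (\<forall>q\<in>E Y. (\<forall>B\<in>E F. q \<in> E B) \<longrightarrow> q \<in> E U))}"
    by (rule small_subset[of _ "vpow mem Y"]) ((auto simp: E_vpow)[1], intro dfn)
  then show ?thesis by (simp add: generated_space_def E_coll)
qed

lemma is_space_generated: "is_space mem (generated_space mem Y S)"
proof -
  have pts: "pts (generated_space mem Y S) = Y" by (simp add: generated_space_def)
  show ?thesis unfolding is_space_def pts
  proof (intro conjI ballI allI impI)
    fix U assume "U \<in> Op (generated_space mem Y S)"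
    then show "E U \<subseteq> E Y" by (simp add: generated_open_iff)
  next
    show "Y \<in> Op (generated_space mem Y S)" unfolding generated_open_iff
      by (auto intro!: exI[of _ Zero])
  next
    fix U V assume U: "U \<in> Op (generated_space mem Y S)" and V: "V \<in> Op (generated_space mem Y S)"
    have H: "\<exists>F. Fin F \<and> E F \<subseteq> E S \<and> (\<forall>B\<in>E F. p \<in> E B) \<and>
        (\<forall>q\<in>E Y. (\<forall>B\<in>E F. q \<in> E B) \<longrightarrow> q \<in> E U \<inter> E V)" if p: "p \<in> E U \<inter> E V" for p
    proof -
      obtain F where F: "Fin F" "E F \<subseteq> E S" "\<forall>B\<in>E F. p \<in> E B" "\<forall>q\<in>E Y. (\<forall>B\<in>E F. q \<in> E B) \<longrightarrow> q \<in> E U"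
        using U p unfolding generated_open_iff by blast
      obtain G where G: "Fin G" "E G \<subseteq> E S" "\<forall>B\<in>E G. p \<in> E B" "\<forall>q\<in>E Y. (\<forall>B\<in>E G. q \<in> E B) \<longrightarrow> q \<in> E V"
        using V p unfolding generated_open_iff by blast
      have "E (coll (E F \<union> E G)) = E F \<union> E G" by (simp add: E_coll small_Un)
      then show ?thesis using F G Fin_Un[OF F(1) G(1)] by (intro exI[of _ "coll (E F \<union> E G)"]) auto
    qed
    have "E U \<inter> E V \<subseteq> E Y" using U unfolding generated_open_iff by blast
    then show "coll (E U \<inter> E V) \<in> Op (generated_space mem Y S)"
      unfolding generated_open_iff E_Int by (rule conjI[OF _ ballI[OF H]])
  next
    fix \<U> assume \<U>: "E \<U> \<subseteq> Op (generated_space mem Y S)"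
    show "vunion mem \<U> \<in> Op (generated_space mem Y S)"
      unfolding generated_open_iff
    proof (intro conjI ballI)
      show "E (vunion mem \<U>) \<subseteq> E Y"
      proof
        fix p assume "p \<in> E (vunion mem \<U>)"
        then obtain U where "U \<in> E \<U>" "p \<in> E U" unfolding E_vunion by blast
        moreover have "E U \<subseteq> E Y"
          using subsetD[OF \<U> \<open>U \<in> E \<U>\<close>] unfolding generated_open_iff by (rule conjunct1)
        ultimately show "p \<in> E Y" by blast
      qed
      fix p assume "p \<in> E (vunion mem \<U>)"
      then obtain U where U: "U \<in> E \<U>" "p \<in> E U" unfolding E_vunion by blast
      have "\<exists>F. Fin F \<and> E F \<subseteq> E S \<and> (\<forall>B\<in>E F. p \<in> E B) \<and> (\<forall>q\<in>E Y. (\<forall>B\<in>E F. q \<in> E B) \<longrightarrow> q \<in> E U)"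
        using subsetD[OF \<U> U(1)] U(2) unfolding generated_open_iff by (elim conjE) (erule bspec)
      then obtain F where F: "Fin F" "E F \<subseteq> E S" "\<forall>B\<in>E F. p \<in> E B" "\<forall>q\<in>E Y. (\<forall>B\<in>E F. q \<in> E B) \<longrightarrow> q \<in> E U"
        by (elim exE conjE)
      have "\<forall>q\<in>E Y. (\<forall>B\<in>E F. q \<in> E B) \<longrightarrow> q \<in> E (vunion mem \<U>)"
        using F(4) U(1) unfolding E_vunion by blast
      with F(1-3) show "\<exists>F. Fin F \<and> E F \<subseteq> E S \<and> (\<forall>B\<in>E F. p \<in> E B) \<and>
          (\<forall>q\<in>E Y. (\<forall>B\<in>E F. q \<in> E B) \<longrightarrow> q \<in> E (vunion mem \<U>))"
        by (intro exI[of _ F] conjI)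
    qed
  qed
qed

lemma is_space_Pow: "is_space mem (Pow_sp Z I)"
  unfolding power_space_def by (rule is_space_generated)

lemma Pow_open_iff:
  "U \<in> Op (Pow_sp Z I) \<longleftrightarrow> E U \<subseteq> E (Fun I (pts Z)) \<and>
     (\<forall>p\<in>E U. \<exists>F. Fin F \<and> (\<forall>B\<in>E F. \<exists>i\<in>E I. \<exists>V\<in>Op Z. B = subbasic Z I i V) \<and> (\<forall>B\<in>E F. p \<in> E B) \<and>
        (\<forall>q\<in>E (Fun I (pts Z)). (\<forall>B\<in>E F. q \<in> E B) \<longrightarrow> q \<in> E U))"
proof -
  have eq: "{p \<in> E (Fun I (pts Z)). app mem p i \<in> E V} = {p \<in> E (Fun I (pts Z)). p \<bullet> i \<in> E V}"
    if "i \<in> E I" for i V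
    using app_val that by auto
  have "{coll {p \<in> E (Fun I (pts Z)). app mem p i \<in> E V} | i V. i \<in> E I \<and> V \<in> Op Z} =
      {subbasic Z I i V | i V. i \<in> E I \<and> V \<in> Op Z}"
  proof (intro Collect_cong iff_exI)
    fix x i V
    show "(x = coll {p \<in> E (Fun I (pts Z)). app mem p i \<in> E V} \<and> i \<in> E I \<and> V \<in> Op Z) \<longleftrightarrow>
        (x = subbasic Z I i V \<and> i \<in> E I \<and> V \<in> Op Z)"
      by (cases "i \<in> E I") (simp_all add: eq)
  qed
  moreover have "{subbasic Z I i V | i V. i \<in> E I \<and> V \<in> Op Z} \<subseteq> E (vpow mem (Fun I (pts Z)))"
    by (auto simp: E_vpow E_coord)
  then have "small {subbasic Z I i V | i V. i \<in> E I \<and> V \<in> Op Z}"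
    by (rule small_subset) (intro dfn)
  ultimately have S: "E (coll {coll {p \<in> E (Fun I (pts Z)). app mem p i \<in> E V} | i V. i \<in> E I \<and> V \<in> Op Z}) =
      {subbasic Z I i V | i V. i \<in> E I \<and> V \<in> Op Z}"
    by (simp add: E_coll)
  have "(E F \<subseteq> {subbasic Z I i V | i V. i \<in> E I \<and> V \<in> Op Z}) \<longleftrightarrow>
      (\<forall>B\<in>E F. \<exists>i\<in>E I. \<exists>V\<in>Op Z. B = subbasic Z I i V)" for F
  proof -
    have "(\<exists>i V. B = subbasic Z I i V \<and> i \<in> E I \<and> V \<in> Op Z) \<longleftrightarrow>
        (\<exists>i\<in>E I. \<exists>V\<in>Op Z. B = subbasic Z I i V)" for B
      by (rule iffI; elim exE bexE conjE; intro exI bexI conjI; assumption)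
    then show ?thesis by (simp only: subset_eq mem_Collect_eq)
  qed
  then show ?thesis unfolding power_space_def generated_open_iff S by simp
qed

lemma open_subbasic:
  assumes "i \<in> E I" "V \<in> Op Z"
  shows "subbasic Z I i V \<in> Op (Pow_sp Z I)"
  unfolding Pow_open_iff E_coord
proof (intro conjI ballI)
  fix p assume "p \<in> {p \<in> E (Fun I (pts Z)). p \<bullet> i \<in> E V}"
  then show "\<exists>F. Fin F \<and> (\<forall>B\<in>E F. \<exists>i\<in>E I. \<exists>V\<in>Op Z. B = subbasic Z I i V) \<and> (\<forall>B\<in>E F. p \<in> E B) \<and>
        (\<forall>q\<in>E (Fun I (pts Z)). (\<forall>B\<in>E F. q \<in> E B) \<longrightarrow> q \<in> {p \<in> E (Fun I (pts Z)). p \<bullet> i \<in> E V})"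
    using assms Fin_singleton[of "subbasic Z I i V"]
    by (intro exI[of _ "coll {subbasic Z I i V}"]) (auto simp: E_coll E_coord)
qed blast

lemma Cm_into_Pow:
  assumes X: "is_space mem X" and g: "g \<in> E (Fun (pts X) (Fun I (pts Z)))"
    and coord: "\<And>i V. i \<in> E I \<Longrightarrow> V \<in> Op Z \<Longrightarrow> coll {x \<in> Pt X. g \<bullet> x \<bullet> i \<in> E V} \<in> Op X"
  shows "g \<in> E (Cm X (Pow_sp Z I))"
proof (rule CmI_local[OF X])
  show "g \<in> E (Fun (pts X) (pts (Pow_sp Z I)))" using g by simp
  fix x U assume x: "x \<in> Pt X" and U: "U \<in> Op (Pow_sp Z I)" "g \<bullet> x \<in> E U"
  then obtain F where F: "Fin F" "\<forall>B\<in>E F. \<exists>i\<in>E I. \<exists>V\<in>Op Z. B = subbasic Z I i V" "\<forall>B\<in>E F. g \<bullet> x \<in> E B"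
      "\<forall>q\<in>E (Fun I (pts Z)). (\<forall>B\<in>E F. q \<in> E B) \<longrightarrow> q \<in> E U"
    unfolding Pow_open_iff by blast
  have gin: "g \<bullet> x \<in> E (Fun I (pts Z))" if "x \<in> Pt X" for x using val_in[OF g that] .
  have d: "definable2 mem (\<lambda>x B. g \<bullet> x \<in> E B)" by (intro dfn)
  have "coll {x \<in> Pt X. g \<bullet> x \<in> E B} \<in> Op X" if "B \<in> E F" for B
  proof -
    obtain i V where iV: "i \<in> E I" "V \<in> Op Z" "B = subbasic Z I i V" using F(2) \<open>B \<in> E F\<close> by blast
    have "{x \<in> Pt X. g \<bullet> x \<in> E B} = {x \<in> Pt X. g \<bullet> x \<bullet> i \<in> E V}"
      using gin by (auto simp: iV(3) E_coord)
    then show ?thesis using coord[OF iV(1,2)] by simp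
  qed
  then have "coll {x \<in> Pt X. \<forall>B\<in>E F. g \<bullet> x \<in> E B} \<in> Op X"
    by (intro open_Fin_inter[OF X F(1) d]) blast
  moreover have "E (coll {x \<in> Pt X. \<forall>B\<in>E F. g \<bullet> x \<in> E B}) = {x \<in> Pt X. \<forall>B\<in>E F. g \<bullet> x \<in> E B}"
    by (rule E_sep) (intro dfn)
  ultimately show "\<exists>U'\<in>Op X. x \<in> E U' \<and> (\<forall>u\<in>E U'. g \<bullet> u \<in> E U)"
    using x F(3,4) gin by (intro bexI) auto
qed

text \<open>
  A map into a closure \<open>Cl A\<close> in a power is obtained from its coordinates: these give
  continuity, and values in the closure because a dense set goes into \<open>A\<close>.
  All comparison maps below are constructed in this way.
\<close>
lemma Cm_into_Cl:
  assumes X: "is_space mem X" and D: "Cl X D = pts X" and g: "g \<in> E (Fun (pts X) (Fun I (pts Z)))"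
    and coord: "\<And>i V. i \<in> E I \<Longrightarrow> V \<in> Op Z \<Longrightarrow> coll {x \<in> Pt X. g \<bullet> x \<bullet> i \<in> E V} \<in> Op X"
    and A: "\<And>d. d \<in> E D \<Longrightarrow> g \<bullet> d \<in> E A"
  shows "g \<in> E (Cm X (Sub (Pow_sp Z I) (Cl (Pow_sp Z I) A)))"
proof -
  have gC: "g \<in> E (Cm X (Pow_sp Z I))" by (rule Cm_into_Pow[OF X g coord])
  have in_Cl: "g \<bullet> x \<in> E (Cl (Pow_sp Z I) A)" if x: "x \<in> Pt X" for x
    unfolding E_Cl
  proof (intro CollectI conjI ballI impI)
    show "g \<bullet> x \<in> Pt (Pow_sp Z I)" using val_in[OF g x] by simp
    fix U assume U: "U \<in> Op (Pow_sp Z I)" "g \<bullet> x \<in> E U"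
    obtain d where "d \<in> E D" "g \<bullet> d \<in> E U"
      using dense_meets[OF D X Cm_vimage[OF gC U(1)]] x U(2) by (auto simp: E_vimage)
    then show "E U \<inter> E A \<noteq> {}" using A by blast
  qed
  show ?thesis by (rule Cm_into_Sub[OF gC in_Cl])
qed

end

section \<open>Evaluation extensions\<close>

context ZF
begin

subsection \<open>Compactness of images\<close>

text \<open>
  A finite subfamily of the preimages of the covering sets is sent back to the given cover by taking
  images; surjectivity makes the image of the preimage of \<open>U\<close> equal to \<open>U\<close>.  This determines the finite
  subcover without choosing, for each preimage, a set of which it is the preimage.
\<close>
lemma compact_image:
  assumes B: "is_space mem B" and Y: "is_space mem Y" and \<phi>: "\<phi> \<in> E (Cm B Y)"
    and surj: "\<And>y. y \<in> Pt Y \<Longrightarrow> \<exists>b\<in>Pt B. \<phi> \<bullet> b = y" and comp: "compact_space mem B"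
  shows "compact_space mem Y"
  unfolding compact_space_def
proof (intro allI impI)
  fix \<U> assume \<U>: "E \<U> \<subseteq> Op Y \<and> vunion mem \<U> = pts Y"
  define pre where "pre U = coll {b \<in> Pt B. \<phi> \<bullet> b \<in> E U}" for U
  define img where "img W = coll ((\<lambda>b. \<phi> \<bullet> b) ` E W)" for W
  have dpre: "definable_term1 mem pre" unfolding pre_def by (intro dfn)
  have dimg: "definable_term1 mem img" unfolding img_def by (intro dfn)
  have Epre: "E (pre U) = {b \<in> Pt B. \<phi> \<bullet> b \<in> E U}" for U unfolding pre_def by (rule E_vimage)
  have img_pre: "img (pre U) = U" if "U \<in> E \<U>" for U
  proof -
    have "E U \<subseteq> Pt Y" using \<U> that open_subset[OF Y] by blast
    then have "(\<lambda>b. \<phi> \<bullet> b) ` E (pre U) = E U" unfolding Epre using surj by auto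
    then show ?thesis by (simp add: img_def)
  qed
  define \<W> where "\<W> = coll (pre ` E \<U>)"
  have \<W>: "E \<W> = pre ` E \<U>" unfolding \<W>_def by (rule E_coll[OF small_image[OF dpre]])
  have "E \<W> \<subseteq> Op B" unfolding \<W> pre_def using \<U> Cm_vimage[OF \<phi>] by auto
  moreover have "vunion mem \<W> = pts B"
  proof (rule E_eq)
    have U: "(\<Union>U\<in>E \<U>. E U) = Pt Y" using \<U> E_vunion by metis
    have "E (vunion mem \<W>) = (\<Union>U\<in>E \<U>. E (pre U))" unfolding E_vunion \<W> by simp
    also have "\<dots> = {b \<in> Pt B. \<phi> \<bullet> b \<in> (\<Union>U\<in>E \<U>. E U)}" unfolding Epre by blast
    also have "\<dots> = Pt B" unfolding U using Cm_in[OF \<phi>] by blast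
    finally show "E (vunion mem \<W>) = Pt B" .
  qed
  ultimately obtain \<V> where \<V>: "E \<V> \<subseteq> E \<W>" "Fin \<V>" "vunion mem \<V> = pts B"
    using comp unfolding compact_space_def by blast
  define \<V>' where "\<V>' = coll (img ` E \<V>)"
  have \<V>': "E \<V>' = img ` E \<V>" unfolding \<V>'_def by (rule E_coll[OF small_image[OF dimg]])
  have "E \<V>' \<subseteq> E \<U>" using \<V>(1) img_pre unfolding \<V>' \<W> by fastforce
  moreover have "Fin \<V>'" unfolding \<V>'_def by (rule Fin_image[OF dimg \<V>(2)])
  moreover have "vunion mem \<V>' = pts Y"
  proof (rule E_eq, intro equalityI subsetI)
    fix y assume "y \<in> E (vunion mem \<V>')"
    then obtain U where "U \<in> E \<V>'" "y \<in> E U" unfolding E_vunion by blast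
    then show "y \<in> Pt Y" using \<open>E \<V>' \<subseteq> E \<U>\<close> \<U> open_subset[OF Y] by blast
  next
    fix y assume "y \<in> Pt Y"
    then obtain b where b: "b \<in> Pt B" "\<phi> \<bullet> b = y" using surj by blast
    then have "b \<in> E (vunion mem \<V>)" using \<V>(3) by simp
    then obtain W where W: "W \<in> E \<V>" "b \<in> E W" unfolding E_vunion by blast
    then obtain U where U: "U \<in> E \<U>" "W = pre U" using \<V>(1) unfolding \<W> by blast
    then have "y \<in> E (img W)" using W(2) b img_pre[OF U(1)] by (simp add: Epre)
    then show "y \<in> E (vunion mem \<V>')" unfolding E_vunion \<V>' using W(1) by blast
  qed
  ultimately show "\<exists>\<V>. E \<V> \<subseteq> E \<U> \<and> Fin \<V> \<and> vunion mem \<V> = pts Y" by blast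
qed

subsection \<open>Embeddings and extensions\<close>

lemma E_Img_pts: "h \<in> E (Fun (pts X) C) \<Longrightarrow> E (Img h (pts X)) = (\<lambda>x. h \<bullet> x) ` Pt X"
  by (rule E_Img[OF _ order_refl])

lemma embeddingI:
  assumes X: "is_space mem X" and Y: "is_space mem Y" and h: "h \<in> E (Cm X Y)"
    and inj: "\<And>x y. x \<in> Pt X \<Longrightarrow> y \<in> Pt X \<Longrightarrow> h \<bullet> x = h \<bullet> y \<Longrightarrow> x = y"
    and op: "\<And>U x. U \<in> Op X \<Longrightarrow> x \<in> E U \<Longrightarrow>
      \<exists>W\<in>Op Y. h \<bullet> x \<in> E W \<and> (\<forall>u\<in>Pt X. h \<bullet> u \<in> E W \<longrightarrow> u \<in> E U)"
  shows "embedding mem X Y h"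
proof -
  let ?A = "Img h (pts X)"
  have A: "E ?A = (\<lambda>x. h \<bullet> x) ` Pt X" by (rule E_Img_pts[OF Cm_Fun[OF h]])
  have S: "is_space mem (Sub Y ?A)"
    by (rule is_space_Sub[OF Y]) (use A Cm_in[OF h] in auto)
  have hA: "h \<in> E (Cm X (Sub Y ?A))" by (rule Cm_into_Sub[OF h]) (simp add: A)
  have "bijection mem h (pts X) (pts (Sub Y ?A))"
    unfolding bijection_bij_betw bij_betw_def pts_Sub A
    using Cm_Fun[OF hA] inj by (auto intro: inj_onI)
  moreover have "Img h U \<in> Op (Sub Y ?A)" if U: "U \<in> Op X" for U
  proof (rule open_local[OF S])
    have EU: "E (Img h U) = (\<lambda>x. h \<bullet> x) ` E U"
      by (rule E_Img[OF Cm_Fun[OF h] open_subset[OF X U]])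
    fix y assume "y \<in> E (Img h U)"
    then obtain x where x: "x \<in> E U" "y = h \<bullet> x" unfolding EU by blast
    obtain W where W: "W \<in> Op Y" "h \<bullet> x \<in> E W" "\<forall>u\<in>Pt X. h \<bullet> u \<in> E W \<longrightarrow> u \<in> E U"
      using op[OF U x(1)] by blast
    have "coll (E W \<inter> E ?A) \<in> Op (Sub Y ?A)" unfolding Sub_open_iff E_Int using W(1) by blast
    moreover have "y \<in> E (coll (E W \<inter> E ?A))" unfolding E_Int unfolding A using W(2) x open_subset[OF X U] by auto
    moreover have "E (coll (E W \<inter> E ?A)) \<subseteq> E (Img h U)" unfolding E_Int unfolding A EU using W(3) by blast
    ultimately show "\<exists>V\<in>Op (Sub Y ?A). y \<in> E V \<and> E V \<subseteq> E (Img h U)" by blast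
  qed
  ultimately show ?thesis
    unfolding embedding_def homeomorphism_def using Cm_Fun[OF h] hA by blast
qed

lemma embedding_Cm:
  assumes Y: "is_space mem Y" and h: "embedding mem X Y h"
  shows "h \<in> E (Cm X Y)"
  unfolding Cm_iff
proof (intro conjI ballI)
  show hF: "h \<in> E (Fun (pts X) (pts Y))" using h unfolding embedding_def by blast
  have hS: "h \<in> E (Cm X (Sub Y (Img h (pts X))))"
    using h unfolding embedding_def homeomorphism_def by blast
  fix V assume "V \<in> Op Y"
  then have "coll (E V \<inter> E (Img h (pts X))) \<in> Op (Sub Y (Img h (pts X)))"
    unfolding Sub_open_iff E_Int by blast
  from Cm_vimage[OF hS this] show "coll {x \<in> Pt X. h \<bullet> x \<in> E V} \<in> Op X"
  proof -
    have "{x \<in> Pt X. h \<bullet> x \<in> E V \<inter> E (Img h (pts X))} = {x \<in> Pt X. h \<bullet> x \<in> E V}"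
      unfolding E_Img_pts[OF hF] by blast
    then show "coll {x \<in> Pt X. h \<bullet> x \<in> E (coll (E V \<inter> E (Img h (pts X))))} \<in> Op X \<Longrightarrow> ?thesis"
      unfolding E_Int by simp
  qed
qed

lemma extensionD:
  assumes "is_extension mem X (Y, h)"
  shows "is_space mem Y" "h \<in> E (Cm X Y)" "Cl Y (Img h (pts X)) = pts Y"
    "E (Img h (pts X)) = (\<lambda>x. h \<bullet> x) ` Pt X"
proof -
  show Y: "is_space mem Y" and "Cl Y (Img h (pts X)) = pts Y" using assms unfolding is_extension_def by auto
  have "embedding mem X Y h" using assms unfolding is_extension_def by simp
  from embedding_Cm[OF Y this] show "h \<in> E (Cm X Y)" .
  then show "E (Img h (pts X)) = (\<lambda>x. h \<bullet> x) ` Pt X" by (rule E_Img_pts[OF Cm_Fun])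
qed

subsection \<open>The evaluation map\<close>

abbreviation "Ev \<equiv> eval_map mem"

lemma eval_map_eq:
  assumes "E F \<subseteq> E (Cm X Z)"
  shows "Ev X F = Lam (pts X) (\<lambda>x. Lam F (\<lambda>f. f \<bullet> x))"
  unfolding eval_map_def
proof (intro Lam_cong)
  fix x f assume "x \<in> Pt X" "f \<in> E F"
  then show "app mem f x = f \<bullet> x" using assms Cm_Fun by (intro app_val) blast
qed

lemma eval_map_in:
  assumes "E F \<subseteq> E (Cm X Z)"
  shows "Ev X F \<in> E (Fun (pts X) (Fun F (pts Z)))"
  unfolding eval_map_eq[OF assms]
proof (rule Lam_in)
  show "definable_term1 mem (\<lambda>x. Lam F (\<lambda>f. f \<bullet> x))" by (intro dfn)
  fix x assume "x \<in> Pt X"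
  then show "Lam F (\<lambda>f. f \<bullet> x) \<in> E (Fun F (pts Z))"
    using assms Cm_in by (intro Lam_in) (intro dfn, blast)
qed

lemma eval_map_val:
  assumes "E F \<subseteq> E (Cm X Z)" "x \<in> Pt X" "f \<in> E F"
  shows "Ev X F \<bullet> x \<bullet> f = f \<bullet> x"
proof -
  have d: "definable_term1 mem (\<lambda>x. Lam F (\<lambda>f. f \<bullet> x))" by (intro dfn)
  have "definable_term1 mem (\<lambda>f. f \<bullet> x)" by (intro dfn)
  then show ?thesis
    unfolding eval_map_eq[OF assms(1)] Lam_val[OF d assms(2)] using assms(3) by (rule Lam_val)
qed

lemma Cl_pts: "is_space mem X \<Longrightarrow> Cl X (pts X) = pts X"
  by (rule E_eq) (auto simp: E_Cl dest: open_subset)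

lemma coord_open_Sub:
  assumes A: "E A \<subseteq> E (Fun I (pts Z))" and i: "i \<in> E I" and V: "V \<in> Op Z"
  shows "coll {p \<in> E A. p \<bullet> i \<in> E V} \<in> Op (Sub (Pow_sp Z I) A)"
  unfolding Sub_open_iff E_coord
  by (intro bexI[OF _ open_subbasic[OF i V]]) (use A in \<open>auto simp: E_coord\<close>)

text \<open>
  The condition \<open>sep\<close> says that \<open>F\<close> separates points from closed sets.  With \<open>T\<^sub>1\<close> it also makes the evaluation
  map injective.
\<close>
lemma eval_extension:
  assumes X: "is_space mem X" and T1: "T1 mem X" and Z: "is_space mem Z" and F: "E F \<subseteq> E (Cm X Z)"
    and sep: "\<And>U x. U \<in> Op X \<Longrightarrow> x \<in> E U \<Longrightarrow>
      \<exists>f\<in>E F. \<exists>V\<in>Op Z. f \<bullet> x \<in> E V \<and> (\<forall>u\<in>Pt X. f \<bullet> u \<in> E V \<longrightarrow> u \<in> E U)"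
  shows "is_extension mem X (eval_extension mem Z X F)"
proof -
  define P where "P = Pow_sp Z F"
  define h where "h = Ev X F"
  define A where "A = Img h (pts X)"
  define Y where "Y = Sub P (Cl P A)"
  have P: "is_space mem P" unfolding P_def by (rule is_space_Pow)
  have hF: "h \<in> E (Fun (pts X) (Fun F (pts Z)))" unfolding h_def by (rule eval_map_in[OF F])
  have hval: "h \<bullet> x \<bullet> f = f \<bullet> x" if "x \<in> Pt X" "f \<in> E F" for x f
    unfolding h_def by (rule eval_map_val[OF F that])
  have A: "E A = (\<lambda>x. h \<bullet> x) ` Pt X" unfolding A_def by (rule E_Img_pts[OF hF])
  have AP: "E A \<subseteq> Pt P" unfolding A P_def using val_in[OF hF] by auto
  have Y: "is_space mem Y" unfolding Y_def by (rule is_space_Sub[OF P Cl_subset])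
  have ptY: "pts Y = Cl P A" by (simp add: Y_def)
  have h: "h \<in> E (Cm X Y)" unfolding Y_def P_def
  proof (rule Cm_into_Cl[OF X Cl_pts[OF X] hF])
    fix i V assume "i \<in> E F" "V \<in> Op Z"
    moreover have "{x \<in> Pt X. h \<bullet> x \<bullet> i \<in> E V} = {x \<in> Pt X. i \<bullet> x \<in> E V}"
      using hval \<open>i \<in> E F\<close> by auto
    ultimately show "coll {x \<in> Pt X. h \<bullet> x \<bullet> i \<in> E V} \<in> Op X"
      using Cm_vimage[OF subsetD[OF F \<open>i \<in> E F\<close>]] by simp
  qed (simp add: A)
  have emb: "embedding mem X Y h"
  proof (rule embeddingI[OF X Y h])
    fix U x assume U: "U \<in> Op X" "x \<in> E U"
    then have x: "x \<in> Pt X" using open_subset[OF X] by blast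
    obtain f V where f: "f \<in> E F" "V \<in> Op Z" "f \<bullet> x \<in> E V" "\<forall>u\<in>Pt X. f \<bullet> u \<in> E V \<longrightarrow> u \<in> E U"
      using sep[OF U] by blast
    have "coll {p \<in> E (Cl P A). p \<bullet> f \<in> E V} \<in> Op Y"
      unfolding Y_def P_def by (rule coord_open_Sub[OF _ f(1,2)]) (use Cl_subset[of "Pow_sp Z F" A] in simp)
    moreover have "h \<bullet> u \<in> E (Cl P A)" if "u \<in> Pt X" for u using Cm_in[OF h that] by (simp add: ptY)
    ultimately show "\<exists>W\<in>Op Y. h \<bullet> x \<in> E W \<and> (\<forall>u\<in>Pt X. h \<bullet> u \<in> E W \<longrightarrow> u \<in> E U)"
      using f hval x by (intro bexI[of _ "coll {p \<in> E (Cl P A). p \<bullet> f \<in> E V}"]) (auto simp: E_coord)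
  next
    fix x y assume xy: "x \<in> Pt X" "y \<in> Pt X" "h \<bullet> x = h \<bullet> y"
    show "x = y"
    proof (rule ccontr)
      assume "x \<noteq> y"
      then obtain U where U: "U \<in> Op X" "x \<in> E U" "y \<notin> E U" using T1 xy unfolding T1_def by blast
      obtain f V where f: "f \<in> E F" "V \<in> Op Z" "f \<bullet> x \<in> E V" "\<forall>u\<in>Pt X. f \<bullet> u \<in> E V \<longrightarrow> u \<in> E U"
        using sep[OF U(1,2)] by blast
      have "f \<bullet> x = f \<bullet> y" using hval xy f(1) by metis
      then show False using f U xy by metis
    qed
  qed
  have "Cl Y A = pts Y"
  proof (rule E_eq, rule equalityI[OF Cl_subset], rule subsetI)
    fix p assume p: "p \<in> Pt Y"
    show "p \<in> E (Cl Y A)"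
      unfolding E_Cl
    proof (intro CollectI conjI ballI impI p)
      fix U assume "U \<in> Op Y" "p \<in> E U"
      then obtain W where W: "W \<in> Op P" "E U = E W \<inter> E (Cl P A)" unfolding Y_def Sub_open_iff by blast
      then obtain a where "a \<in> E A" "a \<in> E W"
        using Cl_meets[of p P A W] \<open>p \<in> E U\<close> by blast
      then show "E U \<inter> E A \<noteq> {}" using W subset_Cl[OF AP] by blast
    qed
  qed
  then have "is_extension mem X (Y, h)" unfolding is_extension_def using Y emb by (simp add: A_def)
  then show ?thesis by (simp add: eval_extension_def Y_def P_def A_def h_def)
qed

end

section \<open>The extension by two-valued maps\<close>

context ZF
begin

abbreviation "One \<equiv> suc Zero"
abbreviation "two \<equiv> two_space mem"

lemma One_neq_Zero [simp]: "One \<noteq> Zero" "Zero \<noteq> One"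
  using E_suc[of Zero] E_Zero by (metis insert_not_empty)+

lemma Pt_two: "Pt two = {Zero, One}"
  by (simp add: two_space_def E_coll)

lemma Op_two: "V \<in> Op two \<longleftrightarrow> E V \<subseteq> {Zero, One}"
  by (simp add: two_space_def E_coll E_vpow)

lemma clopen_two: "E V \<subseteq> {Zero, One} \<Longrightarrow> clopen mem two V"
proof -
  have "small ({Zero, One} - E V)" by (rule small_subset[of _ "pts two"]) (simp add: Pt_two, intro dfn)
  then show "E V \<subseteq> {Zero, One} \<Longrightarrow> clopen mem two V"
    by (simp add: clopen_def Op_two Pt_two E_coll)
qed

lemma is_space_two: "is_space mem two"
proof -
  have "(\<Union>U\<in>E \<U>. E U) \<subseteq> {Zero, One}" if "E \<U> \<subseteq> Op two" for \<U>
    using that Op_two by blast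
  then show ?thesis unfolding is_space_def Op_two Pt_two E_vunion E_Int by blast
qed

lemma zero_dimensional_two: "zero_dimensional mem two"
  unfolding zero_dimensional_def using clopen_two Op_two by blast

lemma T1_two: "T1 mem two"
  unfolding T1_def
proof (intro ballI impI)
  fix x y assume "x \<in> Pt two" "y \<in> Pt two" "x \<noteq> y"
  then show "\<exists>U\<in>Op two. x \<in> E U \<and> y \<notin> E U"
    by (intro bexI[of _ "coll {x}"]) (auto simp: Op_two Pt_two E_coll)
qed

lemma compact_two: "compact_space mem two"
  unfolding compact_space_def
proof (intro allI impI)
  fix \<U> assume \<U>: "E \<U> \<subseteq> Op two \<and> vunion mem \<U> = pts two"
  then have un: "(\<Union>U\<in>E \<U>. E U) = {Zero, One}" using E_vunion[of \<U>] Pt_two by simp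
  then obtain U V where UV: "U \<in> E \<U>" "Zero \<in> E U" "V \<in> E \<U>" "One \<in> E V" by blast
  have "E (vunion mem (coll {U, V})) = Pt two"
    using UV \<U> unfolding E_vunion Pt_two by (auto simp: E_coll Op_two subset_iff)
  then have "vunion mem (coll {U, V}) = pts two" by (rule E_eq)
  then show "\<exists>\<V>. E \<V> \<subseteq> E \<U> \<and> Fin \<V> \<and> vunion mem \<V> = pts two"
    using UV Fin_doubleton[of U V] by (intro exI[of _ "coll {U, V}"]) (simp add: E_coll)
qed

definition chi :: "'a space \<Rightarrow> 'a \<Rightarrow> 'a" where
  "chi X C = Lam (pts X) (\<lambda>x. if x \<in> E C then One else Zero)"

lemma definable_term_chi [dfn]: "definable_term mem F \<Longrightarrow> definable_term mem (\<lambda>e. chi X (F e))"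
  by (rule definable_term_unary[where F = "chi X"]) (unfold chi_def, intro dfn)

lemma chi_val: "x \<in> Pt X \<Longrightarrow> chi X C \<bullet> x = (if x \<in> E C then One else Zero)"
  unfolding chi_def by (rule Lam_val) (intro dfn)

lemma chi_Cm:
  assumes X: "is_space mem X" and C: "clopen mem X C"
  shows "chi X C \<in> E (Cm X two)"
proof (rule CmI_local[OF X])
  show "chi X C \<in> E (Fun (pts X) (pts two))"
    unfolding chi_def by (rule Lam_in) (intro dfn, simp add: Pt_two)
  fix x V assume x: "x \<in> Pt X" "chi X C \<bullet> x \<in> E V"
  obtain U where "U \<in> Op X" "x \<in> E U" "\<forall>u\<in>E U. u \<in> E C \<longleftrightarrow> x \<in> E C"
    using clopen_local[OF X C x(1)] by (elim bexE conjE)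
  moreover from this have "\<forall>u\<in>E U. chi X C \<bullet> u \<in> E V"
    using x chi_val open_subset[OF X] by (metis subsetD)
  ultimately show "\<exists>U\<in>Op X. x \<in> E U \<and> (\<forall>u\<in>E U. chi X C \<bullet> u \<in> E V)" by blast
qed

text \<open>
  Two-valued continuous maps are the same as clopen sets; this is how points of the extension become
  families of clopen sets.
\<close>
lemma Cm_two_chi:
  assumes X: "is_space mem X" and c: "c \<in> E (Cm X two)"
  obtains C where "clopen mem X C" "c = chi X C"
proof
  let ?C = "coll {x \<in> Pt X. c \<bullet> x \<in> E (coll {One})}"
  show "clopen mem X ?C"
    by (rule clopen_vimage[OF X is_space_two c]) (simp add: clopen_two E_coll)
  show "c = chi X ?C"
  proof (rule Fun_ext[OF Cm_Fun[OF c], of _ "pts two"])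
    show "chi X ?C \<in> E (Fun (pts X) (pts two))"
      unfolding chi_def by (rule Lam_in) (intro dfn, simp add: Pt_two)
    fix x assume "x \<in> Pt X"
    then show "c \<bullet> x = chi X ?C \<bullet> x"
      using Cm_in[OF c] unfolding chi_val[OF \<open>x \<in> Pt X\<close>] E_vimage Pt_two by (simp add: E_coll) blast
  qed
qed

end

locale zero_dimensional_T1_space = ZF mem for mem :: "'a \<Rightarrow> 'a \<Rightarrow> bool" +
  fixes X :: "'a space"
  assumes X: "is_space mem X" and zero_dim: "zero_dimensional mem X" and T1: "T1 mem X"
begin

abbreviation "Y \<equiv> fst (e2_extension mem X)"
abbreviation "e \<equiv> snd (e2_extension mem X)"

abbreviation "Clop C \<equiv> clopen mem X C"

definition holds :: "'a \<Rightarrow> 'a \<Rightarrow> bool" where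
  "holds p C \<longleftrightarrow> p \<bullet> chi X C = One"

lemma definable_holds [dfn]:
  "definable_term mem F \<Longrightarrow> definable_term mem G \<Longrightarrow> definable mem (\<lambda>s. holds (F s) (G s))"
  unfolding holds_def by (intro dfn)

definition compl :: "'a \<Rightarrow> 'a" where
  "compl C = coll {x \<in> Pt X. x \<notin> E C}"

lemma E_compl: "E (compl C) = {x \<in> Pt X. x \<notin> E C}"
  unfolding compl_def by (rule E_sep) (intro dfn)

lemma Clop_compl: "Clop C \<Longrightarrow> Clop (compl C)"
  unfolding compl_def by (rule clopen_compl[OF X])

lemma Clop_subset: "Clop C \<Longrightarrow> E C \<subseteq> Pt X"
  by (rule clopen_subset[OF X])

lemma chi_in: "Clop C \<Longrightarrow> chi X C \<in> E (Cm X two)"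
  by (rule chi_Cm[OF X])

lemma extension_e2: "is_extension mem X (Y, e)"
proof -
  have "is_extension mem X (eval_extension mem two X (Cm X two))"
  proof (rule eval_extension[OF X T1 is_space_two order_refl])
    fix U x assume U: "U \<in> Op X" "x \<in> E U"
    then obtain A where A: "Clop A" "x \<in> E A" "E A \<subseteq> E U" using zero_dim unfolding zero_dimensional_def by blast
    have "x \<in> Pt X" using open_subset[OF X] U by blast
    then show "\<exists>f\<in>E (Cm X two). \<exists>V\<in>Op two. f \<bullet> x \<in> E V \<and> (\<forall>u\<in>Pt X. f \<bullet> u \<in> E V \<longrightarrow> u \<in> E U)"
      using A by (intro bexI[OF _ chi_in[OF A(1)]] bexI[of _ "coll {One}"])
        (auto simp: chi_val E_coll Op_two)
  qed
  then show ?thesis by (simp add: e2_extension_def)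
qed

lemmas space_Y = extensionD(1)[OF extension_e2]
lemmas e_Cm = extensionD(2)[OF extension_e2]
lemmas e_dense = extensionD(3)[OF extension_e2]
lemmas E_range_e = extensionD(4)[OF extension_e2]

lemma e_in: "x \<in> Pt X \<Longrightarrow> e \<bullet> x \<in> Pt Y"
  by (rule Cm_in[OF e_Cm])

lemma e_val: "x \<in> Pt X \<Longrightarrow> c \<in> E (Cm X two) \<Longrightarrow> e \<bullet> x \<bullet> c = c \<bullet> x"
  unfolding e2_extension_def eval_extension_def by (simp add: eval_map_val[OF order_refl])

lemma holds_e: "x \<in> Pt X \<Longrightarrow> Clop C \<Longrightarrow> holds (e \<bullet> x) C \<longleftrightarrow> x \<in> E C"
  by (simp add: holds_def e_val chi_in chi_val)

lemma Y_eq: "Y = Sub (Pow_sp two (Cm X two)) (Cl (Pow_sp two (Cm X two)) (Img e (pts X)))"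
  by (simp add: e2_extension_def eval_extension_def)

lemma Y_Sub: "Sub (Pow_sp two (Cm X two)) (pts Y) = Y"
  using Y_eq pts_Sub by metis

lemma Pt_Y: "Pt Y = E (Cl (Pow_sp two (Cm X two)) (Img e (pts X)))"
  by (subst Y_eq) simp

lemma Y_Fun: "p \<in> Pt Y \<Longrightarrow> p \<in> E (Fun (Cm X two) (pts two))"
  using Cl_subset[of "Pow_sp two (Cm X two)" "Img e (pts X)"] unfolding Pt_Y by auto

lemma Y_val: "p \<in> Pt Y \<Longrightarrow> c \<in> E (Cm X two) \<Longrightarrow> p \<bullet> c = Zero \<or> p \<bullet> c = One"
  using val_in[OF Y_Fun] Pt_two by blast

lemma not_holds: "p \<in> Pt Y \<Longrightarrow> Clop C \<Longrightarrow> \<not> holds p C \<longleftrightarrow> p \<bullet> chi X C = Zero"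
  unfolding holds_def using Y_val[OF _ chi_in] by fastforce

lemma Y_ext:
  assumes p: "p \<in> Pt Y" and q: "q \<in> Pt Y" and eq: "\<And>C. Clop C \<Longrightarrow> holds p C \<longleftrightarrow> holds q C"
  shows "p = q"
proof (rule Fun_ext[OF Y_Fun[OF p] Y_Fun[OF q]])
  fix c assume c: "c \<in> E (Cm X two)"
  obtain C where "Clop C" "c = chi X C" using Cm_two_chi[OF X c] .
  then show "p \<bullet> c = q \<bullet> c"
    using eq[of C] Y_val[OF p c] Y_val[OF q c] unfolding holds_def by auto
qed

definition hat :: "'a \<Rightarrow> 'a" where
  "hat C = coll {p \<in> Pt Y. holds p C}"

lemma definable_term_hat [dfn]: "definable_term mem F \<Longrightarrow> definable_term mem (\<lambda>s. hat (F s))"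
  by (rule definable_term_unary[where F = hat]) (unfold hat_def, intro dfn)

lemma E_hat: "E (hat C) = {p \<in> Pt Y. holds p C}"
  unfolding hat_def by (rule E_sep) (intro dfn)

lemma clopen_hat:
  assumes C: "Clop C"
  shows "clopen mem Y (hat C)"
proof -
  have sub: "Pt Y \<subseteq> E (Fun (Cm X two) (pts two))" using Y_Fun by blast
  have op: "coll {p \<in> Pt Y. p \<bullet> chi X C \<in> E V} \<in> Op Y" if "E V \<subseteq> {Zero, One}" for V
    using coord_open_Sub[OF sub chi_in[OF C], of V] that unfolding Op_two Y_Sub by blast
  have "coll {p \<in> Pt Y. p \<bullet> chi X C \<in> E (coll {One})} \<in> Op Y"
    "coll {p \<in> Pt Y. p \<bullet> chi X C \<in> E (coll {Zero})} \<in> Op Y"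
    by (rule op; simp add: E_coll)+
  moreover have "{p \<in> Pt Y. p \<notin> E (hat C)} = {p \<in> Pt Y. p \<bullet> chi X C \<in> E (coll {Zero})}"
    using not_holds[OF _ C] by (auto simp: E_hat E_coll)
  ultimately show ?thesis
    unfolding clopen_iff[OF space_Y] by (simp add: hat_def holds_def E_coll)
qed

text \<open>
  A condition on finitely many values of \<open>p\<close> defines an open set of the extension, which contains a point of the
  dense image of \<open>X\<close>.  All filter properties of \<open>p\<close> follow by applying this to suitable complements.
\<close>
lemma Fin_avoid:
  assumes p: "p \<in> Pt Y" and F: "Fin F" and C: "\<And>C. C \<in> E F \<Longrightarrow> Clop C \<and> \<not> holds p C"
  shows "\<exists>x\<in>Pt X. \<forall>C\<in>E F. x \<notin> E C"
proof -
  have d: "definable2 mem (\<lambda>q C. \<not> holds q C)" by (intro dfn)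
  have "coll {q \<in> Pt Y. \<forall>C\<in>E F. \<not> holds q C} \<in> Op Y"
  proof (rule open_Fin_inter[OF space_Y F d], intro ballI)
    fix B assume "B \<in> E F"
    then have "clopen mem Y (hat B)" using C clopen_hat by blast
    then have "coll {q \<in> Pt Y. q \<notin> E (hat B)} \<in> Op Y" unfolding clopen_iff[OF space_Y] by blast
    moreover have "{q \<in> Pt Y. q \<notin> E (hat B)} = {q \<in> Pt Y. \<not> holds q B}" by (auto simp: E_hat)
    ultimately show "coll {q \<in> Pt Y. \<not> holds q B} \<in> Op Y" by simp
  qed
  moreover have "E (coll {q \<in> Pt Y. \<forall>C\<in>E F. \<not> holds q C}) = {q \<in> Pt Y. \<forall>C\<in>E F. \<not> holds q C}"
    by (rule E_sep) (intro dfn)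
  ultimately obtain d where "d \<in> E (Img e (pts X))" "\<forall>C\<in>E F. \<not> holds d C"
    using dense_meets[OF e_dense space_Y] p C by blast
  then show ?thesis using holds_e C unfolding E_range_e by blast
qed

lemma holds_meet:
  assumes p: "p \<in> Pt Y" and C: "Clop C" "holds p C" and D: "Clop D" "holds p D"
  shows "\<exists>x\<in>E C. x \<in> E D"
proof (rule ccontr)
  assume none: "\<not> (\<exists>x\<in>E C. x \<in> E D)"
  have "clopen mem Y (hat C)" "clopen mem Y (hat D)" using clopen_hat C D by blast+
  then have op: "coll (E (hat C) \<inter> E (hat D)) \<in> Op Y"
    using open_Int[OF space_Y] unfolding clopen_def by blast
  have "E (coll (E (hat C) \<inter> E (hat D))) \<noteq> {}"
    unfolding E_Int unfolding E_hat using p C(2) D(2) by blast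
  from dense_meets[OF e_dense space_Y op this]
  obtain d where "d \<in> E (Img e (pts X))" "holds d C" "holds d D"
    unfolding E_Int unfolding E_hat by blast
  then show False using none holds_e C(1) D(1) unfolding E_range_e by blast
qed

lemma holds_compl:
  assumes p: "p \<in> Pt Y" and C: "Clop C"
  shows "holds p (compl C) \<longleftrightarrow> \<not> holds p C"
proof -
  have "\<exists>x\<in>Pt X. \<forall>D\<in>E (coll {C, compl C}). x \<notin> E D" if "\<not> holds p C" "\<not> holds p (compl C)"
    using that C Clop_compl[OF C] by (intro Fin_avoid[OF p Fin_doubleton]) (auto simp: E_coll)
  then have "holds p C \<or> holds p (compl C)" by (auto simp: E_coll E_compl)
  moreover have "\<not> (holds p C \<and> holds p (compl C))"
    using holds_meet[OF p C _ Clop_compl[OF C]] by (auto simp: E_compl)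
  ultimately show ?thesis by blast
qed

lemma holds_mono:
  assumes p: "p \<in> Pt Y" and C: "Clop C" "holds p C" and D: "Clop D" "E C \<subseteq> E D"
  shows "holds p D"
proof (rule ccontr)
  assume "\<not> holds p D"
  then have "holds p (compl D)" using holds_compl[OF p D(1)] by blast
  from holds_meet[OF p C Clop_compl[OF D(1)] this] show False using D(2) by (auto simp: E_compl)
qed

definition common :: "'a \<Rightarrow> 'a \<Rightarrow> 'a" where
  "common C D = coll {x \<in> Pt X. x \<in> E C \<and> x \<in> E D}"

lemma Clop_common: "Clop C \<Longrightarrow> Clop D \<Longrightarrow> Clop (common C D)"
  unfolding common_def by (rule clopen_Int[OF X])

lemma E_common: "E (common C D) = {x \<in> Pt X. x \<in> E C \<and> x \<in> E D}"
  unfolding common_def by (rule E_sep) (intro dfn)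

lemma holds_Int:
  assumes p: "p \<in> Pt Y" and C: "Clop C" "holds p C" and D: "Clop D" "holds p D"
  shows "holds p (common C D)"
proof (rule ccontr)
  assume n: "\<not> holds p (common C D)"
  let ?F = "coll (insert (common C D) (E (coll {compl C, compl D})))"
  have EF: "E ?F = {common C D, compl C, compl D}"
    using E_coll[OF small_insert[of "common C D" "coll {compl C, compl D}"]]
    unfolding E_coll[OF small_doubleton] .
  have "\<exists>x\<in>Pt X. \<forall>B\<in>E ?F. x \<notin> E B"
  proof (rule Fin_avoid[OF p])
    show "Fin ?F" by (intro Fin_insert Fin_doubleton)
    fix B assume "B \<in> E ?F"
    then show "Clop B \<and> \<not> holds p B"
      unfolding EF using n C D Clop_common Clop_compl holds_compl[OF p] by auto
  qed
  then show False unfolding EF by (auto simp: E_compl E_common)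
qed

lemma holds_nonempty: "p \<in> Pt Y \<Longrightarrow> Clop C \<Longrightarrow> holds p C \<Longrightarrow> E C \<noteq> {}"
  using holds_meet by blast

lemma holds_pts: "p \<in> Pt Y \<Longrightarrow> holds p (pts X)"
  using holds_compl[of p "pts X"] holds_nonempty[of p "compl (pts X)"] clopen_pts[OF X] Clop_compl
  by (auto simp: E_compl)

subsection \<open>Extending maps into compact zero-dimensional spaces\<close>

text \<open>
  The value at \<open>p\<close> is the unique \<open>k\<close> that lies in exactly those clopen sets of \<open>K\<close> at whose preimages \<open>p\<close> holds.
  It exists since the clopen sets of \<open>K\<close> at whose preimages \<open>p\<close> does not hold do not cover \<open>K\<close>: the preimages of
  a finite subcover would cover \<open>X\<close>, against \<open>Fin_avoid\<close>.
\<close>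
lemma extend_to_compact:
  assumes K: "is_space mem K" and comp: "compact_space mem K" and zd: "zero_dimensional mem K" and T1K: "T1 mem K"
    and f: "f \<in> E (Cm X K)"
  obtains g where "g \<in> E (Cm Y K)" "\<And>x. x \<in> Pt X \<Longrightarrow> g \<bullet> (e \<bullet> x) = f \<bullet> x"
proof -
  define pre where "pre C = coll {x \<in> Pt X. f \<bullet> x \<in> E C}" for C
  have dpre: "definable_term1 mem pre" unfolding pre_def by (intro dfn)
  note dpre' = definable_term_unary[OF dpre]
  have Epre: "E (pre C) = {x \<in> Pt X. f \<bullet> x \<in> E C}" for C unfolding pre_def by (rule E_vimage)
  have Cpre: "Clop (pre C)" if "clopen mem K C" for C
    unfolding pre_def by (rule clopen_vimage[OF X K f that])
  define lim where "lim p k \<longleftrightarrow> k \<in> Pt K \<and> (\<forall>C. clopen mem K C \<longrightarrow> (k \<in> E C \<longleftrightarrow> holds p (pre C)))" for p k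
  have sep: "k = l" if kl: "k \<in> Pt K" "l \<in> Pt K" and eq: "\<And>C. clopen mem K C \<Longrightarrow> k \<in> E C \<longleftrightarrow> l \<in> E C" for k l
  proof (rule ccontr)
    assume "k \<noteq> l"
    then obtain U where U: "U \<in> Op K" "k \<in> E U" "l \<notin> E U" using T1K kl unfolding T1_def by blast
    then obtain C where "clopen mem K C" "k \<in> E C" "E C \<subseteq> E U" using zd unfolding zero_dimensional_def by blast
    then show False using eq U(3) by blast
  qed
  have ex1: "\<exists>!k. lim p k" if p: "p \<in> Pt Y" for p
  proof -
    define \<U> where "\<U> = coll {C \<in> Op K. clopen mem K C \<and> \<not> holds p (pre C)}"
    have \<U>: "E \<U> = {C \<in> Op K. clopen mem K C \<and> \<not> holds p (pre C)}"
      unfolding \<U>_def by (rule E_sep) (intro dfn dpre')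
    have "vunion mem \<U> \<noteq> pts K"
    proof
      assume "vunion mem \<U> = pts K"
      moreover have "E \<U> \<subseteq> Op K" unfolding \<U> by blast
      ultimately obtain \<V> where \<V>: "E \<V> \<subseteq> E \<U>" "Fin \<V>" "vunion mem \<V> = pts K"
        using comp unfolding compact_space_def by blast
      have EF: "E (coll (pre ` E \<V>)) = pre ` E \<V>" by (rule E_coll[OF small_image[OF dpre]])
      have "\<exists>x\<in>Pt X. \<forall>C\<in>E (coll (pre ` E \<V>)). x \<notin> E C"
      proof (rule Fin_avoid[OF p Fin_image[OF dpre \<V>(2)]])
        fix C assume "C \<in> E (coll (pre ` E \<V>))"
        then show "Clop C \<and> \<not> holds p C" using \<V>(1) Cpre unfolding EF \<U> by blast
      qed
      then obtain x where x: "x \<in> Pt X" "\<forall>C\<in>E \<V>. x \<notin> E (pre C)" unfolding EF by blast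
      then have "f \<bullet> x \<notin> E (vunion mem \<V>)" unfolding E_vunion Epre by blast
      then show False using Cm_in[OF f x(1)] \<V>(3) by simp
    qed
    moreover have "E (vunion mem \<U>) \<subseteq> Pt K" unfolding E_vunion \<U> using open_subset[OF K] by blast
    ultimately obtain k where k: "k \<in> Pt K" "k \<notin> E (vunion mem \<U>)" using E_eq by blast
    have "k \<in> E C \<longleftrightarrow> holds p (pre C)" if C: "clopen mem K C" for C
    proof -
      have 1: "holds p (pre C)" if "k \<in> E C" "clopen mem K C" for C
        using k(2) that unfolding E_vunion \<U> clopen_def by blast
      let ?D = "coll {x \<in> Pt K. x \<notin> E C}"
      have D: "clopen mem K ?D" by (rule clopen_compl[OF K C])
      have ED: "E ?D = {x \<in> Pt K. x \<notin> E C}" by (rule E_sep) (intro dfn)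
      have "pre ?D = compl (pre C)"
        by (rule E_eq) (use Cm_in[OF f] in \<open>auto simp: Epre ED E_compl\<close>)
      then have "k \<notin> E C \<Longrightarrow> \<not> holds p (pre C)"
        using 1[of ?D] D ED k(1) holds_compl[OF p Cpre[OF C]] by simp
      then show ?thesis using 1 C by blast
    qed
    then have "lim p k" unfolding lim_def using k(1) by blast
    moreover have "l = k" if "lim p l" for l
      by (rule sep) (use that \<open>lim p k\<close> in \<open>auto simp: lim_def\<close>)
    ultimately show ?thesis by blast
  qed
  have dlim: "definable2 mem lim" unfolding lim_def by (intro dfn dpre')
  note dlim' = definable_binary[OF dlim]
  define g where "g = Lam (pts Y) (\<lambda>p. descr (lim p))"
  have dg: "definable_term1 mem (\<lambda>p. descr (lim p))" by (intro dfn dlim')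
  have lim: "lim p (g \<bullet> p)" if p: "p \<in> Pt Y" for p
  proof -
    obtain k where k: "lim p k" using ex1[OF p] by blast
    then show ?thesis using descr_eq[OF ex1[OF p] k] by (simp add: g_def Lam_val[OF dg p])
  qed
  have gF: "g \<in> E (Fun (pts Y) (pts K))"
    unfolding g_def
  proof (rule Lam_in[OF dg])
    fix p assume p: "p \<in> Pt Y"
    then have "lim p (descr (lim p))" using lim[OF p] by (simp add: g_def Lam_val[OF dg p])
    then show "descr (lim p) \<in> Pt K" unfolding lim_def[of p "descr (lim p)"] by (rule conjunct1)
  qed
  have "g \<in> E (Cm Y K)"
  proof (rule CmI_local[OF space_Y gF])
    fix p V assume p: "p \<in> Pt Y" and V: "V \<in> Op K" "g \<bullet> p \<in> E V"
    then obtain C where C: "clopen mem K C" "g \<bullet> p \<in> E C" "E C \<subseteq> E V"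
      using zd unfolding zero_dimensional_def by blast
    have "hat (pre C) \<in> Op Y" using clopen_hat[OF Cpre[OF C(1)]] unfolding clopen_def by blast
    moreover have "p \<in> E (hat (pre C))" using lim[OF p] C p unfolding lim_def E_hat by blast
    moreover have "\<forall>q\<in>E (hat (pre C)). g \<bullet> q \<in> E V"
      using lim C unfolding lim_def E_hat by blast
    ultimately show "\<exists>U\<in>Op Y. p \<in> E U \<and> (\<forall>u\<in>E U. g \<bullet> u \<in> E V)" by blast
  qed
  moreover have "g \<bullet> (e \<bullet> x) = f \<bullet> x" if x: "x \<in> Pt X" for x
  proof (rule sep)
    show "g \<bullet> (e \<bullet> x) \<in> Pt K" using lim[OF e_in[OF x]] by (simp add: lim_def)
    show "f \<bullet> x \<in> Pt K" using Cm_in[OF f x] .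
    fix C assume C: "clopen mem K C"
    show "g \<bullet> (e \<bullet> x) \<in> E C \<longleftrightarrow> f \<bullet> x \<in> E C"
      using lim[OF e_in[OF x]] C holds_e[OF x Cpre[OF C]] x by (simp add: lim_def Epre)
  qed
  ultimately show thesis by (rule that)
qed

end

section \<open>The real line of the model\<close>

locale complete_reals = ZF mem for mem :: "'a \<Rightarrow> 'a \<Rightarrow> bool" +
  fixes R :: "'a ofield"
  assumes R: "complete_ordered_field mem R"
begin

abbreviation "Rc \<equiv> E (car R)"
abbreviation "RR \<equiv> ring_of mem R"
abbreviation "nul \<equiv> rzero R"
abbreviation "uni \<equiv> rone R"
abbreviation "leR \<equiv> rle mem R"
abbreviation "RS \<equiv> real_space mem R"

text \<open>
  Addition in terms of the definable application.  The field operations of \<open>RR\<close> agree with it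
  on the carrier, but need not be definable elsewhere.
\<close>
definition plus :: "'a \<Rightarrow> 'a \<Rightarrow> 'a" (infixl "\<boxplus>" 65) where
  "x \<boxplus> y = rplus R \<bullet> pair x y"

lemma definable_term_plus [dfn]:
  "definable_term mem F \<Longrightarrow> definable_term mem G \<Longrightarrow> definable_term mem (\<lambda>s. F s \<boxplus> G s)"
  unfolding plus_def by (intro dfn)

lemma definable_le [dfn]:
  "definable_term mem F \<Longrightarrow> definable_term mem G \<Longrightarrow> definable mem (\<lambda>s. leR (F s) (G s))"
  unfolding rle_def by (intro dfn)

lemma field_R: "field RR"
  using R unfolding complete_ordered_field_def by blast

lemma carrier_R [simp]: "carrier RR = Rc" "zero RR = nul" "one RR = uni"
  by (simp_all add: ring_of_def)

lemma add_R: "x \<in> Rc \<Longrightarrow> y \<in> Rc \<Longrightarrow> x \<oplus>\<^bsub>RR\<^esub> y = x \<boxplus> y"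
proof -
  have "rplus R \<in> E (Fun (Cart (car R) (car R)) (car R))"
    using R unfolding complete_ordered_field_def by blast
  then show "x \<in> Rc \<Longrightarrow> y \<in> Rc \<Longrightarrow> ?thesis"
    using app_val[of "rplus R" "Cart (car R) (car R)" "car R" "pair x y"] by (simp add: ring_of_def plus_def)
qed

sublocale F: field RR
  by (rule field_R)

lemma nul_in [simp]: "nul \<in> Rc" and uni_in [simp]: "uni \<in> Rc" and uni_neq_nul: "uni \<noteq> nul"
  using F.zero_closed F.one_closed F.one_not_zero by simp_all

lemma plus_in [simp]: "x \<in> Rc \<Longrightarrow> y \<in> Rc \<Longrightarrow> x \<boxplus> y \<in> Rc"
  using F.a_closed[of x y] by (simp add: add_R)

lemma plus_nul [simp]: "x \<in> Rc \<Longrightarrow> x \<boxplus> nul = x" "x \<in> Rc \<Longrightarrow> nul \<boxplus> x = x"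
  using F.r_zero[of x] F.l_zero[of x] by (simp_all add: add_R)

lemma plus_assoc: "x \<in> Rc \<Longrightarrow> y \<in> Rc \<Longrightarrow> z \<in> Rc \<Longrightarrow> x \<boxplus> y \<boxplus> z = x \<boxplus> (y \<boxplus> z)"
  using F.a_assoc[of x y z] by (simp add: add_R)

lemma plus_comm: "x \<in> Rc \<Longrightarrow> y \<in> Rc \<Longrightarrow> x \<boxplus> y = y \<boxplus> x"
  using F.a_comm[of x y] by (simp add: add_R)

lemma plus_left_comm: "x \<in> Rc \<Longrightarrow> y \<in> Rc \<Longrightarrow> z \<in> Rc \<Longrightarrow> x \<boxplus> (y \<boxplus> z) = y \<boxplus> (x \<boxplus> z)"
  using plus_assoc[of x y z] plus_assoc[of y x z] plus_comm[of x y] by simp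

lemmas plus_ac = plus_assoc plus_comm plus_left_comm

lemma difference:
  assumes "x \<in> Rc" "y \<in> Rc"
  obtains d where "d \<in> Rc" "y \<boxplus> d = x"
proof
  let ?n = "\<ominus>\<^bsub>RR\<^esub> y"
  have n: "?n \<in> Rc" using F.a_inv_closed[of y] assms by simp
  have "y \<boxplus> ?n = nul" using F.r_neg[of y] assms n by (simp add: add_R)
  then show "?n \<boxplus> x \<in> Rc" "y \<boxplus> (?n \<boxplus> x) = x" using assms n by (simp_all add: plus_assoc[symmetric])
qed

lemma linear_R: "linear_order_on Rc {(x, y). leR x y}"
  using R unfolding complete_ordered_field_def by blast

lemma le_refl [simp]: "x \<in> Rc \<Longrightarrow> leR x x"
  using linear_R unfolding order_on_defs refl_on_def by blast

lemma le_trans: "leR x y \<Longrightarrow> leR y z \<Longrightarrow> leR x z"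
  using linear_R unfolding order_on_defs trans_def by blast

lemma le_antisym: "leR x y \<Longrightarrow> leR y x \<Longrightarrow> x = y"
  using linear_R unfolding order_on_defs antisym_def by blast

lemma le_linear: "x \<in> Rc \<Longrightarrow> y \<in> Rc \<Longrightarrow> leR x y \<or> leR y x"
proof -
  have "total_on Rc {(x, y). leR x y}" using linear_R unfolding order_on_defs by blast
  then have "\<forall>x\<in>Rc. \<forall>y\<in>Rc. x \<noteq> y \<longrightarrow> leR x y \<or> leR y x" by (simp add: total_on_def)
  then show "x \<in> Rc \<Longrightarrow> y \<in> Rc \<Longrightarrow> leR x y \<or> leR y x" by (cases "x = y") simp_all
qed

lemma le_plus: "x \<in> Rc \<Longrightarrow> y \<in> Rc \<Longrightarrow> z \<in> Rc \<Longrightarrow> leR x y \<Longrightarrow> leR (x \<boxplus> z) (y \<boxplus> z)"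
proof -
  have "\<forall>x\<in>Rc. \<forall>y\<in>Rc. \<forall>z\<in>Rc. leR x y \<longrightarrow> leR (x \<oplus>\<^bsub>RR\<^esub> z) (y \<oplus>\<^bsub>RR\<^esub> z)"
    using R unfolding complete_ordered_field_def by blast
  then show "x \<in> Rc \<Longrightarrow> y \<in> Rc \<Longrightarrow> z \<in> Rc \<Longrightarrow> leR x y \<Longrightarrow> ?thesis" using add_R by metis
qed

lemma le_plus_iff:
  assumes "x \<in> Rc" "y \<in> Rc" "z \<in> Rc"
  shows "leR (x \<boxplus> z) (y \<boxplus> z) \<longleftrightarrow> leR x y"
proof
  assume *: "leR (x \<boxplus> z) (y \<boxplus> z)"
  obtain n where n: "n \<in> Rc" "z \<boxplus> n = nul" using difference[OF nul_in assms(3)] .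
  have "leR (x \<boxplus> z \<boxplus> n) (y \<boxplus> z \<boxplus> n)" by (rule le_plus) (use * assms n in simp_all)
  then show "leR x y" using assms n by (simp add: plus_assoc)
qed (use le_plus assms in blast)

lemma le_plus_iff': "x \<in> Rc \<Longrightarrow> y \<in> Rc \<Longrightarrow> z \<in> Rc \<Longrightarrow> leR (z \<boxplus> x) (z \<boxplus> y) \<longleftrightarrow> leR x y"
  using le_plus_iff plus_comm by metis

lemma le_mult_nonneg: "x \<in> Rc \<Longrightarrow> y \<in> Rc \<Longrightarrow> leR nul x \<Longrightarrow> leR nul y \<Longrightarrow> leR nul (x \<otimes>\<^bsub>RR\<^esub> y)"
  using R unfolding complete_ordered_field_def by blast

lemma nul_le_uni: "leR nul uni"
proof (rule ccontr)
  assume not: "\<not> leR nul uni"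
  then have 1: "leR uni nul" using le_linear[OF nul_in uni_in] by blast
  let ?n = "\<ominus>\<^bsub>RR\<^esub> uni"
  have n: "?n \<in> Rc" "uni \<boxplus> ?n = nul" using F.a_inv_closed[of uni] F.r_neg[of uni] by (simp_all add: add_R)
  have "leR (uni \<boxplus> ?n) (nul \<boxplus> ?n)" by (rule le_plus) (use 1 n in simp_all)
  then have "leR nul ?n" using n by simp
  then have "leR nul (?n \<otimes>\<^bsub>RR\<^esub> ?n)" using le_mult_nonneg n by blast
  moreover have "?n \<otimes>\<^bsub>RR\<^esub> ?n = uni" using F.l_minus[of uni ?n] n(1) F.minus_minus[of uni] F.l_one[of ?n] by simp
  ultimately show False using not by simp
qed

definition positive :: "'a \<Rightarrow> bool" where
  "positive d \<longleftrightarrow> d \<in> Rc \<and> leR nul d \<and> d \<noteq> nul"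

lemma definable_positive [dfn]: "definable_term mem F \<Longrightarrow> definable mem (\<lambda>s. positive (F s))"
  unfolding positive_def by (intro dfn)

lemma positive_iff: "positive d \<longleftrightarrow> d \<in> Rc \<and> rless mem R nul d"
  unfolding positive_def rless_def by blast

lemma positive_in: "positive d \<Longrightarrow> d \<in> Rc" and positive_le: "positive d \<Longrightarrow> leR nul d"
  by (simp_all add: positive_def)

lemma positive_not_le: "positive d \<Longrightarrow> \<not> leR d nul"
  using le_antisym unfolding positive_def by blast

lemma positiveI: "d \<in> Rc \<Longrightarrow> \<not> leR d nul \<Longrightarrow> positive d"
  using le_linear[OF nul_in, of d] le_refl unfolding positive_def by auto

lemma uni_positive: "positive uni"
  using nul_le_uni uni_neq_nul by (simp add: positive_def)

text \<open>
  The half of \<open>e\<close> is its product with the inverse of two; it is positive since twice a nonpositive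
  element is nonpositive.
\<close>
lemma half:
  assumes "positive e"
  obtains d where "positive d" "d \<boxplus> d = e"
proof -
  let ?two = "uni \<boxplus> uni"
  have nonpos: "leR (d \<boxplus> d) nul" if d: "d \<in> Rc" "leR d nul" for d
  proof -
    have "leR (d \<boxplus> d) (nul \<boxplus> d)" by (rule le_plus) (use d in simp_all)
    then show ?thesis using d le_trans by simp
  qed
  have two: "?two \<in> Rc" by simp
  have "?two \<noteq> nul"
  proof
    assume "?two = nul"
    moreover have "leR (nul \<boxplus> uni) (uni \<boxplus> uni)" by (rule le_plus) (use nul_le_uni in simp_all)
    ultimately show False using positive_not_le[OF uni_positive] by simp
  qed
  then have "?two \<in> Units RR" using F.field_Units by simp
  then have inv: "inv\<^bsub>RR\<^esub> ?two \<in> Rc" "?two \<otimes>\<^bsub>RR\<^esub> inv\<^bsub>RR\<^esub> ?two = uni"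
    using F.Units_inv_closed F.Units_r_inv by simp_all
  have e: "e \<in> Rc" by (rule positive_in[OF assms])
  define d where "d = inv\<^bsub>RR\<^esub> ?two \<otimes>\<^bsub>RR\<^esub> e"
  have d: "d \<in> Rc" unfolding d_def using F.m_closed[of "inv\<^bsub>RR\<^esub> ?two" e] inv(1) e by simp
  have "d \<boxplus> d = ?two \<otimes>\<^bsub>RR\<^esub> d"
    using F.l_distr[of uni uni d] F.l_one[of d] d by (simp add: add_R)
  also have "\<dots> = e"
    unfolding d_def using F.m_assoc[of ?two "inv\<^bsub>RR\<^esub> ?two" e] F.l_one[of e] inv e by simp
  finally have dd: "d \<boxplus> d = e" .
  then have "\<not> leR d nul" using nonpos[OF d] positive_not_le[OF assms] by auto
  then show thesis using that positiveI[OF d] dd by blast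
qed

lemma supremum:
  assumes "definable1 mem P" "a \<in> Rc" "P a" and "u \<in> Rc" "\<And>x. x \<in> Rc \<Longrightarrow> P x \<Longrightarrow> leR x u"
  obtains s where "s \<in> Rc" "\<And>x. x \<in> Rc \<Longrightarrow> P x \<Longrightarrow> leR x s"
    "\<And>v. v \<in> Rc \<Longrightarrow> (\<And>x. x \<in> Rc \<Longrightarrow> P x \<Longrightarrow> leR x v) \<Longrightarrow> leR s v"
proof -
  have compl: "\<forall>S. E S \<subseteq> Rc \<and> E S \<noteq> {} \<and> (\<exists>u\<in>Rc. \<forall>x\<in>E S. leR x u) \<longrightarrow> (\<exists>s. is_sup mem R (E S) s)"
    using R unfolding complete_ordered_field_def by blast
  define S where "S = coll {x \<in> Rc. P x}"
  have S: "E S = {x \<in> Rc. P x}" unfolding S_def by (rule E_sep[OF assms(1)])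
  have "E S \<subseteq> Rc" "E S \<noteq> {}" "\<exists>u\<in>Rc. \<forall>x\<in>E S. leR x u" using assms(2-) unfolding S by blast+
  then obtain s where "is_sup mem R (E S) s" using compl by blast
  then show thesis using that unfolding is_sup_def S by blast
qed

subsection \<open>Closeness\<close>

text \<open>
  That the distance of \<open>x\<close> and \<open>y\<close> is at most \<open>d\<close>, in a form that is definable and for which the
  triangle inequality is immediate.
\<close>
definition close :: "'a \<Rightarrow> 'a \<Rightarrow> 'a \<Rightarrow> bool" where
  "close d x y \<longleftrightarrow> leR x (y \<boxplus> d) \<and> leR y (x \<boxplus> d)"

lemma definable_close [dfn]:
  "definable_term mem D \<Longrightarrow> definable_term mem F \<Longrightarrow> definable_term mem G \<Longrightarrow>
    definable mem (\<lambda>s. close (D s) (F s) (G s))"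
  unfolding close_def by (intro dfn)

lemma close_sym: "close d x y \<longleftrightarrow> close d y x"
  unfolding close_def by blast

lemma close_mono:
  assumes "close d x y" "leR d d'" "x \<in> Rc" "y \<in> Rc" "d \<in> Rc" "d' \<in> Rc"
  shows "close d' x y"
  using assms le_plus_iff'[of d d' x] le_plus_iff'[of d d' y] le_trans unfolding close_def by blast

lemma close_refl: "x \<in> Rc \<Longrightarrow> d \<in> Rc \<Longrightarrow> leR nul d \<Longrightarrow> close d x x"
  using le_plus_iff'[of nul d x] unfolding close_def by simp

lemma close_trans:
  assumes "close d x y" "close d' y z" and "x \<in> Rc" "y \<in> Rc" "z \<in> Rc" "d \<in> Rc" "d' \<in> Rc"
  shows "close (d \<boxplus> d') x z"
proof -
  have *: "leR x (z \<boxplus> (d \<boxplus> d'))" if "leR x (y \<boxplus> d)" "leR y (z \<boxplus> d')" "x \<in> Rc" "z \<in> Rc" for x z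
  proof -
    have "leR (y \<boxplus> d) (z \<boxplus> d' \<boxplus> d)" by (rule le_plus) (use that assms in simp_all)
    moreover have "z \<boxplus> d' \<boxplus> d = z \<boxplus> (d \<boxplus> d')" using that assms by (simp add: plus_ac)
    ultimately show ?thesis using that le_trans by metis
  qed
  have **: "leR z (x \<boxplus> (d \<boxplus> d'))" if "leR z (y \<boxplus> d')" "leR y (x \<boxplus> d)" "x \<in> Rc" "z \<in> Rc" for x z
  proof -
    have "leR (y \<boxplus> d') (x \<boxplus> d \<boxplus> d')" by (rule le_plus) (use that assms in simp_all)
    then show ?thesis using that assms le_trans by (simp add: plus_assoc)
  qed
  show ?thesis using assms * ** unfolding close_def by blast
qed

lemma close_double:
  assumes "close d x y" "close d y z" "d \<boxplus> d = e" "positive d" "x \<in> Rc" "y \<in> Rc" "z \<in> Rc"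
  shows "close e x z"
  using close_trans[OF assms(1,2)] assms positive_in by auto

lemma close_weaken:
  assumes "close d x y" "d \<boxplus> d = e" "positive d" "x \<in> Rc" "y \<in> Rc"
  shows "close e x y"
  using close_double[OF assms(1) close_refl assms(2,3)] assms positive_in positive_le by blast

lemma eq_if_close:
  assumes x: "x \<in> Rc" and y: "y \<in> Rc" and close: "\<And>d. positive d \<Longrightarrow> close d x y"
  shows "x = y"
proof -
  have *: "leR y x" if x: "x \<in> Rc" and y: "y \<in> Rc" and close: "\<And>d. positive d \<Longrightarrow> leR y (x \<boxplus> d)" for x y
  proof (rule ccontr)
    assume not: "\<not> leR y x"
    obtain t where t: "t \<in> Rc" "x \<boxplus> t = y" using difference[OF y x] .
    have "\<not> leR t nul"
    proof
      assume "leR t nul"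
      then have "leR (x \<boxplus> t) (x \<boxplus> nul)" using le_plus_iff'[of t nul x] t x by simp
      then show False using t x not by simp
    qed
    then obtain d where d: "positive d" "d \<boxplus> d = t" using half positiveI t(1) by blast
    have "leR (x \<boxplus> t) (x \<boxplus> d)" using close[OF d(1)] t by simp
    then have "leR (d \<boxplus> d) (d \<boxplus> nul)" using le_plus_iff'[of t d x] x t d positive_in[OF d(1)] by simp
    then have "leR d nul" using le_plus_iff'[of d nul d] positive_in[OF d(1)] by simp
    then show False using positive_not_le d(1) by blast
  qed
  show ?thesis using *[OF x y] *[OF y x] close le_antisym unfolding close_def by blast
qed

subsection \<open>Distances\<close>

lemma minus_facts:
  assumes "x \<in> Rc" "y \<in> Rc"
  shows "x \<ominus>\<^bsub>RR\<^esub> y \<in> Rc" "y \<boxplus> (x \<ominus>\<^bsub>RR\<^esub> y) = x"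
    "\<ominus>\<^bsub>RR\<^esub> (x \<ominus>\<^bsub>RR\<^esub> y) \<in> Rc" "x \<boxplus> (\<ominus>\<^bsub>RR\<^esub> (x \<ominus>\<^bsub>RR\<^esub> y)) = y"
proof -
  let ?r = "x \<ominus>\<^bsub>RR\<^esub> y" and ?n = "\<ominus>\<^bsub>RR\<^esub> y"
  have n: "?n \<in> Rc" "y \<boxplus> ?n = nul" using F.a_inv_closed[of y] F.r_neg[of y] assms by (simp_all add: add_R)
  have r: "?r = x \<boxplus> ?n" unfolding a_minus_def using assms n by (simp add: add_R)
  show 1: "?r \<in> Rc" using r assms n by simp
  have "y \<boxplus> ?r = y \<boxplus> ?n \<boxplus> x"
    unfolding r plus_comm[OF assms(1) n(1)] using plus_assoc[OF assms(2) n(1) assms(1)] by (rule sym)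
  then show 2: "y \<boxplus> ?r = x" using n assms by simp
  show 3: "\<ominus>\<^bsub>RR\<^esub> ?r \<in> Rc" using F.a_inv_closed[of ?r] 1 by simp
  have "?r \<boxplus> \<ominus>\<^bsub>RR\<^esub> ?r = nul" using F.r_neg[of ?r] 1 3 by (simp add: add_R)
  then have "y \<boxplus> ?r \<boxplus> \<ominus>\<^bsub>RR\<^esub> ?r = y" using assms 1 3 by (simp add: plus_assoc)
  then show "x \<boxplus> (\<ominus>\<^bsub>RR\<^esub> ?r) = y" using 2 by simp
qed

text \<open>
  A definable description of the distance, by which the set of distances of the values of a function
  exists in the model.
\<close>
lemma rdist_eq_iff:
  assumes x: "x \<in> Rc" and y: "y \<in> Rc"
  shows "r = rdist mem R x y \<longleftrightarrow> r \<in> Rc \<and> leR nul r \<and> (y \<boxplus> r = x \<or> x \<boxplus> r = y)"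
proof -
  let ?r = "x \<ominus>\<^bsub>RR\<^esub> y" and ?s = "\<ominus>\<^bsub>RR\<^esub> (x \<ominus>\<^bsub>RR\<^esub> y)"
  note m = minus_facts[OF x y]
  have cancel: "a = b" if "c \<boxplus> a = c \<boxplus> b" "a \<in> Rc" "b \<in> Rc" "c \<in> Rc" for a b c
    using that le_plus_iff'[of a b c] le_plus_iff'[of b a c] le_antisym by auto
  have uniq: "a = b" if a: "a \<in> Rc" "leR nul a" "y \<boxplus> a = x" and b: "b \<in> Rc" "leR nul b" "x \<boxplus> b = y" for a b
  proof -
    have "y \<boxplus> (a \<boxplus> b) = y \<boxplus> nul" using a b x y by (simp add: plus_assoc[symmetric])
    then have ab: "a \<boxplus> b = nul" using cancel[of y "a \<boxplus> b" nul] a b y by simp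
    have "leR (nul \<boxplus> b) (a \<boxplus> b)" by (rule le_plus) (use a b in simp_all)
    then have "b = nul" using ab b le_antisym by simp
    then show ?thesis using ab a by simp
  qed
  have pos: "rdist mem R x y \<in> Rc \<and> leR nul (rdist mem R x y) \<and>
      (y \<boxplus> rdist mem R x y = x \<or> x \<boxplus> rdist mem R x y = y)"
  proof (cases "leR nul ?r")
    case True
    then show ?thesis using m by (simp add: rdist_def rabs_def)
  next
    case False
    have "leR nul ?s"
    proof -
      have "leR ?r nul" using le_linear[OF nul_in m(1)] False by blast
      then have "leR (x \<boxplus> ?s \<boxplus> ?r) (x \<boxplus> ?s)" using m x y le_plus_iff'[of ?r nul y] by simp
      then have "leR x (x \<boxplus> ?s)" using m by simp
      then show ?thesis using le_plus_iff'[of nul ?s x] m x by simp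
    qed
    then show ?thesis using False m by (simp add: rdist_def rabs_def)
  qed
  show ?thesis
  proof
    assume "r \<in> Rc \<and> leR nul r \<and> (y \<boxplus> r = x \<or> x \<boxplus> r = y)"
    then show "r = rdist mem R x y"
      using pos uniq[of r "rdist mem R x y"] uniq[of "rdist mem R x y" r]
        cancel[of y r "rdist mem R x y"] cancel[of x r "rdist mem R x y"] x y by metis
  qed (use pos in blast)
qed

lemma rdist_le_iff:
  assumes x: "x \<in> Rc" and y: "y \<in> Rc" and d: "d \<in> Rc"
  shows "leR (rdist mem R x y) d \<longleftrightarrow> close d x y"
proof -
  define r where "r = rdist mem R x y"
  then have r: "r \<in> Rc" "leR nul r" "y \<boxplus> r = x \<or> x \<boxplus> r = y" using rdist_eq_iff[OF x y] by blast+
  have *: "leR r d \<longleftrightarrow> leR u (v \<boxplus> d) \<and> leR v (u \<boxplus> d)"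
    if uv: "u \<in> Rc" "v \<in> Rc" "v \<boxplus> r = u" for u v
  proof
    assume rd: "leR r d"
    have "leR u (v \<boxplus> d)" using rd uv d le_plus_iff'[of r d v] r by simp
    moreover have "leR nul d" using rd r le_trans by blast
    then have "leR nul (r \<boxplus> d)" using le_plus[of nul r d] le_trans[of nul d] r d by simp
    then have "leR v (v \<boxplus> (r \<boxplus> d))" using le_plus_iff'[of nul "r \<boxplus> d" v] uv r d by simp
    then have "leR v (u \<boxplus> d)" using uv r d by (simp add: plus_assoc[symmetric])
    ultimately show "leR u (v \<boxplus> d) \<and> leR v (u \<boxplus> d)" by blast
  next
    assume "leR u (v \<boxplus> d) \<and> leR v (u \<boxplus> d)"
    then show "leR r d" using uv d le_plus_iff'[of r d v] r by simp
  qed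
  show ?thesis unfolding close_def r_def[symmetric] using r(3) *[of x y] *[of y x] x y by blast
qed

lemma rabs_eq_rdist: "x \<in> Rc \<Longrightarrow> rabs mem R x = rdist mem R x nul"
proof -
  assume x: "x \<in> Rc"
  have "x \<ominus>\<^bsub>RR\<^esub> nul = x"
    using minus_facts(1,2)[OF x nul_in] by simp
  then show ?thesis by (simp add: rdist_def)
qed

lemma rabs_le_iff: "x \<in> Rc \<Longrightarrow> d \<in> Rc \<Longrightarrow> leR (rabs mem R x) d \<longleftrightarrow> close d x nul"
  by (simp add: rabs_eq_rdist rdist_le_iff)

subsection \<open>The topology of the real line\<close>

lemma Pt_RS [simp]: "pts RS = car R"
  by (simp add: real_space_def)

lemma RS_open_iff: "U \<in> Op RS \<longleftrightarrow> E U \<subseteq> Rc \<and> (\<forall>x\<in>E U. \<exists>d. positive d \<and> (\<forall>y\<in>Rc. close d y x \<longrightarrow> y \<in> E U))"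
proof -
  have iff: "(\<exists>e\<in>Rc. rless mem R nul e \<and> (\<forall>y\<in>Rc. rless mem R (rdist mem R y x) e \<longrightarrow> y \<in> S)) \<longleftrightarrow>
      (\<exists>d. positive d \<and> (\<forall>y\<in>Rc. close d y x \<longrightarrow> y \<in> S))" if x: "x \<in> Rc" for x S
  proof
    assume "\<exists>e\<in>Rc. rless mem R nul e \<and> (\<forall>y\<in>Rc. rless mem R (rdist mem R y x) e \<longrightarrow> y \<in> S)"
    then obtain e where e: "positive e" "\<And>y. y \<in> Rc \<Longrightarrow> rless mem R (rdist mem R y x) e \<Longrightarrow> y \<in> S"
      unfolding positive_iff by blast
    obtain d where d: "positive d" "d \<boxplus> d = e" using half[OF e(1)] .
    have "rless mem R (rdist mem R y x) e" if "y \<in> Rc" "close d y x" for y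
    proof -
      have 1: "leR (rdist mem R y x) d" using rdist_le_iff that x positive_in[OF d(1)] by blast
      have 2: "leR d e" using le_plus_iff'[of nul d d] positive_in[OF d(1)] positive_le[OF d(1)] d(2) by simp
      have "rdist mem R y x \<noteq> e"
      proof
        assume "rdist mem R y x = e"
        then have "leR (d \<boxplus> d) (d \<boxplus> nul)" using 1 d positive_in[OF d(1)] by simp
        then show False using le_plus_iff'[of d nul d] positive_in[OF d(1)] positive_not_le[OF d(1)] by simp
      qed
      then show ?thesis using le_trans[OF 1 2] unfolding rless_def by blast
    qed
    then show "\<exists>d. positive d \<and> (\<forall>y\<in>Rc. close d y x \<longrightarrow> y \<in> S)" using d(1) e(2) by blast
  next
    assume "\<exists>d. positive d \<and> (\<forall>y\<in>Rc. close d y x \<longrightarrow> y \<in> S)"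
    then obtain d where "positive d" "\<forall>y\<in>Rc. close d y x \<longrightarrow> y \<in> S" by blast
    then show "\<exists>e\<in>Rc. rless mem R nul e \<and> (\<forall>y\<in>Rc. rless mem R (rdist mem R y x) e \<longrightarrow> y \<in> S)"
      using rdist_le_iff x unfolding positive_iff rless_def by blast
  qed
  have "{U. E U \<subseteq> Rc \<and> (\<forall>x\<in>E U. \<exists>e\<in>Rc. rless mem R nul e \<and>
        (\<forall>y\<in>Rc. rless mem R (rdist mem R y x) e \<longrightarrow> y \<in> E U))} =
      {U. E U \<subseteq> Rc \<and> (\<forall>x\<in>E U. \<exists>d. positive d \<and> (\<forall>y\<in>Rc. close d y x \<longrightarrow> y \<in> E U))}"
    using iff by (intro Collect_cong conj_cong ball_cong refl) blast
  moreover have "small {U. E U \<subseteq> Rc \<and> (\<forall>x\<in>E U. \<exists>d. positive d \<and> (\<forall>y\<in>Rc. close d y x \<longrightarrow> y \<in> E U))}"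
    by (rule small_subset[of _ "vpow mem (car R)"]) ((auto simp: E_vpow)[1], intro dfn)
  ultimately show ?thesis by (simp add: real_space_def E_coll)
qed

lemma close_min:
  assumes "positive d" "positive e"
  obtains c where "positive c" "leR c d" "leR c e"
  using assms le_linear[of d e] le_refl positive_in by blast

lemma is_space_RS: "is_space mem RS"
  unfolding is_space_def Pt_RS
proof (intro conjI ballI allI impI)
  show "car R \<in> Op RS" unfolding RS_open_iff using uni_positive by blast
next
  fix U V assume U: "U \<in> Op RS" and V: "V \<in> Op RS"
  show "coll (E U \<inter> E V) \<in> Op RS"
    unfolding RS_open_iff E_Int
  proof (intro conjI ballI)
    show "E U \<inter> E V \<subseteq> Rc" using U unfolding RS_open_iff by blast
    fix x assume x: "x \<in> E U \<inter> E V"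
    then have xR: "x \<in> Rc" using U unfolding RS_open_iff by blast
    obtain d where d: "positive d" "\<forall>y\<in>Rc. close d y x \<longrightarrow> y \<in> E U" using U x unfolding RS_open_iff by blast
    obtain e where e: "positive e" "\<forall>y\<in>Rc. close e y x \<longrightarrow> y \<in> E V" using V x unfolding RS_open_iff by blast
    obtain c where c: "positive c" "leR c d" "leR c e" using close_min[OF d(1) e(1)] .
    have "close d y x \<and> close e y x" if "y \<in> Rc" "close c y x" for y
      using close_mono[OF that(2) c(2) that(1) xR] close_mono[OF that(2) c(3) that(1) xR]
        positive_in c(1) d(1) e(1) by blast
    then show "\<exists>d. positive d \<and> (\<forall>y\<in>Rc. close d y x \<longrightarrow> y \<in> E U \<inter> E V)" using c(1) d(2) e(2) by blast
  qed
next
  fix \<U> assume \<U>: "E \<U> \<subseteq> Op RS"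
  show "vunion mem \<U> \<in> Op RS"
    unfolding RS_open_iff E_vunion
  proof (intro conjI ballI)
    show "(\<Union>U\<in>E \<U>. E U) \<subseteq> Rc" using \<U> RS_open_iff by blast
    fix x assume "x \<in> (\<Union>U\<in>E \<U>. E U)"
    then obtain U where U: "U \<in> E \<U>" "x \<in> E U" by blast
    then obtain d where "positive d" "\<forall>y\<in>Rc. close d y x \<longrightarrow> y \<in> E U" using \<U> RS_open_iff by blast
    then show "\<exists>d. positive d \<and> (\<forall>y\<in>Rc. close d y x \<longrightarrow> y \<in> (\<Union>U\<in>E \<U>. E U))" using U(1) by blast
  qed
qed (simp add: RS_open_iff)

text \<open>
  The interior of the closed ball of radius \<open>e\<close>.  Its openness only uses halving and the
  triangle inequality, so strict inequalities between distances can be avoided.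
\<close>
lemma open_inside_ball:
  assumes x: "x \<in> Rc" and e: "positive e"
  obtains V where "V \<in> Op RS" "x \<in> E V" "\<And>y. y \<in> E V \<Longrightarrow> close e y x"
proof -
  define V where "V = coll {y \<in> Rc. \<exists>d. positive d \<and> (\<forall>z\<in>Rc. close d z y \<longrightarrow> close e z x)}"
  have V: "E V = {y \<in> Rc. \<exists>d. positive d \<and> (\<forall>z\<in>Rc. close d z y \<longrightarrow> close e z x)}"
    unfolding V_def by (rule E_sep) (intro dfn)
  have "V \<in> Op RS"
    unfolding RS_open_iff
  proof (intro conjI ballI)
    show "E V \<subseteq> Rc" unfolding V by blast
    fix y assume "y \<in> E V"
    then obtain d where y: "y \<in> Rc" and d: "positive d" "\<And>z. z \<in> Rc \<Longrightarrow> close d z y \<Longrightarrow> close e z x"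
      unfolding V by blast
    obtain h where h: "positive h" "h \<boxplus> h = d" using half[OF d(1)] .
    have "y' \<in> E V" if y': "y' \<in> Rc" "close h y' y" for y'
    proof -
      have "close e z x" if "z \<in> Rc" "close h z y'" for z
        using d(2)[OF that(1) close_double[OF that(2) y'(2) h(2,1) that(1) y'(1) y]] .
      then show ?thesis unfolding V using y'(1) h(1) by blast
    qed
    then show "\<exists>d. positive d \<and> (\<forall>z\<in>Rc. close d z y \<longrightarrow> z \<in> E V)" using h(1) by blast
  qed
  moreover have "x \<in> E V" unfolding V using x e by blast
  moreover have "close e y x" if "y \<in> E V" for y
    using that close_refl positive_in positive_le unfolding V by blast
  ultimately show thesis by (rule that)
qed

definition punctured :: "'a \<Rightarrow> 'a" where
  "punctured a = coll {r \<in> Rc. r \<noteq> a}"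

lemma E_punctured: "E (punctured a) = {r \<in> Rc. r \<noteq> a}"
  unfolding punctured_def by (rule E_sep) (intro dfn)

lemma open_punctured:
  assumes "a \<in> Rc"
  shows "punctured a \<in> Op RS"
proof -
  have "\<exists>d. positive d \<and> (\<forall>y\<in>Rc. close d y x \<longrightarrow> y \<in> {r \<in> Rc. r \<noteq> a})" if x: "x \<in> Rc" "x \<noteq> a" for x
  proof -
    obtain d where "positive d" "\<not> close d a x" using eq_if_close[OF assms x(1)] x(2) by blast
    then show ?thesis by blast
  qed
  then show ?thesis unfolding RS_open_iff E_punctured by blast
qed

lemma real_valued: "f \<in> E (Cm X RS) \<Longrightarrow> x \<in> Pt X \<Longrightarrow> f \<bullet> x \<in> Rc"
  using Cm_in[of f X RS x] by simp

end

section \<open>Functions of countable clopen oscillation\<close>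

context ZF
begin

definition open_partition :: "'a space \<Rightarrow> 'a \<Rightarrow> bool" where
  "open_partition X \<P> \<longleftrightarrow> (\<forall>P\<in>E \<P>. P \<in> Op X) \<and>
     (\<forall>P\<in>E \<P>. \<forall>P'\<in>E \<P>. \<forall>x. x \<in> E P \<longrightarrow> x \<in> E P' \<longrightarrow> P = P') \<and> (\<forall>x\<in>Pt X. \<exists>P\<in>E \<P>. x \<in> E P)"

text \<open>
  The members of the cover are numbered injectively by \<open>t\<close>, and each one loses the union \<open>before (t A)\<close>
  of the members with smaller numbers.  That union is clopen by induction on the number, as passing from
  \<open>n\<close> to its successor adds at most one member.
\<close>
lemma countable_clopen_cover_partition:
  assumes X: "is_space mem X" and ctb: "Ctb \<A>" and cl: "\<And>A. A \<in> E \<A> \<Longrightarrow> clopen mem X A"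
    and cover: "vunion mem \<A> = pts X"
  shows "\<exists>\<P>. open_partition X \<P> \<and> (\<forall>P\<in>E \<P>. \<exists>A\<in>E \<A>. E P \<subseteq> E A)"
proof -
  obtain t where t: "definable_term1 mem t" "inj_on t (E \<A>)" "t ` E \<A> \<subseteq> E om"
    using CtbE[OF ctb] .
  note dt = definable_term_unary[OF t(1)]
  have tom: "t A \<in> E om" if "A \<in> E \<A>" for A using t(3) that by blast
  define before where "before n = coll {x \<in> Pt X. \<exists>A\<in>E \<A>. x \<in> E A \<and> t A \<in> E n}" for n
  have Eb: "E (before n) = {x \<in> Pt X. \<exists>A\<in>E \<A>. x \<in> E A \<and> t A \<in> E n}" for n
    unfolding before_def by (rule E_sep) (intro dfn dt)
  have dbefore: "definable_term1 mem before" unfolding before_def by (intro dfn dt)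
  note db = definable_term_unary[OF dbefore]
  have clopen_before: "clopen mem X (before n)" if n: "n \<in> E om" for n
  proof (rule omega_induct[where P = "\<lambda>n. clopen mem X (before n)", OF _ n])
    show "definable1 mem (\<lambda>n. clopen mem X (before n))" by (intro dfn db)
    have "before Zero = Zero" by (rule E_eq) (simp add: Eb)
    then show "clopen mem X (before Zero)" using clopen_Zero[OF X] by simp
    fix n assume n: "n \<in> E om" and IH: "clopen mem X (before n)"
    show "clopen mem X (before (suc n))"
    proof (cases "\<exists>A\<in>E \<A>. t A = n")
      case False
      then have "before (suc n) = before n" by (intro E_eq) (auto simp: Eb)
      then show ?thesis using IH by simp
    next
      case True
      then obtain A where A: "A \<in> E \<A>" "t A = n" by blast
      have eq: "x \<in> E (before (suc n)) \<longleftrightarrow> x \<in> E (before n) \<or> x \<in> E A" if "x \<in> Pt X" for x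
        using A inj_onD[OF t(2)] that by (auto simp: Eb)
      have "clopen mem X (coll {x \<in> Pt X. x \<in> E (before (suc n))})"
      proof (rule clopen_sepI[OF X])
        show "definable1 mem (\<lambda>x. x \<in> E (before (suc n)))" by (intro dfn)
        fix x assume x: "x \<in> Pt X"
        obtain U where U: "U \<in> Op X" "x \<in> E U" "\<forall>u\<in>E U. u \<in> E (before n) \<longleftrightarrow> x \<in> E (before n)"
          using clopen_local[OF X IH x] by (elim bexE conjE)
        obtain V where V: "V \<in> Op X" "x \<in> E V" "\<forall>u\<in>E V. u \<in> E A \<longleftrightarrow> x \<in> E A"
          using clopen_local[OF X cl[OF A(1)] x] by (elim bexE conjE)
        have "\<forall>u\<in>E U \<inter> E V. u \<in> E (before (suc n)) \<longleftrightarrow> x \<in> E (before (suc n))"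
        proof
          fix u assume u: "u \<in> E U \<inter> E V"
          then have uX: "u \<in> Pt X" using open_subset[OF X U(1)] by blast
          show "u \<in> E (before (suc n)) \<longleftrightarrow> x \<in> E (before (suc n))"
            unfolding eq[OF uX] eq[OF x] using bspec[OF U(3), of u] bspec[OF V(3), of u] u by blast
        qed
        then show "\<exists>U\<in>Op X. x \<in> E U \<and> (\<forall>u\<in>E U. u \<in> E (before (suc n)) \<longleftrightarrow> x \<in> E (before (suc n)))"
          using U(2) V(2) by (intro bexI[OF _ open_Int[OF X U(1) V(1)]]) (unfold E_Int, blast)
      qed
      moreover have "{x \<in> Pt X. x \<in> E (before (suc n))} = E (before (suc n))" unfolding Eb by blast
      ultimately show ?thesis by simp
    qed
  qed
  define piece where "piece A = coll {x \<in> Pt X. x \<in> E A \<and> x \<notin> E (before (t A))}" for A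
  have Ep: "E (piece A) = {x \<in> Pt X. x \<in> E A \<and> x \<notin> E (before (t A))}" for A
    unfolding piece_def by (rule E_sep) (intro dfn)
  have dp: "definable_term1 mem piece" unfolding piece_def by (intro dfn dt db)
  define \<P> where "\<P> = coll (piece ` E \<A>)"
  have \<P>: "E \<P> = piece ` E \<A>" unfolding \<P>_def by (rule E_coll[OF small_image[OF dp]])
  have disj: "A = A'" if A: "A \<in> E \<A>" "x \<in> E (piece A)" and A': "A' \<in> E \<A>" "x \<in> E (piece A')" for A A' x
  proof -
    have "t A \<notin> E (t A')" "t A' \<notin> E (t A)" using that unfolding Ep Eb by blast+
    then have "t A = t A'" using omega_linear[OF tom[OF A(1)] tom[OF A'(1)]] by blast
    then show ?thesis using inj_onD[OF t(2)] A(1) A'(1) by blast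
  qed
  show ?thesis
    unfolding open_partition_def
  proof (intro exI[of _ \<P>] conjI ballI allI impI)
    fix P assume "P \<in> E \<P>"
    then obtain A where A: "A \<in> E \<A>" "P = piece A" unfolding \<P> by blast
    have "A \<in> Op X" "coll {x \<in> Pt X. x \<notin> E (before (t A))} \<in> Op X"
      using cl[OF A(1)] clopen_before[OF tom[OF A(1)]] unfolding clopen_iff[OF X] by blast+
    then have "coll (E A \<inter> E (coll {x \<in> Pt X. x \<notin> E (before (t A))})) \<in> Op X" by (rule open_Int[OF X])
    moreover have "E (coll {x \<in> Pt X. x \<notin> E (before (t A))}) = {x \<in> Pt X. x \<notin> E (before (t A))}"
      by (rule E_sep) (intro dfn)
    moreover have "E A \<inter> {x \<in> Pt X. x \<notin> E (before (t A))} = E (piece A)" unfolding Ep by blast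
    ultimately show "P \<in> Op X" using A(2) by simp
  next
    fix P assume "P \<in> E \<P>"
    then show "\<exists>A\<in>E \<A>. E P \<subseteq> E A" unfolding \<P> using Ep by blast
  next
    fix P P' x assume "P \<in> E \<P>" "P' \<in> E \<P>" "x \<in> E P" "x \<in> E P'"
    then show "P = P'" using disj unfolding \<P> by blast
  next
    fix x assume x: "x \<in> Pt X"
    have "\<exists>n\<in>E om. \<exists>A\<in>E \<A>. x \<in> E A \<and> t A = n"
      using x tom unfolding cover[symmetric] E_vunion by blast
    moreover have "definable1 mem (\<lambda>n. \<exists>A\<in>E \<A>. x \<in> E A \<and> t A = n)" by (intro dfn dt)
    ultimately have "\<exists>!n. n \<in> E om \<and> (\<exists>A\<in>E \<A>. x \<in> E A \<and> t A = n) \<and>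
        (\<forall>m\<in>E n. \<not> (\<exists>A\<in>E \<A>. x \<in> E A \<and> t A = m))"
      by (intro omega_least)
    then obtain n where n: "n \<in> E om \<and> (\<exists>A\<in>E \<A>. x \<in> E A \<and> t A = n) \<and>
        (\<forall>m\<in>E n. \<not> (\<exists>A\<in>E \<A>. x \<in> E A \<and> t A = m))"
      by (rule ex1E)
    then obtain A where A: "A \<in> E \<A>" "x \<in> E A" "t A = n" by blast
    have "x \<notin> E (before (t A))" unfolding Eb A(3) using n by blast
    then have "x \<in> E (piece A)" unfolding Ep using x A(2) by blast
    then show "\<exists>P\<in>E \<P>. x \<in> E P" unfolding \<P> using A(1) by blast
  qed
qed

text \<open>
  Both a union of pieces and its complement consist of whole pieces, which are open.
\<close>
lemma partition_clopen:
  assumes X: "is_space mem X" and \<P>: "open_partition X \<P>" and Q: "definable1 mem Q"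
  shows "clopen mem X (coll {x \<in> Pt X. \<exists>P\<in>E \<P>. x \<in> E P \<and> Q P})"
proof (rule clopen_sepI[OF X])
  show "definable1 mem (\<lambda>x. \<exists>P\<in>E \<P>. x \<in> E P \<and> Q P)" by (intro dfn definable_unary[OF Q])
  fix x assume "x \<in> Pt X"
  then obtain P where P: "P \<in> E \<P>" "x \<in> E P" using \<P> unfolding open_partition_def by blast
  have "(\<exists>P\<in>E \<P>. u \<in> E P \<and> Q P) \<longleftrightarrow> Q P" if "u \<in> E P" for u
    using P(1) that \<P> unfolding open_partition_def by blast
  moreover have "P \<in> Op X" using \<P> P(1) unfolding open_partition_def by blast
  ultimately show "\<exists>U\<in>Op X. x \<in> E U \<and> (\<forall>u\<in>E U. (\<exists>P\<in>E \<P>. u \<in> E P \<and> Q P) \<longleftrightarrow> (\<exists>P\<in>E \<P>. x \<in> E P \<and> Q P))"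
    using P(2) by blast
qed

end

context complete_reals
begin

abbreviation "US X \<equiv> U_countable_bounded mem R X"

definition small_on :: "'a \<Rightarrow> 'a \<Rightarrow> 'a \<Rightarrow> bool" where
  "small_on d f A \<longleftrightarrow> (\<forall>x\<in>E A. \<forall>y\<in>E A. close d (f \<bullet> x) (f \<bullet> y))"

lemma definable_small_on [dfn]:
  assumes "definable_term mem D" "definable_term mem F" "definable_term mem G"
  shows "definable mem (\<lambda>s. small_on (D s) (F s) (G s))"
proof -
  show ?thesis unfolding small_on_def by (intro dfn assms definable_term_rename[OF assms(1)]
      definable_term_rename[OF assms(2)] definable_term_rename[OF assms(3)])
qed

text \<open>
  The supremum in the definition of the oscillation exists as soon as the distances are bounded, by Dedekind
  completeness.
\<close>
lemma oscillation_le_iff: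
  assumes f: "f \<in> E (Cm X RS)" and A: "E A \<subseteq> Pt X" and d: "d \<in> Rc" "leR nul d"
  shows "(\<exists>s. is_osc mem R f A s \<and> leR s d) \<longleftrightarrow> small_on d f A"
proof (cases "E A = {}")
  case True
  then show ?thesis using d by (auto simp: is_osc_def small_on_def)
next
  case False
  then obtain a where a: "a \<in> E A" by blast
  have val: "app mem f x = f \<bullet> x" "f \<bullet> x \<in> Rc" if "x \<in> E A" for x
    using app_val[OF Cm_Fun[OF f]] real_valued[OF f] that A by blast+
  define P where "P r \<longleftrightarrow> (\<exists>x\<in>E A. \<exists>y\<in>E A. leR nul r \<and> (f \<bullet> y \<boxplus> r = f \<bullet> x \<or> f \<bullet> x \<boxplus> r = f \<bullet> y))" for r
  have P: "definable1 mem P" unfolding P_def by (intro dfn)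
  have S: "{rdist mem R (app mem f x) (app mem f y) | x y. x \<in> E A \<and> y \<in> E A} = {r \<in> Rc. P r}"
  proof (intro equalityI subsetI)
    fix r assume "r \<in> {rdist mem R (app mem f x) (app mem f y) | x y. x \<in> E A \<and> y \<in> E A}"
    then obtain x y where "x \<in> E A" "y \<in> E A" "r = rdist mem R (f \<bullet> x) (f \<bullet> y)" using val by auto
    then show "r \<in> {r \<in> Rc. P r}" unfolding P_def using rdist_eq_iff[OF val(2) val(2)] by blast
  next
    fix r assume "r \<in> {r \<in> Rc. P r}"
    then obtain x y where xy: "x \<in> E A" "y \<in> E A" "r = rdist mem R (f \<bullet> x) (f \<bullet> y)"
      unfolding P_def using rdist_eq_iff[OF val(2) val(2)] by blast
    then show "r \<in> {rdist mem R (app mem f x) (app mem f y) | x y. x \<in> E A \<and> y \<in> E A}"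
      using val(1)[OF xy(1)] val(1)[OF xy(2)] by (intro CollectI exI[of _ x] exI[of _ y]) simp
  qed
  have Pd: "(\<forall>r\<in>Rc. P r \<longrightarrow> leR r d) \<longleftrightarrow> small_on d f A"
  proof
    assume l: "\<forall>r\<in>Rc. P r \<longrightarrow> leR r d"
    show "small_on d f A"
      unfolding small_on_def
    proof (intro ballI)
      fix x y assume xy: "x \<in> E A" "y \<in> E A"
      have "rdist mem R (f \<bullet> x) (f \<bullet> y) \<in> {r \<in> Rc. P r}"
        unfolding S[symmetric] using xy val(1) by (intro CollectI exI[of _ x] exI[of _ y]) simp
      then show "close d (f \<bullet> x) (f \<bullet> y)" using l rdist_le_iff[OF val(2)[OF xy(1)] val(2)[OF xy(2)] d(1)] by blast
    qed
  next
    assume s: "small_on d f A"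
    show "\<forall>r\<in>Rc. P r \<longrightarrow> leR r d"
    proof (intro ballI impI)
      fix r assume "r \<in> Rc" "P r"
      then have "r \<in> {r \<in> Rc. P r}" by simp
      then obtain x y where xy: "x \<in> E A" "y \<in> E A" "r = rdist mem R (f \<bullet> x) (f \<bullet> y)"
        unfolding S[symmetric] using val(1) by auto
      then show "leR r d"
        using s rdist_le_iff[OF val(2)[OF xy(1)] val(2)[OF xy(2)] d(1)] unfolding small_on_def by blast
    qed
  qed
  have nonempty: "nul \<in> Rc" "P nul" unfolding P_def using a val(2) by auto
  show ?thesis
  proof
    assume "\<exists>s. is_osc mem R f A s \<and> leR s d"
    then obtain s where s: "is_osc mem R f A s" "leR s d" by blast
    then have "\<forall>r\<in>{r \<in> Rc. P r}. leR r s" using False unfolding is_osc_def S is_sup_def by simp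
    then have "\<forall>r\<in>Rc. P r \<longrightarrow> leR r d" using le_trans s(2) by blast
    then show "small_on d f A" unfolding Pd .
  next
    assume "small_on d f A"
    then have b: "\<And>r. r \<in> Rc \<Longrightarrow> P r \<Longrightarrow> leR r d" using Pd by blast
    obtain s where s: "s \<in> Rc" "\<And>x. x \<in> Rc \<Longrightarrow> P x \<Longrightarrow> leR x s"
        "\<And>v. v \<in> Rc \<Longrightarrow> (\<And>x. x \<in> Rc \<Longrightarrow> P x \<Longrightarrow> leR x v) \<Longrightarrow> leR s v"
      using supremum[OF P nonempty d(1) b] by blast
    have "is_osc mem R f A s" using False s unfolding is_osc_def S is_sup_def by simp
    moreover have "leR s d" using s(3)[OF d(1)] b by blast
    ultimately show "\<exists>s. is_osc mem R f A s \<and> leR s d" by blast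
  qed
qed

definition small_cover :: "'a space \<Rightarrow> 'a \<Rightarrow> 'a \<Rightarrow> 'a \<Rightarrow> bool" where
  "small_cover X f d \<A> \<longleftrightarrow> Ctb \<A> \<and> (\<forall>A\<in>E \<A>. clopen mem X A) \<and> vunion mem \<A> = pts X \<and>
     (\<forall>A\<in>E \<A>. small_on d f A)"

text \<open>
  Membership in \<open>U\<^sup>*\<close> without suprema and absolute values.  Since this description is definable,
  it also shows that the functions in question form a set.
\<close>
lemma US_iff:
  assumes X: "is_space mem X"
  shows "f \<in> E (US X) \<longleftrightarrow> f \<in> E (Cm X RS) \<and> (\<forall>d. positive d \<longrightarrow> (\<exists>\<A>. small_cover X f d \<A>)) \<and>
    (\<exists>b\<in>Rc. \<forall>x\<in>Pt X. close b (f \<bullet> x) nul)"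
proof -
  have osc: "(\<exists>\<A>. Ctb \<A> \<and> (\<forall>A\<in>E \<A>. clopen mem X A) \<and> vunion mem \<A> = pts X \<and>
        (\<forall>A\<in>E \<A>. \<exists>s. is_osc mem R f A s \<and> leR s d)) \<longleftrightarrow> (\<exists>\<A>. small_cover X f d \<A>)"
    if f: "f \<in> E (Cm X RS)" and d: "positive d" for f d
    unfolding small_cover_def
    using oscillation_le_iff[OF f clopen_subset[OF X] positive_in[OF d] positive_le[OF d]] by (metis (no_types, lifting))
  have "{f \<in> E (Cm X RS). \<forall>e\<in>Rc. rless mem R nul e \<longrightarrow>
       (\<exists>\<A>. Ctb \<A> \<and> (\<forall>A\<in>E \<A>. clopen mem X A) \<and> vunion mem \<A> = pts X \<and>
          (\<forall>A\<in>E \<A>. \<exists>s. is_osc mem R f A s \<and> leR s e))} =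
      {f \<in> E (Cm X RS). \<forall>d. positive d \<longrightarrow> (\<exists>\<A>. small_cover X f d \<A>)}"
    using osc unfolding positive_iff by blast
  moreover have "small {f \<in> E (Cm X RS). \<forall>d. positive d \<longrightarrow> (\<exists>\<A>. small_cover X f d \<A>)}"
    unfolding small_cover_def vunion_def by (rule small_sep) (intro dfn)
  ultimately have 1: "E (U_countable mem R X) = {f \<in> E (Cm X RS). \<forall>d. positive d \<longrightarrow> (\<exists>\<A>. small_cover X f d \<A>)}"
    unfolding U_countable_def by (simp add: E_coll)
  have "leR (rabs mem R (app mem f x)) b \<longleftrightarrow> close b (f \<bullet> x) nul"
    if "f \<in> E (Cm X RS)" "b \<in> Rc" "x \<in> Pt X" for f b x
    using app_val[OF Cm_Fun[OF that(1)] that(3)] rabs_le_iff[OF real_valued[OF that(1,3)] that(2)] by simp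
  then have "{f \<in> E (Cm X RS). \<exists>b\<in>Rc. \<forall>x\<in>Pt X. leR (rabs mem R (app mem f x)) b} =
      {f \<in> E (Cm X RS). \<exists>b\<in>Rc. \<forall>x\<in>Pt X. close b (f \<bullet> x) nul}"
    by (intro Collect_cong conj_cong bex_cong ball_cong refl) blast
  moreover have "small {f \<in> E (Cm X RS). \<exists>b\<in>Rc. \<forall>x\<in>Pt X. close b (f \<bullet> x) nul}"
    by (rule small_sep) (intro dfn)
  ultimately have 2: "E (C_bounded mem R X) = {f \<in> E (Cm X RS). \<exists>b\<in>Rc. \<forall>x\<in>Pt X. close b (f \<bullet> x) nul}"
    unfolding C_bounded_def by (simp add: E_coll)
  show ?thesis unfolding U_countable_bounded_def E_Int unfolding 1 2 by blast
qed

lemma US_Cm: "is_space mem X \<Longrightarrow> f \<in> E (US X) \<Longrightarrow> f \<in> E (Cm X RS)"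
  by (simp add: US_iff)

lemma US_Comp:
  assumes X: "is_space mem X" and Y: "is_space mem Y" and f: "f \<in> E (US Y)" and h: "h \<in> E (Cm X Y)"
  shows "Comp f h \<in> E (US X)"
proof -
  have fC: "f \<in> E (Cm Y RS)" by (rule US_Cm[OF Y f])
  have val: "Comp f h \<bullet> x = f \<bullet> (h \<bullet> x)" if "x \<in> Pt X" for x
    using Comp_val[OF Cm_Fun[OF h] Cm_Fun[OF fC] that] .
  have cov: "\<exists>\<B>. small_cover X (Comp f h) d \<B>" if d: "positive d" for d
  proof -
    obtain \<A> where \<A>: "Ctb \<A>" "\<forall>A\<in>E \<A>. clopen mem Y A" "vunion mem \<A> = pts Y" "\<forall>A\<in>E \<A>. small_on d f A"
      using f d unfolding US_iff[OF Y] small_cover_def by blast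
    define pre where "pre A = coll {x \<in> Pt X. h \<bullet> x \<in> E A}" for A
    have dpre: "definable_term1 mem pre" unfolding pre_def by (intro dfn)
    have Epre: "E (pre A) = {x \<in> Pt X. h \<bullet> x \<in> E A}" for A unfolding pre_def by (rule E_vimage)
    define \<B> where "\<B> = coll (pre ` E \<A>)"
    have \<B>: "E \<B> = pre ` E \<A>" unfolding \<B>_def by (rule E_coll[OF small_image[OF dpre]])
    have "Ctb \<B>" unfolding \<B>_def by (rule Ctb_image[OF dpre \<A>(1)])
    moreover have "\<forall>B\<in>E \<B>. clopen mem X B"
      using \<A>(2) clopen_vimage[OF X Y h] unfolding \<B> pre_def by blast
    moreover have "vunion mem \<B> = pts X"
    proof (rule E_eq)
      have un: "(\<Union>A\<in>E \<A>. E A) = Pt Y" using \<A>(3) E_vunion[of \<A>] by simp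
      have "E (vunion mem \<B>) = {x \<in> Pt X. h \<bullet> x \<in> (\<Union>A\<in>E \<A>. E A)}" unfolding E_vunion \<B> using Epre by auto
      then show "E (vunion mem \<B>) = Pt X" unfolding un using Cm_in[OF h] by blast
    qed
    moreover have "\<forall>B\<in>E \<B>. small_on d (Comp f h) B"
      using \<A>(4) val unfolding \<B> small_on_def by (auto simp: Epre)
    ultimately show ?thesis unfolding small_cover_def by blast
  qed
  obtain b where b: "b \<in> Rc" "\<forall>y\<in>Pt Y. close b (f \<bullet> y) nul" using f unfolding US_iff[OF Y] by blast
  have "\<forall>x\<in>Pt X. close b (Comp f h \<bullet> x) nul" using b(2) val Cm_in[OF h] by simp
  then show ?thesis unfolding US_iff[OF X] using Cm_Comp[OF h fC] cov b(1) by blast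
qed

lemma US_partition:
  assumes X: "is_space mem X" and f: "f \<in> E (US X)" and d: "positive d"
  shows "\<exists>\<P>. open_partition X \<P> \<and> (\<forall>P\<in>E \<P>. small_on d f P)"
proof -
  obtain \<A> where \<A>: "Ctb \<A>" "\<And>A. A \<in> E \<A> \<Longrightarrow> clopen mem X A" "vunion mem \<A> = pts X" "\<forall>A\<in>E \<A>. small_on d f A"
    using f d unfolding US_iff[OF X] small_cover_def by blast
  obtain \<P> where "open_partition X \<P>" "\<forall>P\<in>E \<P>. \<exists>A\<in>E \<A>. E P \<subseteq> E A"
    using countable_clopen_cover_partition[OF X \<A>(1-3)] by blast
  then show ?thesis using \<A>(4) unfolding small_on_def by (intro exI[of _ \<P>] conjI ballI) blast+
qed

end

section \<open>Comparison of the two extensions\<close>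

locale comparison = zero_dimensional_T1_space mem X + complete_reals mem R
  for mem :: "'a \<Rightarrow> 'a \<Rightarrow> bool" and X :: "'a space" and R :: "'a ofield"
begin

abbreviation "U \<equiv> US X"
abbreviation "Z \<equiv> fst (eU_extension mem R X)"
abbreviation "eU \<equiv> snd (eU_extension mem R X)"

subsection \<open>Limits of functions at points of the extension\<close>

text \<open>Convergence of \<open>f\<close> to \<open>v\<close> along the ultrafilter of clopen sets at which \<open>p\<close> holds.\<close>
definition lim :: "'a \<Rightarrow> 'a \<Rightarrow> 'a \<Rightarrow> bool" where
  "lim f p v \<longleftrightarrow> v \<in> Rc \<and>
     (\<forall>d. positive d \<longrightarrow> (\<exists>C. Clop C \<and> holds p C \<and> (\<forall>x\<in>E C. close d (f \<bullet> x) v)))"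

lemma definable_lim [dfn]:
  assumes "definable_term mem F" "definable_term mem G" "definable_term mem H"
  shows "definable mem (\<lambda>s. lim (F s) (G s) (H s))"
  unfolding lim_def
  by (intro dfn assms definable_term_rename[OF assms(1)] definable_term_rename[OF assms(2)]
      definable_term_rename[OF assms(3)])

lemma U_Cm: "f \<in> E U \<Longrightarrow> f \<in> E (Cm X RS)"
  by (rule US_Cm[OF X])

lemma U_real: "f \<in> E U \<Longrightarrow> x \<in> Pt X \<Longrightarrow> f \<bullet> x \<in> Rc"
  by (rule real_valued[OF U_Cm])

lemma lim_close:
  assumes f: "f \<in> E (Cm X RS)" and p: "p \<in> Pt Y" and v: "lim f p v" and d: "positive d"
    and C: "Clop C" "holds p C"
  obtains x where "x \<in> E C" "x \<in> Pt X" "close d (f \<bullet> x) v"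
proof -
  obtain D where D: "Clop D" "holds p D" "\<forall>x\<in>E D. close d (f \<bullet> x) v"
    using v d unfolding lim_def by blast
  obtain x where "x \<in> E C" "x \<in> E D" using holds_meet[OF p C D(1,2)] by blast
  then show thesis using that D(3) Clop_subset[OF C(1)] by blast
qed

lemma lim_unique:
  assumes f: "f \<in> E (Cm X RS)" and p: "p \<in> Pt Y" and v: "lim f p v" and w: "lim f p w"
  shows "v = w"
proof (rule eq_if_close)
  show vR: "v \<in> Rc" and wR: "w \<in> Rc" using v w unfolding lim_def by blast+
  fix d assume "positive d"
  then obtain h where h: "positive h" "h \<boxplus> h = d" using half by blast
  obtain C where C: "Clop C" "holds p C" "\<forall>x\<in>E C. close h (f \<bullet> x) v"
    using v h(1) unfolding lim_def by blast
  obtain x where x: "x \<in> E C" "x \<in> Pt X" "close h (f \<bullet> x) w" using lim_close[OF f p w h(1) C(1,2)] .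
  have "close h v (f \<bullet> x)" using C(3) x(1) close_sym by blast
  then show "close d v w" using close_double[OF _ x(3) h(2,1) vR real_valued[OF f x(2)] wR] by blast
qed

text \<open>
  The limit is the supremum of all \<open>c\<close> such that \<open>c \<le> f\<close> on a clopen set at which \<open>p\<close> holds.  Then \<open>f\<close> is at least
  \<open>v - d\<close> on such a set.  For the upper bound \<open>v + d\<close>, let \<open>D\<close> be the union of the pieces,
  of oscillation at most \<open>d / 2\<close>, on which \<open>f\<close> somewhere reaches \<open>v + d\<close>.  As \<open>f\<close> is at least \<open>v + d / 2\<close> on \<open>D\<close>,
  the point \<open>p\<close> does not hold at \<open>D\<close>, hence it holds at the complement, where \<open>f\<close> is at most \<open>v + d\<close>.
\<close>
lemma lim_exists:
  assumes f: "f \<in> E U" and p: "p \<in> Pt Y"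
  shows "\<exists>v. lim f p v"
proof -
  obtain b where b: "b \<in> Rc" "\<And>x. x \<in> Pt X \<Longrightarrow> close b (f \<bullet> x) nul"
    using f unfolding US_iff[OF X] by blast
  have fb: "leR (f \<bullet> x) b" "leR nul (f \<bullet> x \<boxplus> b)" if "x \<in> Pt X" for x
    using b(2)[OF that] b(1) unfolding close_def by simp_all
  obtain a where a: "a \<in> Rc" "b \<boxplus> a = nul" using difference[OF nul_in b(1)] .
  have fa: "leR a (f \<bullet> x)" if x: "x \<in> Pt X" for x
  proof -
    have "leR (nul \<boxplus> a) (f \<bullet> x \<boxplus> b \<boxplus> a)"
      by (rule le_plus) (use a b(1) U_real[OF f x] fb(2)[OF x] in simp_all)
    then show ?thesis using a b(1) U_real[OF f x] by (simp add: plus_assoc)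
  qed
  define below where "below c \<longleftrightarrow> (\<exists>C. Clop C \<and> holds p C \<and> (\<forall>x\<in>E C. leR c (f \<bullet> x)))" for c
  have dbelow: "definable1 mem below" unfolding below_def by (intro dfn)
  have below_a: "below a"
    unfolding below_def using clopen_pts[OF X] holds_pts[OF p] fa by blast
  have below_b: "leR c b" if c: "c \<in> Rc" "below c" for c
  proof -
    obtain C where C: "Clop C" "holds p C" "\<forall>x\<in>E C. leR c (f \<bullet> x)" using c(2) unfolding below_def by blast
    obtain x where "x \<in> E C" using holds_nonempty[OF p C(1,2)] by blast
    then show ?thesis using C(3) fb(1) Clop_subset[OF C(1)] le_trans by blast
  qed
  obtain v where v: "v \<in> Rc" "\<And>c. c \<in> Rc \<Longrightarrow> below c \<Longrightarrow> leR c v"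
      "\<And>w. w \<in> Rc \<Longrightarrow> (\<And>c. c \<in> Rc \<Longrightarrow> below c \<Longrightarrow> leR c w) \<Longrightarrow> leR v w"
    using supremum[OF dbelow a(1) below_a b(1) below_b] by blast
  have "lim f p v"
    unfolding lim_def
  proof (intro conjI allI impI v(1))
    fix d assume d: "positive d"
    note dR = positive_in[OF d]
    obtain w where w: "w \<in> Rc" "d \<boxplus> w = v" using difference[OF v(1) dR] .
    have "\<not> leR v w"
    proof
      assume "leR v w"
      then have "leR (d \<boxplus> w) (nul \<boxplus> w)" using w by simp
      then show False using le_plus_iff[OF dR nul_in w(1)] positive_not_le[OF d] by blast
    qed
    then obtain c where c: "c \<in> Rc" "below c" "\<not> leR c w" using v(3)[OF w(1)] by blast
    then have "leR w c" using le_linear[OF w(1) c(1)] by blast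
    then have "leR v (d \<boxplus> c)" using le_plus_iff'[OF w(1) c(1) dR] w(2) by simp
    obtain C where C: "Clop C" "holds p C" "\<forall>x\<in>E C. leR c (f \<bullet> x)" using c(2) unfolding below_def by blast
    have vC: "leR v (f \<bullet> x \<boxplus> d)" if x: "x \<in> E C" for x
    proof -
      have fx: "f \<bullet> x \<in> Rc" using U_real[OF f] Clop_subset[OF C(1)] x by blast
      then have "leR (d \<boxplus> c) (d \<boxplus> f \<bullet> x)" using le_plus_iff'[OF c(1) fx dR] C(3) x by blast
      then show ?thesis using \<open>leR v (d \<boxplus> c)\<close> le_trans plus_comm[OF dR fx] by metis
    qed
    obtain h where h: "positive h" "h \<boxplus> h = d" using half[OF d] .
    note hR = positive_in[OF h(1)]
    obtain \<P> where \<P>: "open_partition X \<P>" "\<And>P. P \<in> E \<P> \<Longrightarrow> small_on h f P" using US_partition[OF X f h(1)] by blast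
    define Q where "Q P \<longleftrightarrow> (\<exists>y\<in>E P. leR (v \<boxplus> d) (f \<bullet> y))" for P
    have dQ: "definable1 mem Q" unfolding Q_def by (intro dfn)
    define D where "D = coll {x \<in> Pt X. \<exists>P\<in>E \<P>. x \<in> E P \<and> Q P}"
    have D: "Clop D" unfolding D_def by (rule partition_clopen[OF X \<P>(1) dQ])
    have ED: "E D = {x \<in> Pt X. \<exists>P\<in>E \<P>. x \<in> E P \<and> Q P}"
      unfolding D_def by (rule E_sep) (intro dfn definable_unary[OF dQ])
    have vhD: "leR (v \<boxplus> h) (f \<bullet> x)" if x: "x \<in> E D" for x
    proof -
      obtain P y where P: "x \<in> Pt X" "P \<in> E \<P>" "x \<in> E P" "y \<in> E P" "leR (v \<boxplus> d) (f \<bullet> y)"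
        using x unfolding ED Q_def by blast
      have fx: "f \<bullet> x \<in> Rc" using U_real[OF f P(1)] .
      have "leR (f \<bullet> y) (f \<bullet> x \<boxplus> h)" using \<P>(2)[OF P(2)] P(3,4) unfolding small_on_def close_def by blast
      then have "leR (v \<boxplus> h \<boxplus> h) (f \<bullet> x \<boxplus> h)" using le_trans[OF P(5)] h(2) v(1) hR by (simp add: plus_assoc)
      then show ?thesis using le_plus_iff[of "v \<boxplus> h" "f \<bullet> x" h] v(1) hR fx by simp
    qed
    have "\<not> holds p D"
    proof
      assume "holds p D"
      then have "below (v \<boxplus> h)" unfolding below_def using D vhD by blast
      then have "leR (v \<boxplus> h) (v \<boxplus> nul)" using v(1,2) hR by simp
      then show False using le_plus_iff'[OF hR nul_in v(1)] positive_not_le[OF h(1)] by blast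
    qed
    then have cD: "Clop (compl D)" "holds p (compl D)" using holds_compl[OF p D] Clop_compl[OF D] by blast+
    have upD: "leR (f \<bullet> x) (v \<boxplus> d)" if x: "x \<in> E (compl D)" for x
    proof -
      have xX: "x \<in> Pt X" "x \<notin> E D" using x unfolding E_compl by blast+
      obtain P where P: "P \<in> E \<P>" "x \<in> E P" using \<P>(1) xX(1) unfolding open_partition_def by blast
      then have "\<not> leR (v \<boxplus> d) (f \<bullet> x)" using xX unfolding ED Q_def by blast
      then show ?thesis using le_linear[of "v \<boxplus> d" "f \<bullet> x"] v(1) dR U_real[OF f xX(1)] by simp
    qed
    have "\<forall>x\<in>E (common C (compl D)). close d (f \<bullet> x) v"
      using vC upD unfolding close_def E_common by blast
    then show "\<exists>C. Clop C \<and> holds p C \<and> (\<forall>x\<in>E C. close d (f \<bullet> x) v)"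
      using Clop_common[OF C(1) cD(1)] holds_Int[OF p C(1,2) cD] by blast
  qed
  then show ?thesis by blast
qed

lemma lim_e:
  assumes f: "f \<in> E (Cm X RS)" and x: "x \<in> Pt X" and v: "lim f (e \<bullet> x) v"
  shows "v = f \<bullet> x"
proof (rule eq_if_close)
  show "v \<in> Rc" using v unfolding lim_def by blast
  show "f \<bullet> x \<in> Rc" by (rule real_valued[OF f x])
  fix d assume "positive d"
  then obtain C where "Clop C" "holds (e \<bullet> x) C" "\<forall>x\<in>E C. close d (f \<bullet> x) v"
    using v unfolding lim_def by blast
  then show "close d v (f \<bullet> x)" using holds_e[OF x] close_sym by blast
qed

definition prolong :: "'a \<Rightarrow> 'a" where
  "prolong f = Lam (pts Y) (\<lambda>p. descr (lim f p))"

lemma definable_term_prolong [dfn]: "definable_term mem F \<Longrightarrow> definable_term mem (\<lambda>s. prolong (F s))"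
  by (rule definable_term_unary[where F = prolong]) (unfold prolong_def, intro dfn)

lemma lim_prolong:
  assumes f: "f \<in> E U" and p: "p \<in> Pt Y"
  shows "lim f p (prolong f \<bullet> p)"
proof -
  have d: "definable_term1 mem (\<lambda>p. descr (lim f p))" by (intro dfn)
  obtain v where v: "lim f p v" using lim_exists[OF f p] by blast
  then have "\<exists>!v. lim f p v" using lim_unique[OF U_Cm[OF f] p] by blast
  from descr_eq[OF this v] v show ?thesis by (simp add: prolong_def Lam_val[OF d p])
qed

lemma prolong_eqI:
  assumes f: "f \<in> E U" and p: "p \<in> Pt Y" and v: "lim f p v"
  shows "prolong f \<bullet> p = v"
  using lim_unique[OF U_Cm[OF f] p lim_prolong[OF f p] v] .

lemma prolong_e: "f \<in> E U \<Longrightarrow> x \<in> Pt X \<Longrightarrow> prolong f \<bullet> (e \<bullet> x) = f \<bullet> x"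
  using lim_e[OF U_Cm _ lim_prolong[OF _ e_in]] .

lemma prolong_real: "f \<in> E U \<Longrightarrow> p \<in> Pt Y \<Longrightarrow> prolong f \<bullet> p \<in> Rc"
  using lim_prolong unfolding lim_def by blast

lemma prolong_Cm:
  assumes f: "f \<in> E U"
  shows "prolong f \<in> E (Cm Y RS)"
proof (rule CmI_local[OF space_Y])
  have d: "definable_term1 mem (\<lambda>p. descr (lim f p))" by (intro dfn)
  show "prolong f \<in> E (Fun (pts Y) (pts RS))"
    unfolding prolong_def
  proof (rule Lam_in[OF d])
    fix p assume p: "p \<in> Pt Y"
    then show "descr (lim f p) \<in> Pt RS" using prolong_real[OF f p] by (simp add: prolong_def Lam_val[OF d p])
  qed
  fix p V assume p: "p \<in> Pt Y" and V: "V \<in> Op RS" "prolong f \<bullet> p \<in> E V"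
  let ?v = "prolong f \<bullet> p"
  obtain d where d: "positive d" "\<forall>y\<in>Rc. close d y ?v \<longrightarrow> y \<in> E V" using V unfolding RS_open_iff by blast
  obtain h where h: "positive h" "h \<boxplus> h = d" using half[OF d(1)] .
  obtain C where C: "Clop C" "holds p C" "\<forall>x\<in>E C. close h (f \<bullet> x) ?v"
    using lim_prolong[OF f p] h(1) unfolding lim_def by blast
  have "prolong f \<bullet> q \<in> E V" if q: "q \<in> E (hat C)" for q
  proof -
    have q': "q \<in> Pt Y" "holds q C" using q unfolding E_hat by blast+
    obtain x where x: "x \<in> E C" "x \<in> Pt X" "close h (f \<bullet> x) (prolong f \<bullet> q)"
      using lim_close[OF U_Cm[OF f] q'(1) lim_prolong[OF f q'(1)] h(1) C(1) q'(2)] .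
    have "close h (prolong f \<bullet> q) (f \<bullet> x)" using x(3) close_sym by blast
    moreover have "close h (f \<bullet> x) ?v" using C(3) x(1) by blast
    ultimately have "close d (prolong f \<bullet> q) ?v"
      by (rule close_double[OF _ _ h(2,1) prolong_real[OF f q'(1)] U_real[OF f x(2)] prolong_real[OF f p]])
    then show ?thesis using d(2) prolong_real[OF f q'(1)] by blast
  qed
  moreover have "hat C \<in> Op Y" using clopen_hat[OF C(1)] unfolding clopen_def by blast
  moreover have "p \<in> E (hat C)" using p C(2) unfolding E_hat by blast
  ultimately show "\<exists>W\<in>Op Y. p \<in> E W \<and> (\<forall>q\<in>E W. prolong f \<bullet> q \<in> E V)" by blast
qed

text \<open>
  Each member \<open>A\<close> of a countable cover is fattened to the clopen set \<open>G A\<close> of all pieces on which \<open>f\<close> comes within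
  \<open>2h\<close> of a value on \<open>A\<close>.  A point \<open>p\<close> of \<open>Y\<close> lies in one of the hats: near \<open>p\<close>, that is on a clopen set \<open>C\<close> at which
  \<open>p\<close> holds, all values of \<open>f\<close> are \<open>h\<close>-close to the limit, so if \<open>A\<close> contains one point of \<open>C\<close> then \<open>G A\<close> contains all of
  \<open>C\<close>.  A value of the extended function on the hat of \<open>G A\<close> is at distance at most \<open>h\<close> from a value on \<open>G A\<close>,
  which is at most \<open>h + 2h\<close> from a value on \<open>A\<close>.  Rounded up to powers of two, all this stays within
  \<open>d = 16h\<close>.
\<close>
lemma prolong_small_cover:
  assumes f: "f \<in> E U" and d: "positive d"
  shows "\<exists>\<G>. small_cover Y (prolong f) d \<G>"
proof -
  obtain d1 where d1: "positive d1" "d1 \<boxplus> d1 = d" using half[OF d] .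
  obtain d2 where d2: "positive d2" "d2 \<boxplus> d2 = d1" using half[OF d1(1)] .
  obtain d3 where d3: "positive d3" "d3 \<boxplus> d3 = d2" using half[OF d2(1)] .
  obtain h where h: "positive h" "h \<boxplus> h = d3" using half[OF d3(1)] .
  obtain \<A> where \<A>: "Ctb \<A>" "\<forall>A\<in>E \<A>. Clop A" "vunion mem \<A> = pts X" "\<forall>A\<in>E \<A>. small_on h f A"
    using f h(1) unfolding US_iff[OF X] small_cover_def by blast
  obtain \<P> where \<P>: "open_partition X \<P>" "\<And>P. P \<in> E \<P> \<Longrightarrow> small_on h f P" using US_partition[OF X f h(1)] by blast
  define Q where "Q A P \<longleftrightarrow> (\<exists>y\<in>E P. \<exists>z\<in>E A. close d3 (f \<bullet> y) (f \<bullet> z))" for A P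
  have dQ: "definable2 mem Q" unfolding Q_def by (intro dfn)
  note dQ' = definable_binary[OF dQ]
  define G where "G A = coll {x \<in> Pt X. \<exists>P\<in>E \<P>. x \<in> E P \<and> Q A P}" for A
  have CG: "Clop (G A)" for A unfolding G_def by (rule partition_clopen[OF X \<P>(1)]) (intro dfn dQ')
  have EG: "E (G A) = {x \<in> Pt X. \<exists>P\<in>E \<P>. x \<in> E P \<and> Q A P}" for A
    unfolding G_def by (rule E_sep) (intro dfn dQ')
  have dhG: "definable_term1 mem (\<lambda>A. hat (G A))" unfolding G_def by (intro dfn dQ')
  define \<G> where "\<G> = coll ((\<lambda>A. hat (G A)) ` E \<A>)"
  have \<G>: "E \<G> = (\<lambda>A. hat (G A)) ` E \<A>" unfolding \<G>_def by (rule E_coll[OF small_image[OF dhG]])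
  have "Ctb \<G>" unfolding \<G>_def by (rule Ctb_image[OF dhG \<A>(1)])
  moreover have "\<forall>B\<in>E \<G>. clopen mem Y B" unfolding \<G> using clopen_hat[OF CG] by blast
  moreover have "vunion mem \<G> = pts Y"
  proof (rule E_eq, intro equalityI subsetI)
    fix p assume "p \<in> E (vunion mem \<G>)"
    then obtain A where "p \<in> E (hat (G A))" unfolding E_vunion \<G> by blast
    then show "p \<in> Pt Y" unfolding E_hat by blast
  next
    fix p assume p: "p \<in> Pt Y"
    let ?v = "prolong f \<bullet> p"
    obtain C where C: "Clop C" "holds p C" "\<forall>x\<in>E C. close h (f \<bullet> x) ?v"
      using lim_prolong[OF f p] h(1) unfolding lim_def by blast
    obtain x where x: "x \<in> E C" using holds_nonempty[OF p C(1,2)] by blast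
    then have xX: "x \<in> Pt X" using Clop_subset[OF C(1)] by blast
    then obtain A where A: "A \<in> E \<A>" "x \<in> E A" unfolding \<A>(3)[symmetric] E_vunion by blast
    have "E C \<subseteq> E (G A)"
    proof
      fix y assume y: "y \<in> E C"
      then have yX: "y \<in> Pt X" using Clop_subset[OF C(1)] by blast
      obtain P where P: "P \<in> E \<P>" "y \<in> E P" using \<P>(1) yX unfolding open_partition_def by blast
      have "close h (f \<bullet> y) ?v" "close h ?v (f \<bullet> x)" using C(3) x y close_sym by blast+
      then have "close d3 (f \<bullet> y) (f \<bullet> x)"
        by (rule close_double[OF _ _ h(2,1) U_real[OF f yX] prolong_real[OF f p] U_real[OF f xX]])
      then show "y \<in> E (G A)" unfolding EG Q_def using yX P A(2) by blast
    qed
    then have "holds p (G A)" by (rule holds_mono[OF p C(1,2) CG])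
    then have "p \<in> E (hat (G A))" unfolding E_hat using p by simp
    then show "p \<in> E (vunion mem \<G>)" unfolding E_vunion \<G> using A(1) by (intro UN_I[of "hat (G A)"] imageI)
  qed
  moreover have "\<forall>B\<in>E \<G>. small_on d (prolong f) B"
  proof
    fix B assume "B \<in> E \<G>"
    then obtain A where A: "A \<in> E \<A>" "B = hat (G A)" unfolding \<G> by blast
    have near: "\<exists>z\<in>E A. close d2 (prolong f \<bullet> p) (f \<bullet> z) \<and> f \<bullet> z \<in> Rc" if p: "p \<in> E B" for p
    proof -
      have p': "p \<in> Pt Y" "holds p (G A)" using p unfolding A(2) E_hat by blast+
      obtain x where x: "x \<in> E (G A)" "x \<in> Pt X" "close h (f \<bullet> x) (prolong f \<bullet> p)"
        using lim_close[OF U_Cm[OF f] p'(1) lim_prolong[OF f p'(1)] h(1) CG p'(2)] .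
      obtain P y z where P: "P \<in> E \<P>" "x \<in> E P" "y \<in> E P" "z \<in> E A" "close d3 (f \<bullet> y) (f \<bullet> z)"
        using x(1) unfolding EG Q_def by blast
      have "P \<in> Op X" using \<P>(1) P(1) unfolding open_partition_def by blast
      then have fy: "f \<bullet> y \<in> Rc" using U_real[OF f] open_subset[OF X] P(3) by blast
      have "E A \<subseteq> Pt X" using \<A>(2) A(1) Clop_subset by blast
      then have fz: "f \<bullet> z \<in> Rc" using U_real[OF f] P(4) by blast
      note fx = U_real[OF f x(2)] and fp = prolong_real[OF f p'(1)]
      have "close h (prolong f \<bullet> p) (f \<bullet> x)" using x(3) close_sym by blast
      moreover have "close h (f \<bullet> x) (f \<bullet> y)" using \<P>(2)[OF P(1)] P(2,3) unfolding small_on_def by blast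
      ultimately have "close d3 (prolong f \<bullet> p) (f \<bullet> y)" by (rule close_double[OF _ _ h(2,1) fp fx fy])
      then have "close d2 (prolong f \<bullet> p) (f \<bullet> z)" using P(5) by (rule close_double[OF _ _ d3(2,1) fp fy fz])
      then show ?thesis using P(4) fz by blast
    qed
    show "small_on d (prolong f) B"
      unfolding small_on_def
    proof (intro ballI)
      fix p q assume p: "p \<in> E B" and q: "q \<in> E B"
      obtain z where z: "z \<in> E A" "close d2 (prolong f \<bullet> p) (f \<bullet> z)" "f \<bullet> z \<in> Rc" using near[OF p] by blast
      obtain w where w: "w \<in> E A" "close d2 (prolong f \<bullet> q) (f \<bullet> w)" "f \<bullet> w \<in> Rc" using near[OF q] by blast
      have fp: "prolong f \<bullet> p \<in> Rc" and fq: "prolong f \<bullet> q \<in> Rc"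
        using prolong_real[OF f] p q unfolding A(2) E_hat by blast+
      have "close h (f \<bullet> z) (f \<bullet> w)" using \<A>(4) A(1) z(1) w(1) unfolding small_on_def by blast
      then have "close d3 (f \<bullet> z) (f \<bullet> w)" by (rule close_weaken[OF _ h(2,1) z(3) w(3)])
      then have "close d2 (f \<bullet> z) (f \<bullet> w)" by (rule close_weaken[OF _ d3(2,1) z(3) w(3)])
      with z(2) have "close d1 (prolong f \<bullet> p) (f \<bullet> w)" by (rule close_double[OF _ _ d2(2,1) fp z(3) w(3)])
      moreover have "close d2 (f \<bullet> w) (prolong f \<bullet> q)" using w(2) close_sym by blast
      then have "close d1 (f \<bullet> w) (prolong f \<bullet> q)" by (rule close_weaken[OF _ d2(2,1) w(3) fq])
      ultimately show "close d (prolong f \<bullet> p) (prolong f \<bullet> q)" by (rule close_double[OF _ _ d1(2,1) fp w(3) fq])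
    qed
  qed
  ultimately show ?thesis unfolding small_cover_def by blast
qed

lemma prolong_bounded:
  assumes f: "f \<in> E U"
  shows "\<exists>b\<in>Rc. \<forall>p\<in>Pt Y. close b (prolong f \<bullet> p) nul"
proof -
  obtain b where b: "b \<in> Rc" "\<And>x. x \<in> Pt X \<Longrightarrow> close b (f \<bullet> x) nul"
    using f unfolding US_iff[OF X] by blast
  have "close (uni \<boxplus> b) (prolong f \<bullet> p) nul" if p: "p \<in> Pt Y" for p
  proof -
    obtain x where x: "x \<in> Pt X" "close uni (f \<bullet> x) (prolong f \<bullet> p)"
      using lim_close[OF U_Cm[OF f] p lim_prolong[OF f p] uni_positive clopen_pts[OF X] holds_pts[OF p]] .
    have "close uni (prolong f \<bullet> p) (f \<bullet> x)" using x(2) close_sym by blast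
    from close_trans[OF this b(2)[OF x(1)]] show ?thesis
      using prolong_real[OF f p] U_real[OF f x(1)] b(1) by simp
  qed
  then show ?thesis using b(1) by (intro bexI[of _ "uni \<boxplus> b"]) simp_all
qed

lemma prolong_US: "f \<in> E U \<Longrightarrow> prolong f \<in> E (US Y)"
  unfolding US_iff[OF space_Y] using prolong_Cm prolong_small_cover prolong_bounded by blast

theorem U_eq_restrictions: "E U = {Comp f e | f. f \<in> E (US Y)}"
proof (intro equalityI subsetI)
  fix f assume f: "f \<in> E U"
  have "Comp (prolong f) e = f"
  proof (rule Fun_ext[OF Comp_pair(2)[OF Cm_Fun[OF e_Cm] Cm_Fun[OF prolong_Cm[OF f]]] Cm_Fun[OF U_Cm[OF f]]])
    fix x assume x: "x \<in> Pt X"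
    then show "Comp (prolong f) e \<bullet> x = f \<bullet> x"
      using Comp_val[OF Cm_Fun[OF e_Cm] Cm_Fun[OF prolong_Cm[OF f]] x] prolong_e[OF f x] by simp
  qed
  then show "f \<in> {Comp f e | f. f \<in> E (US Y)}"
    unfolding mem_Collect_eq using prolong_US[OF f] by (intro exI[of _ "prolong f"] conjI) simp_all
next
  fix f assume "f \<in> {Comp f e | f. f \<in> E (US Y)}"
  then show "f \<in> E U" using US_Comp[OF X space_Y _ e_Cm] by blast
qed

subsection \<open>Real characteristic functions\<close>

definition rchi :: "'a \<Rightarrow> 'a" where
  "rchi C = Lam (pts X) (\<lambda>x. if x \<in> E C then uni else nul)"

lemma definable_term_rchi [dfn]: "definable_term mem F \<Longrightarrow> definable_term mem (\<lambda>s. rchi (F s))"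
  by (rule definable_term_unary[where F = rchi]) (unfold rchi_def, intro dfn)

lemma rchi_val: "x \<in> Pt X \<Longrightarrow> rchi C \<bullet> x = (if x \<in> E C then uni else nul)"
  unfolding rchi_def by (rule Lam_val) (intro dfn)

text \<open>
  The cover by \<open>C\<close> and its complement shows that a characteristic function has countable clopen oscillation.
\<close>
lemma rchi_U:
  assumes C: "Clop C"
  shows "rchi C \<in> E U"
  unfolding US_iff[OF X]
proof (intro conjI allI impI)
  show "rchi C \<in> E (Cm X RS)"
  proof (rule CmI_local[OF X])
    show "rchi C \<in> E (Fun (pts X) (pts RS))"
      unfolding rchi_def by (rule Lam_in) (intro dfn, simp)
    fix x V assume x: "x \<in> Pt X" "rchi C \<bullet> x \<in> E V"
    obtain W where W: "W \<in> Op X" "x \<in> E W" "\<forall>u\<in>E W. u \<in> E C \<longleftrightarrow> x \<in> E C"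
      using clopen_local[OF X C x(1)] by (elim bexE conjE)
    have "rchi C \<bullet> u \<in> E V" if u: "u \<in> E W" for u
    proof -
      have "u \<in> Pt X" using open_subset[OF X W(1)] u by blast
      then show ?thesis using x bspec[OF W(3) u] by (simp add: rchi_val)
    qed
    then show "\<exists>W\<in>Op X. x \<in> E W \<and> (\<forall>u\<in>E W. rchi C \<bullet> u \<in> E V)" using W(1,2) by blast
  qed
  have "close uni (rchi C \<bullet> x) nul" if "x \<in> Pt X" for x
  proof -
    have "leR uni (uni \<boxplus> uni)" using le_plus_iff'[of nul uni uni] nul_le_uni by simp
    then have "leR nul (uni \<boxplus> uni)" using nul_le_uni le_trans by blast
    then show ?thesis using that nul_le_uni by (simp add: rchi_val close_def)
  qed
  then show "\<exists>b\<in>Rc. \<forall>x\<in>Pt X. close b (rchi C \<bullet> x) nul" using uni_in by blast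
  fix d assume d: "positive d"
  have "E (vunion mem (coll {C, compl C})) = Pt X"
    using Clop_subset[OF C] unfolding E_vunion by (auto simp: E_coll E_compl)
  then have "vunion mem (coll {C, compl C}) = pts X" by (rule E_eq)
  moreover have "rchi C \<bullet> x = uni" if "x \<in> E C" for x
    using rchi_val[of x C] Clop_subset[OF C] that by auto
  then have "small_on d (rchi C) C"
    unfolding small_on_def using close_refl[OF uni_in positive_in[OF d] positive_le[OF d]] by simp
  moreover have "rchi C \<bullet> x = nul" if "x \<in> E (compl C)" for x
    using rchi_val[of x C] that unfolding E_compl by simp
  then have "small_on d (rchi C) (compl C)"
    unfolding small_on_def using close_refl[OF nul_in positive_in[OF d] positive_le[OF d]] by simp
  ultimately have "small_cover X (rchi C) d (coll {C, compl C})"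
    unfolding small_cover_def using Fin_Ctb[OF Fin_doubleton[of C "compl C"]] C Clop_compl[OF C]
    by (simp add: E_coll)
  then show "\<exists>\<A>. small_cover X (rchi C) d \<A>" by blast
qed

text \<open>
  The limit of the characteristic function of \<open>C\<close> at \<open>p\<close> tells whether \<open>p\<close> holds at \<open>C\<close>; this makes \<open>to_Z\<close> invertible.
\<close>
lemma prolong_rchi:
  assumes C: "Clop C" and p: "p \<in> Pt Y"
  shows "prolong (rchi C) \<bullet> p = (if holds p C then uni else nul)"
proof (rule prolong_eqI[OF rchi_U[OF C] p])
  define D where "D = (if holds p C then C else compl C)"
  have D: "Clop D" "holds p D" unfolding D_def using C Clop_compl[OF C] holds_compl[OF p C] by simp_all
  have "close d (rchi C \<bullet> x) (if holds p C then uni else nul)" if "positive d" "x \<in> E D" for d x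
    using that Clop_subset[OF C] close_refl[OF uni_in] close_refl[OF nul_in] positive_in positive_le
    unfolding D_def by (auto simp: rchi_val E_compl split: if_splits)
  then show "lim (rchi C) p (if holds p C then uni else nul)"
    unfolding lim_def using D by auto
qed

subsection \<open>The extension by functions of countable clopen oscillation\<close>

lemma extension_eU: "is_extension mem X (Z, eU)"
proof -
  have sub: "E U \<subseteq> E (Cm X RS)" using U_Cm by blast
  have "is_extension mem X (eval_extension mem RS X U)"
  proof (rule eval_extension[OF X T1 is_space_RS sub])
    fix W x assume W: "W \<in> Op X" "x \<in> E W"
    then obtain A where A: "Clop A" "x \<in> E A" "E A \<subseteq> E W" using zero_dim unfolding zero_dimensional_def by blast
    have "x \<in> Pt X" using open_subset[OF X] W by blast
    then show "\<exists>f\<in>E U. \<exists>V\<in>Op RS. f \<bullet> x \<in> E V \<and> (\<forall>u\<in>Pt X. f \<bullet> u \<in> E V \<longrightarrow> u \<in> E W)"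
      using A uni_neq_nul
      by (intro bexI[OF _ rchi_U[OF A(1)]] bexI[OF _ open_punctured[OF nul_in]])
        (auto simp: E_punctured rchi_val split: if_splits)
  qed
  then show ?thesis by (simp add: eU_extension_def)
qed

lemmas space_Z = extensionD(1)[OF extension_eU]
lemmas eU_Cm = extensionD(2)[OF extension_eU]
lemmas eU_dense = extensionD(3)[OF extension_eU]
lemmas E_range_eU = extensionD(4)[OF extension_eU]

lemma U_sub: "E U \<subseteq> E (Cm X RS)"
  using U_Cm by blast

lemma eU_val: "x \<in> Pt X \<Longrightarrow> f \<in> E U \<Longrightarrow> eU \<bullet> x \<bullet> f = f \<bullet> x"
  unfolding eU_extension_def eval_extension_def by (simp add: eval_map_val[OF U_sub])

lemma Z_eq: "Z = Sub (Pow_sp RS U) (Cl (Pow_sp RS U) (Img eU (pts X)))"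
  by (simp add: eU_extension_def eval_extension_def)

lemma Z_Sub: "Sub (Pow_sp RS U) (pts Z) = Z"
  using Z_eq pts_Sub by metis

lemma Z_Fun: "z \<in> Pt Z \<Longrightarrow> z \<in> E (Fun U (pts RS))"
  using Cl_subset[of "Pow_sp RS U" "Img eU (pts X)"] by (subst (asm) Z_eq) auto

lemma Z_open: "f \<in> E U \<Longrightarrow> V \<in> Op RS \<Longrightarrow> coll {z \<in> Pt Z. z \<bullet> f \<in> E V} \<in> Op Z"
  using coord_open_Sub[of "pts Z" U RS f V] Z_Fun unfolding Z_Sub by blast

lemma Z_real: "z \<in> Pt Z \<Longrightarrow> f \<in> E U \<Longrightarrow> z \<bullet> f \<in> Rc"
  using val_in[OF Z_Fun] by simp

text \<open>
  Points of \<open>Z\<close> are approximated by points of \<open>X\<close> at two functions at once: closely at \<open>f\<close>, and at \<open>g\<close> up to an open set.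
\<close>
lemma Z_approx:
  assumes z: "z \<in> Pt Z" and f: "f \<in> E U" and g: "g \<in> E U" and d: "positive d"
    and V: "V \<in> Op RS" "z \<bullet> g \<in> E V"
  obtains x where "x \<in> Pt X" "close d (f \<bullet> x) (z \<bullet> f)" "g \<bullet> x \<in> E V"
proof -
  obtain W where W: "W \<in> Op RS" "z \<bullet> f \<in> E W" "\<And>y. y \<in> E W \<Longrightarrow> close d y (z \<bullet> f)"
    using open_inside_ball[OF Z_real[OF z f] d] by blast
  have op: "coll (E (coll {z \<in> Pt Z. z \<bullet> f \<in> E W}) \<inter> E (coll {z \<in> Pt Z. z \<bullet> g \<in> E V})) \<in> Op Z"
    by (rule open_Int[OF space_Z Z_open[OF f W(1)] Z_open[OF g V(1)]])
  have "E (coll (E (coll {z \<in> Pt Z. z \<bullet> f \<in> E W}) \<inter> E (coll {z \<in> Pt Z. z \<bullet> g \<in> E V}))) \<noteq> {}"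
    unfolding E_Int unfolding E_coord using z W(2) V(2) by blast
  from dense_meets[OF eU_dense space_Z op this]
  obtain q where "q \<in> E (Img eU (pts X))" "q \<bullet> f \<in> E W" "q \<bullet> g \<in> E V"
    unfolding E_Int unfolding E_coord by blast
  then obtain x where "x \<in> Pt X" "f \<bullet> x \<in> E W" "g \<bullet> x \<in> E V"
    unfolding E_range_eU using eU_val f g by auto
  then show thesis using that W(3) by blast
qed

text \<open>
  A value other than zero and one could be approximated by a value of the characteristic function that is
  not zero, hence by one.
\<close>
lemma Z_rchi:
  assumes z: "z \<in> Pt Z" and C: "Clop C"
  shows "z \<bullet> rchi C = nul \<or> z \<bullet> rchi C = uni"
proof (rule ccontr)
  assume not: "\<not> (z \<bullet> rchi C = nul \<or> z \<bullet> rchi C = uni)"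
  note r = rchi_U[OF C]
  note zR = Z_real[OF z r]
  have ne: "uni \<noteq> z \<bullet> rchi C" using not by auto
  obtain d where d: "positive d" "\<not> close d uni (z \<bullet> rchi C)" using eq_if_close[OF uni_in zR] ne by blast
  obtain x where "x \<in> Pt X" "close d (rchi C \<bullet> x) (z \<bullet> rchi C)" "rchi C \<bullet> x \<in> E (punctured nul)"
    using Z_approx[OF z r r d(1) open_punctured[OF nul_in]] not zR unfolding E_punctured by blast
  then show False using d(2) unfolding E_punctured by (auto simp: rchi_val split: if_splits)
qed

definition to_Z :: 'a where
  "to_Z = Lam (pts Y) (\<lambda>p. Lam U (\<lambda>f. prolong f \<bullet> p))"

lemma to_Z_facts:
  shows to_Z_Fun: "to_Z \<in> E (Fun (pts Y) (Fun U (pts RS)))"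
    and to_Z_val: "\<And>p f. p \<in> Pt Y \<Longrightarrow> f \<in> E U \<Longrightarrow> to_Z \<bullet> p \<bullet> f = prolong f \<bullet> p"
proof -
  have d1: "definable_term1 mem (\<lambda>p. Lam U (\<lambda>f. prolong f \<bullet> p))" by (intro dfn)
  have d2: "definable_term1 mem (\<lambda>f. prolong f \<bullet> p)" for p by (intro dfn)
  show "to_Z \<in> E (Fun (pts Y) (Fun U (pts RS)))"
    unfolding to_Z_def by (rule Lam_in[OF d1], rule Lam_in[OF d2]) (use prolong_real in simp)
  show "to_Z \<bullet> p \<bullet> f = prolong f \<bullet> p" if "p \<in> Pt Y" "f \<in> E U" for p f
    unfolding to_Z_def Lam_val[OF d1 that(1)] by (rule Lam_val[OF d2 that(2)])
qed

lemma to_Z_e: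
  assumes x: "x \<in> Pt X"
  shows "to_Z \<bullet> (e \<bullet> x) = eU \<bullet> x"
proof (rule Fun_ext[OF val_in[OF to_Z_Fun e_in[OF x]] Z_Fun[OF Cm_in[OF eU_Cm x]]])
  fix f assume f: "f \<in> E U"
  show "to_Z \<bullet> (e \<bullet> x) \<bullet> f = eU \<bullet> x \<bullet> f"
    using to_Z_val[OF e_in[OF x] f] prolong_e[OF f x] eU_val[OF x f] by simp
qed

lemma to_Z_Cm: "to_Z \<in> E (Cm Y Z)"
proof -
  have "to_Z \<in> E (Cm Y (Sub (Pow_sp RS U) (Cl (Pow_sp RS U) (Img eU (pts X)))))"
  proof (rule Cm_into_Cl[OF space_Y e_dense to_Z_Fun])
    fix f V assume f: "f \<in> E U" and V: "V \<in> Op RS"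
    have "{p \<in> Pt Y. to_Z \<bullet> p \<bullet> f \<in> E V} = {p \<in> Pt Y. prolong f \<bullet> p \<in> E V}" using to_Z_val f by auto
    then show "coll {p \<in> Pt Y. to_Z \<bullet> p \<bullet> f \<in> E V} \<in> Op Y" using Cm_vimage[OF prolong_Cm[OF f] V] by simp
  next
    fix q assume "q \<in> E (Img e (pts X))"
    then show "to_Z \<bullet> q \<in> E (Img eU (pts X))" unfolding E_range_e E_range_eU using to_Z_e by auto
  qed
  then show ?thesis by (simp only: Z_eq[symmetric])
qed

definition support :: "'a \<Rightarrow> 'a" where
  "support c = coll {x \<in> Pt X. c \<bullet> x = One}"

lemma definable_term_support [dfn]: "definable_term mem F \<Longrightarrow> definable_term mem (\<lambda>s. support (F s))"
  by (rule definable_term_unary[where F = support]) (unfold support_def, intro dfn)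

lemma support_chi:
  assumes C: "Clop C"
  shows "support (chi X C) = C"
proof (rule E_eq)
  have "E (support (chi X C)) = {x \<in> Pt X. chi X C \<bullet> x = One}"
    unfolding support_def by (rule E_sep) (intro dfn)
  then show "E (support (chi X C)) = E C" using Clop_subset[OF C] by (auto simp: chi_val split: if_splits)
qed

definition to_Y :: 'a where
  "to_Y = Lam (pts Z) (\<lambda>z. Lam (Cm X two) (\<lambda>c. if z \<bullet> rchi (support c) = uni then One else Zero))"

lemma to_Y_facts:
  shows to_Y_Fun: "to_Y \<in> E (Fun (pts Z) (Fun (Cm X two) (pts two)))"
    and to_Y_val: "\<And>z C. z \<in> Pt Z \<Longrightarrow> Clop C \<Longrightarrow> to_Y \<bullet> z \<bullet> chi X C = (if z \<bullet> rchi C = uni then One else Zero)"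
proof -
  have d1: "definable_term1 mem (\<lambda>z. Lam (Cm X two) (\<lambda>c. if z \<bullet> rchi (support c) = uni then One else Zero))"
    by (intro dfn)
  have d2: "definable_term1 mem (\<lambda>c. if z \<bullet> rchi (support c) = uni then One else Zero)" for z by (intro dfn)
  show "to_Y \<in> E (Fun (pts Z) (Fun (Cm X two) (pts two)))"
    unfolding to_Y_def by (rule Lam_in[OF d1], rule Lam_in[OF d2]) (simp add: Pt_two)
  show "to_Y \<bullet> z \<bullet> chi X C = (if z \<bullet> rchi C = uni then One else Zero)" if "z \<in> Pt Z" "Clop C" for z C
    unfolding to_Y_def Lam_val[OF d1 that(1)] Lam_val[OF d2 chi_in[OF that(2)]] support_chi[OF that(2)] ..
qed

lemma to_Y_eU:
  assumes x: "x \<in> Pt X"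
  shows "to_Y \<bullet> (eU \<bullet> x) = e \<bullet> x"
proof (rule Fun_ext[OF val_in[OF to_Y_Fun Cm_in[OF eU_Cm x]] Y_Fun[OF e_in[OF x]]])
  fix c assume c: "c \<in> E (Cm X two)"
  obtain C where C: "Clop C" "c = chi X C" using Cm_two_chi[OF X c] .
  show "to_Y \<bullet> (eU \<bullet> x) \<bullet> c = e \<bullet> x \<bullet> c"
    unfolding C(2) to_Y_val[OF Cm_in[OF eU_Cm x] C(1)] eU_val[OF x rchi_U[OF C(1)]] e_val[OF x chi_in[OF C(1)]]
    using x uni_neq_nul by (simp add: rchi_val chi_val)
qed

lemma to_Y_Cm: "to_Y \<in> E (Cm Z Y)"
proof -
  have "to_Y \<in> E (Cm Z (Sub (Pow_sp two (Cm X two)) (Cl (Pow_sp two (Cm X two)) (Img e (pts X)))))"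
  proof (rule Cm_into_Cl[OF space_Z eU_dense to_Y_Fun])
    fix c V assume c: "c \<in> E (Cm X two)" and V: "V \<in> Op two"
    obtain C where C: "Clop C" "c = chi X C" using Cm_two_chi[OF X c] .
    show "coll {z \<in> Pt Z. to_Y \<bullet> z \<bullet> c \<in> E V} \<in> Op Z"
    proof (rule open_sepI[OF space_Z])
      show "definable1 mem (\<lambda>z. to_Y \<bullet> z \<bullet> c \<in> E V)" by (intro dfn)
      fix z assume z: "z \<in> Pt Z" "to_Y \<bullet> z \<bullet> c \<in> E V"
      \<comment> \<open>near \<open>z\<close>, the coordinate of the characteristic function avoids the other value\<close>
      define a where "a = (if z \<bullet> rchi C = uni then nul else uni)"
      have aR: "a \<in> Rc" by (simp add: a_def)
      let ?W = "coll {q \<in> Pt Z. q \<bullet> rchi C \<in> E (punctured a)}"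
      have W: "?W \<in> Op Z" by (rule Z_open[OF rchi_U[OF C(1)] open_punctured[OF aR]])
      have EW: "E ?W = {q \<in> Pt Z. q \<bullet> rchi C \<in> Rc \<and> q \<bullet> rchi C \<noteq> a}" unfolding E_coord unfolding E_punctured by blast
      have "z \<in> E ?W" unfolding EW unfolding a_def using z(1) Z_real[OF z(1) rchi_U[OF C(1)]] uni_neq_nul by auto
      moreover have "to_Y \<bullet> q \<bullet> c \<in> E V" if q: "q \<in> E ?W" for q
      proof -
        have q': "q \<in> Pt Z" "q \<bullet> rchi C \<noteq> a" using q unfolding EW by blast+
        have "q \<bullet> rchi C = uni \<longleftrightarrow> z \<bullet> rchi C = uni"
          using Z_rchi[OF q'(1) C(1)] Z_rchi[OF z(1) C(1)] q'(2) unfolding a_def by (auto split: if_splits)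
        then have "to_Y \<bullet> q \<bullet> c = to_Y \<bullet> z \<bullet> c" unfolding C(2) to_Y_val[OF q'(1) C(1)] to_Y_val[OF z(1) C(1)] by simp
        then show ?thesis using z(2) by simp
      qed
      ultimately show "\<exists>W\<in>Op Z. z \<in> E W \<and> (\<forall>q\<in>E W. to_Y \<bullet> q \<bullet> c \<in> E V)" using W by blast
    qed
  next
    fix q assume "q \<in> E (Img eU (pts X))"
    then show "to_Y \<bullet> q \<in> E (Img e (pts X))" unfolding E_range_e E_range_eU using to_Y_eU by auto
  qed
  then show ?thesis by (simp only: Y_eq[symmetric])
qed

lemma to_Y_to_Z:
  assumes p: "p \<in> Pt Y"
  shows "to_Y \<bullet> (to_Z \<bullet> p) = p"
proof (rule Y_ext)
  note zp = Cm_in[OF to_Z_Cm p]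
  show "to_Y \<bullet> (to_Z \<bullet> p) \<in> Pt Y" by (rule Cm_in[OF to_Y_Cm zp])
  fix C assume C: "Clop C"
  show "holds (to_Y \<bullet> (to_Z \<bullet> p)) C \<longleftrightarrow> holds p C"
    unfolding holds_def[of "to_Y \<bullet> (to_Z \<bullet> p)"] to_Y_val[OF zp C] to_Z_val[OF p rchi_U[OF C]] prolong_rchi[OF C p]
    using uni_neq_nul by auto
qed (rule p)

text \<open>
  Let \<open>v\<close> be the limit of \<open>f\<close> at the point of \<open>Y\<close> given by \<open>z\<close>.  On some \<open>C\<close> with \<open>z (rchi C) = uni\<close> the function \<open>f\<close> is close to \<open>v\<close>.
  Approximating \<open>z\<close> at \<open>f\<close> and at the characteristic function of \<open>C\<close> gives a point of \<open>C\<close> at which \<open>f\<close> is close to \<open>z f\<close> as well.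
\<close>
lemma to_Z_to_Y:
  assumes z: "z \<in> Pt Z"
  shows "to_Z \<bullet> (to_Y \<bullet> z) = z"
proof -
  define p where "p = to_Y \<bullet> z"
  have p: "p \<in> Pt Y" unfolding p_def by (rule Cm_in[OF to_Y_Cm z])
  show ?thesis
  proof (rule Fun_ext[OF Z_Fun[OF Cm_in[OF to_Z_Cm]] Z_Fun[OF z]])
    show "to_Y \<bullet> z \<in> Pt Y" using p by (simp add: p_def)
    fix f assume f: "f \<in> E U"
    have "prolong f \<bullet> p = z \<bullet> f"
    proof (rule eq_if_close[OF prolong_real[OF f p] Z_real[OF z f]])
      fix d assume "positive d"
      then obtain h where h: "positive h" "h \<boxplus> h = d" using half by blast
      obtain C where C: "Clop C" "holds p C" "\<forall>x\<in>E C. close h (f \<bullet> x) (prolong f \<bullet> p)"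
        using lim_prolong[OF f p] h(1) unfolding lim_def by blast
      have zC: "z \<bullet> rchi C = uni"
        using C(2) unfolding holds_def p_def to_Y_val[OF z C(1)] by (simp split: if_splits)
      have zV: "z \<bullet> rchi C \<in> E (punctured nul)" unfolding E_punctured zC using uni_neq_nul by simp
      obtain x where x: "x \<in> Pt X" "close h (f \<bullet> x) (z \<bullet> f)" "rchi C \<bullet> x \<in> E (punctured nul)"
        using Z_approx[OF z f rchi_U[OF C(1)] h(1) open_punctured[OF nul_in] zV] .
      have "x \<in> E C" using x(3) rchi_val[OF x(1), of C] unfolding E_punctured by (simp split: if_splits)
      then have "close h (prolong f \<bullet> p) (f \<bullet> x)" using C(3) close_sym by blast
      then show "close d (prolong f \<bullet> p) (z \<bullet> f)"
        using close_double[OF _ x(2) h(2,1) prolong_real[OF f p] U_real[OF f x(1)] Z_real[OF z f]] by blast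
    qed
    then show "to_Z \<bullet> (to_Y \<bullet> z) \<bullet> f = z \<bullet> f" using to_Z_val[OF p f] by (simp add: p_def)
  qed
qed

theorem extensions_equivalent:
  "equivalent_extensions mem X (e2_extension mem X) (eU_extension mem R X)"
proof -
  have "homeomorphism mem Y Z to_Z"
    by (rule homeomorphismI[OF space_Y to_Z_Cm to_Y_Cm to_Y_to_Z to_Z_to_Y])
  moreover have "Comp to_Z e = eU"
  proof (rule Fun_ext[OF Comp_pair(2)[OF Cm_Fun[OF e_Cm] Cm_Fun[OF to_Z_Cm]] Cm_Fun[OF eU_Cm]])
    fix x assume x: "x \<in> Pt X"
    show "Comp to_Z e \<bullet> x = eU \<bullet> x"
      using Comp_val[OF Cm_Fun[OF e_Cm] Cm_Fun[OF to_Z_Cm] x] to_Z_e[OF x] by simp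
  qed
  ultimately show ?thesis
    unfolding equivalent_extensions_def using extension_e2 extension_eU by auto
qed

subsection \<open>The Banaschewski compactification\<close>

lemma compact_Y_iff_Z: "compact_space mem Y \<longleftrightarrow> compact_space mem Z"
proof
  assume c: "compact_space mem Y"
  show "compact_space mem Z"
    by (rule compact_image[OF space_Y space_Z to_Z_Cm _ c]) (use to_Z_to_Y Cm_in[OF to_Y_Cm] in blast)
next
  assume c: "compact_space mem Z"
  show "compact_space mem Y"
    by (rule compact_image[OF space_Z space_Y to_Y_Cm _ c]) (use to_Y_to_Z Cm_in[OF to_Z_Cm] in blast)
qed

text \<open>
  A clopen set of \<open>Y\<close> and the hat of its trace on \<open>X\<close> have the same trace on the dense image of \<open>X\<close>.
\<close>
lemma clopen_eq_hat:
  assumes A: "clopen mem Y A"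
  shows "A = hat (coll {x \<in> Pt X. e \<bullet> x \<in> E A})"
proof -
  let ?C = "coll {x \<in> Pt X. e \<bullet> x \<in> E A}"
  have C: "Clop ?C" by (rule clopen_vimage[OF X space_Y e_Cm A])
  show ?thesis
  proof (rule dense_clopen_eq[OF space_Y e_dense A clopen_hat[OF C]])
    fix q assume "q \<in> E (Img e (pts X))"
    then obtain x where x: "x \<in> Pt X" "q = e \<bullet> x" unfolding E_range_e by blast
    show "q \<in> E A \<longleftrightarrow> q \<in> E (hat ?C)"
      unfolding E_hat x(2) using holds_e[OF x(1) C] e_in[OF x(1)] x(1) unfolding E_vimage by blast
  qed
qed

text \<open>
  \<open>Y\<close> is zero-dimensional because a basic open set is a finite intersection of subbasic sets, and these
  are clopen as the two-point space is discrete.  The universal property is \<open>extend_to_compact\<close>.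
\<close>
lemma banaschewski_Y:
  assumes comp: "compact_space mem Y"
  shows "banaschewski_compactification mem X (Y, e)"
  unfolding banaschewski_compactification_def fst_conv snd_conv
proof (intro conjI allI impI ballI extension_e2 comp)
  show "T1 mem Y"
    unfolding T1_def
  proof (intro ballI impI)
    fix p q assume pq: "p \<in> Pt Y" "q \<in> Pt Y" "p \<noteq> q"
    then obtain C where C: "Clop C" "\<not> (holds p C \<longleftrightarrow> holds q C)" using Y_ext by blast
    define D where "D = (if holds p C then C else compl C)"
    have D: "Clop D" "holds p D" "\<not> holds q D"
      using C Clop_compl[OF C(1)] holds_compl[OF pq(1) C(1)] holds_compl[OF pq(2) C(1)] by (auto simp: D_def)
    then show "\<exists>U\<in>Op Y. p \<in> E U \<and> q \<notin> E U"
      using clopen_hat[OF D(1)] pq(1) unfolding clopen_def by (intro bexI[of _ "hat D"]) (simp_all add: E_hat)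
  qed
  show "zero_dimensional mem Y"
    unfolding zero_dimensional_def
  proof (intro ballI)
    fix U p assume U: "U \<in> Op Y" "p \<in> E U"
    define I where "I = Cm X two"
    obtain W where W: "W \<in> Op (Pow_sp two I)" "E U = E W \<inter> Pt Y"
      using U(1) Sub_open_iff[of U "Pow_sp two I" "pts Y"] unfolding I_def Y_Sub by blast
    then have "p \<in> E W" using U(2) by blast
    then obtain F where F: "Fin F" "\<forall>B\<in>E F. \<exists>i\<in>E I. \<exists>V\<in>Op two. B = subbasic two I i V" "\<forall>B\<in>E F. p \<in> E B"
        "\<forall>q\<in>E (Fun I (pts two)). (\<forall>B\<in>E F. q \<in> E B) \<longrightarrow> q \<in> E W"
      using W(1) unfolding Pow_open_iff by blast
    have d: "definable2 mem (\<lambda>q B. q \<in> E B)" by (intro dfn)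
    have tr: "clopen mem Y (coll {q \<in> Pt Y. q \<in> E B})" if B: "B \<in> E F" for B
    proof -
      obtain i V where iV: "i \<in> E I" "V \<in> Op two" "B = subbasic two I i V" using F(2) B by blast
      have Bq: "q \<in> E B \<longleftrightarrow> q \<bullet> i \<in> E V" if "q \<in> Pt Y" for q
        unfolding iV(3) E_coord using Y_Fun[OF that] unfolding I_def by blast
      have sub: "Pt Y \<subseteq> E (Fun I (pts two))" unfolding I_def using Y_Fun by blast
      have op: "coll {q \<in> Pt Y. q \<bullet> i \<in> E V'} \<in> Op Y" if "V' \<in> Op two" for V'
        using coord_open_Sub[OF sub iV(1) that] unfolding I_def Y_Sub .
      let ?V' = "coll {v \<in> Pt two. v \<notin> E V}"
      have EV': "E ?V' = {v \<in> Pt two. v \<notin> E V}" by (rule E_sep) (intro dfn)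
      have V': "?V' \<in> Op two" unfolding Op_two EV' using Pt_two by blast
      have "q \<bullet> i \<in> Pt two" if "q \<in> Pt Y" for q using val_in[OF Y_Fun[OF that]] iV(1) unfolding I_def by blast
      then have eq1: "{q \<in> Pt Y. q \<notin> E (coll {q \<in> Pt Y. q \<in> E B})} = {q \<in> Pt Y. q \<bullet> i \<in> E ?V'}"
        unfolding E_sep[OF definable_in_E[OF definable_term_var definable_term_const]] EV' using Bq by blast
      have eq2: "{q \<in> Pt Y. q \<in> E B} = {q \<in> Pt Y. q \<bullet> i \<in> E V}" using Bq by blast
      show ?thesis unfolding clopen_iff[OF space_Y] eq1 unfolding eq2 using op[OF iV(2)] op[OF V'] by blast
    qed
    have EB: "E (coll {q \<in> Pt Y. q \<in> E B}) = {q \<in> Pt Y. q \<in> E B}" for B by (rule E_sep) (intro dfn)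
    let ?A = "coll {q \<in> Pt Y. \<forall>B\<in>E F. q \<in> E B}"
    have EA: "E ?A = {q \<in> Pt Y. \<forall>B\<in>E F. q \<in> E B}" by (rule E_sep) (intro dfn)
    have "?A \<in> Op Y"
      by (rule open_Fin_inter[OF space_Y F(1) d]) (use tr in \<open>auto simp: clopen_def\<close>)
    moreover have "coll {q \<in> Pt Y. q \<notin> E ?A} \<in> Op Y"
    proof (rule open_sepI[OF space_Y])
      show "definable1 mem (\<lambda>q. q \<notin> E ?A)" by (intro dfn)
      fix q assume q: "q \<in> Pt Y" "q \<notin> E ?A"
      then obtain B where B: "B \<in> E F" "q \<notin> E B" unfolding EA by blast
      let ?O = "coll {q \<in> Pt Y. q \<notin> E (coll {q \<in> Pt Y. q \<in> E B})}"
      have "?O \<in> Op Y" using tr[OF B(1)] unfolding clopen_iff[OF space_Y] by blast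
      moreover have "E ?O = {q \<in> Pt Y. q \<notin> E (coll {q \<in> Pt Y. q \<in> E B})}" by (rule E_sep) (intro dfn)
      then have "E ?O = {q \<in> Pt Y. q \<notin> E B}" unfolding EB by blast
      ultimately show "\<exists>W\<in>Op Y. q \<in> E W \<and> (\<forall>u\<in>E W. u \<notin> E ?A)" unfolding EA using q(1) B by blast
    qed
    ultimately have "clopen mem Y ?A" unfolding clopen_iff[OF space_Y] by blast
    moreover have "p \<in> E ?A" unfolding EA using F(3) U open_subset[OF space_Y] by blast
    moreover have "E ?A \<subseteq> E U" unfolding EA W(2) using F(4) Y_Fun unfolding I_def by blast
    ultimately show "\<exists>A. clopen mem Y A \<and> p \<in> E A \<and> E A \<subseteq> E U" by blast
  qed
  fix K f assume K: "is_space mem K \<and> compact_space mem K \<and> zero_dimensional mem K \<and> T1 mem K"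
    and f: "f \<in> E (Cm X K)"
  then obtain g where g: "g \<in> E (Cm Y K)" "\<And>x. x \<in> Pt X \<Longrightarrow> g \<bullet> (e \<bullet> x) = f \<bullet> x"
    using extend_to_compact[of K f] by blast
  have "Comp g e = f"
  proof (rule Fun_ext[OF Comp_pair(2)[OF Cm_Fun[OF e_Cm] Cm_Fun[OF g(1)]] Cm_Fun[OF f]])
    fix x assume x: "x \<in> Pt X"
    show "Comp g e \<bullet> x = f \<bullet> x" using Comp_val[OF Cm_Fun[OF e_Cm] Cm_Fun[OF g(1)] x] g(2)[OF x] by simp
  qed
  then show "\<exists>g\<in>E (Cm Y K). Comp g e = f" using g(1) by blast
qed

text \<open>
  The universal property for the two-point space makes every clopen set of \<open>X\<close> the trace of a clopen set \<open>D\<close> of \<open>B\<close>,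
  and density makes \<open>D\<close> unique, so that it depends definably on its trace.  Membership in \<open>D\<close> gives the coordinates of
  \<open>\<phi> : B \<rightarrow> Y\<close>.  The embedding of \<open>X\<close> in \<open>B\<close> extends to \<open>g : Y \<rightarrow> B\<close>, and \<open>\<phi> \<circ> g\<close> is the identity
  because the preimage of \<open>D\<close> under \<open>g\<close> is the hat of the trace of \<open>D\<close>.
\<close>
lemma compact_if_banaschewski:
  assumes ban: "banaschewski_compactification mem X (B, h)"
  shows "compact_space mem Y"
proof -
  have ext: "is_extension mem X (B, h)" and comp: "compact_space mem B" and zd: "zero_dimensional mem B" and T1B: "T1 mem B"
    using ban unfolding banaschewski_compactification_def by auto
  have univ: "\<And>K f. is_space mem K \<Longrightarrow> compact_space mem K \<Longrightarrow> zero_dimensional mem K \<Longrightarrow> T1 mem K \<Longrightarrow>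
      f \<in> E (Cm X K) \<Longrightarrow> \<exists>g\<in>E (Cm B K). Comp g h = f"
    using ban unfolding banaschewski_compactification_def by simp
  note B = extensionD(1)[OF ext] and h = extensionD(2)[OF ext] and dense = extensionD(3)[OF ext] and range = extensionD(4)[OF ext]
  have h_in: "h \<bullet> x \<in> Pt B" if "x \<in> Pt X" for x by (rule Cm_in[OF h that])
  define trace where "trace D = coll {x \<in> Pt X. h \<bullet> x \<in> E D}" for D
  have Etrace: "E (trace D) = {x \<in> Pt X. h \<bullet> x \<in> E D}" for D unfolding trace_def by (rule E_vimage)
  have dtrace: "definable_term1 mem trace" unfolding trace_def by (intro dfn)
  note dtrace' = definable_term_unary[OF dtrace]
  have ex: "\<exists>D. clopen mem B D \<and> trace D = C" if C: "Clop C" for C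
  proof -
    obtain g where g: "g \<in> E (Cm B two)" "Comp g h = chi X C"
      using univ[OF is_space_two compact_two zero_dimensional_two T1_two chi_in[OF C]] by blast
    have gh: "g \<bullet> (h \<bullet> x) = (if x \<in> E C then One else Zero)" if x: "x \<in> Pt X" for x
      using Comp_val[OF Cm_Fun[OF h] Cm_Fun[OF g(1)] x] chi_val[OF x, of C] unfolding g(2) by simp
    let ?D = "coll {b \<in> Pt B. g \<bullet> b \<in> E (coll {One})}"
    have D: "clopen mem B ?D" by (rule clopen_vimage[OF B is_space_two g(1)]) (simp add: clopen_two E_coll)
    have One: "E (coll {One}) = {One}" by (simp add: E_coll)
    have "E (trace ?D) = {x \<in> Pt X. h \<bullet> x \<in> Pt B \<and> g \<bullet> (h \<bullet> x) \<in> {One}}"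
      unfolding Etrace E_vimage unfolding One by blast
    also have "\<dots> = E C" using h_in gh Clop_subset[OF C] by (auto split: if_splits)
    finally have "trace ?D = C" by (rule E_eq)
    with D show ?thesis by blast
  qed
  have uniq: "D = D'" if "clopen mem B D" "clopen mem B D'" "trace D = trace D'" for D D'
  proof (rule dense_clopen_eq[OF B dense that(1,2)])
    fix q assume "q \<in> E (Img h (pts X))"
    then obtain x where x: "x \<in> Pt X" "q = h \<bullet> x" unfolding range by blast
    have "x \<in> E (trace D) \<longleftrightarrow> x \<in> E (trace D')" using that(3) by simp
    then show "q \<in> E D \<longleftrightarrow> q \<in> E D'" unfolding Etrace x(2) using x(1) by blast
  qed
  define mark where "mark b c \<longleftrightarrow> (\<exists>D. clopen mem B D \<and> trace D = support c \<and> b \<in> E D)" for b c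
  have dmark: "definable2 mem mark" unfolding mark_def by (intro dfn dtrace')
  note dmark' = definable_binary[OF dmark]
  define \<phi> where "\<phi> = Lam (pts B) (\<lambda>b. Lam (Cm X two) (\<lambda>c. if mark b c then One else Zero))"
  have d1: "definable_term1 mem (\<lambda>b. Lam (Cm X two) (\<lambda>c. if mark b c then One else Zero))" by (intro dfn dmark')
  have d2: "definable_term1 mem (\<lambda>c. if mark b c then One else Zero)" for b by (intro dfn dmark')
  have \<phi>F: "\<phi> \<in> E (Fun (pts B) (Fun (Cm X two) (pts two)))"
    unfolding \<phi>_def by (rule Lam_in[OF d1], rule Lam_in[OF d2]) (simp add: Pt_two)
  have mark: "mark b (chi X (trace D)) \<longleftrightarrow> b \<in> E D" if D: "clopen mem B D" for b D
  proof -
    have C: "Clop (trace D)" unfolding trace_def by (rule clopen_vimage[OF X B h D])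
    show ?thesis unfolding mark_def support_chi[OF C] using uniq D by blast
  qed
  have \<phi>val: "\<phi> \<bullet> b \<bullet> chi X (trace D) = (if b \<in> E D then One else Zero)" if b: "b \<in> Pt B" and D: "clopen mem B D" for b D
  proof -
    have C: "Clop (trace D)" unfolding trace_def by (rule clopen_vimage[OF X B h D])
    show ?thesis unfolding \<phi>_def Lam_val[OF d1 b] Lam_val[OF d2 chi_in[OF C]] mark[OF D] ..
  qed
  have coord: "coll {b \<in> Pt B. \<phi> \<bullet> b \<bullet> c \<in> E V} \<in> Op B" if c: "c \<in> E (Cm X two)" for c V
  proof (rule open_sepI[OF B])
    show "definable1 mem (\<lambda>b. \<phi> \<bullet> b \<bullet> c \<in> E V)" by (intro dfn)
    fix b assume b: "b \<in> Pt B" "\<phi> \<bullet> b \<bullet> c \<in> E V"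
    obtain C where C: "Clop C" "c = chi X C" using Cm_two_chi[OF X c] .
    obtain D where D: "clopen mem B D" "trace D = C" using ex[OF C(1)] by blast
    obtain W where W: "W \<in> Op B" "b \<in> E W" "\<forall>w\<in>E W. w \<in> E D \<longleftrightarrow> b \<in> E D"
      using clopen_local[OF B D(1) b(1)] by (elim bexE conjE)
    have "\<phi> \<bullet> w \<bullet> c \<in> E V" if w: "w \<in> E W" for w
    proof -
      have "w \<in> Pt B" using open_subset[OF B W(1)] w by blast
      then show ?thesis
        using b(2) bspec[OF W(3) w] unfolding C(2) D(2)[symmetric] \<phi>val[OF b(1) D(1)] by (simp add: \<phi>val[OF _ D(1)])
    qed
    then show "\<exists>W\<in>Op B. b \<in> E W \<and> (\<forall>w\<in>E W. \<phi> \<bullet> w \<bullet> c \<in> E V)" using W(1,2) by blast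
  qed
  have \<phi>h: "\<phi> \<bullet> (h \<bullet> x) = e \<bullet> x" if x: "x \<in> Pt X" for x
  proof (rule Fun_ext[OF val_in[OF \<phi>F h_in[OF x]] Y_Fun[OF e_in[OF x]]])
    fix c assume c: "c \<in> E (Cm X two)"
    obtain C where C: "Clop C" "c = chi X C" using Cm_two_chi[OF X c] .
    obtain D where D: "clopen mem B D" "trace D = C" using ex[OF C(1)] by blast
    have "h \<bullet> x \<in> E D \<longleftrightarrow> x \<in> E C" using x unfolding D(2)[symmetric] Etrace by blast
    then show "\<phi> \<bullet> (h \<bullet> x) \<bullet> c = e \<bullet> x \<bullet> c"
      using \<phi>val[OF h_in[OF x] D(1)] e_val[OF x c] chi_val[OF x, of C] unfolding C(2) D(2) by simp
  qed
  have "\<phi> \<in> E (Cm B (Sub (Pow_sp two (Cm X two)) (Cl (Pow_sp two (Cm X two)) (Img e (pts X)))))"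
  proof (rule Cm_into_Cl[OF B dense \<phi>F coord])
    fix q assume "q \<in> E (Img h (pts X))"
    then show "\<phi> \<bullet> q \<in> E (Img e (pts X))" unfolding E_range_e range using \<phi>h by auto
  qed
  then have \<phi>: "\<phi> \<in> E (Cm B Y)" by (simp only: Y_eq[symmetric])
  obtain g where g: "g \<in> E (Cm Y B)" "\<And>x. x \<in> Pt X \<Longrightarrow> g \<bullet> (e \<bullet> x) = h \<bullet> x"
    using extend_to_compact[OF B comp zd T1B h] by blast
  have \<phi>g: "\<phi> \<bullet> (g \<bullet> p) = p" if p: "p \<in> Pt Y" for p
  proof (rule Y_ext)
    have gp: "g \<bullet> p \<in> Pt B" by (rule Cm_in[OF g(1) p])
    show "\<phi> \<bullet> (g \<bullet> p) \<in> Pt Y" by (rule Cm_in[OF \<phi> gp])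
    fix C assume C: "Clop C"
    obtain D where D: "clopen mem B D" "trace D = C" using ex[OF C] by blast
    let ?A = "coll {q \<in> Pt Y. g \<bullet> q \<in> E D}"
    have A: "clopen mem Y ?A" by (rule clopen_vimage[OF space_Y B g(1) D(1)])
    have "{x \<in> Pt X. e \<bullet> x \<in> E ?A} = E C"
      unfolding D(2)[symmetric] Etrace E_vimage using g(2) e_in by auto
    then have "?A = hat C" using clopen_eq_hat[OF A] by simp
    then have "g \<bullet> p \<in> E D \<longleftrightarrow> holds p C" using p E_vimage[of "pts Y" g D] E_hat[of C] by auto
    moreover have "holds (\<phi> \<bullet> (g \<bullet> p)) C \<longleftrightarrow> g \<bullet> p \<in> E D"
      using \<phi>val[OF gp D(1)] unfolding holds_def D(2) by simp
    ultimately show "holds (\<phi> \<bullet> (g \<bullet> p)) C \<longleftrightarrow> holds p C" by blast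
  qed (rule p)
  show ?thesis
    by (rule compact_image[OF B space_Y \<phi> _ comp]) (use \<phi>g Cm_in[OF g(1)] in blast)
qed

theorem banaschewski_exists_iff:
  "(\<exists>B. banaschewski_compactification mem X B) \<longleftrightarrow> compact_space mem Z"
  unfolding compact_Y_iff_Z[symmetric]
proof
  assume "\<exists>B. banaschewski_compactification mem X B"
  then obtain B h where "banaschewski_compactification mem X (B, h)" by auto
  then show "compact_space mem Y" by (rule compact_if_banaschewski)
next
  assume "compact_space mem Y"
  then show "\<exists>B. banaschewski_compactification mem X B" using banaschewski_Y by blast
qed

end

theorem theorem2p16:
  fixes mem :: "'a \<Rightarrow> 'a \<Rightarrow> bool" and R :: "'a ofield" and X :: "'a space"
  assumes "ZF mem"
    and "complete_ordered_field mem R"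
    and "is_space mem X" and "elts mem (pts X) \<noteq> {}"
    and "zero_dimensional mem X" and "T1 mem X"
  shows "equivalent_extensions mem X (e2_extension mem X) (eU_extension mem R X) \<and>
    elts mem (U_countable_bounded mem R X) =
      {vcomp mem f (snd (e2_extension mem X)) | f.
         f \<in> elts mem (U_countable_bounded mem R (fst (e2_extension mem X)))} \<and>
    ((\<exists>B. banaschewski_compactification mem X B) \<longleftrightarrow>
       compact_space mem (fst (eU_extension mem R X)))"
proof -
  interpret ZF mem by (rule assms(1))
  interpret comparison mem X R by unfold_locales (rule assms)+
  show ?thesis using extensions_equivalent U_eq_restrictions banaschewski_exists_iff by blast
qed

end
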